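(* Let $p$ be an odd prime number, let $G$ be a semi-extraspecial $p$-group, and write $|G:G'| = p^{2a}$ with $a$ a positive integer. Then $G$ possesses an automorphism of order $|G:G'|-1$ if and only if $G$ is isomorphic to a Sylow $p$-subgroup of $\mathrm{SL}_3(p^a)$.
   Context: All groups are finite. $G'$ denotes the derived subgroup of $G$ and $Z(G)$ its center. A $p$-group $E$ is called extraspecial if $|E'| = |Z(E)| = p$. A nontrivial $p$-group $G$ is called semi-extraspecial if $G/N$ is extraspecial for every maximal subgroup $N$ of $Z(G)$. It is known that for a semi-extraspecial $p$-group $G$ one has $G' = Z(G) = \Phi(G)$ (the Frattini subgroup), and that $|G:G'| = |G:Z(G)| = p^{2a}$ for some positive integer $a$. For a prime power $q$, $\mathrm{SL}_n(q)$ denotes the group of $n\times n$ matrices of determinant $1$ over the field $\mathbb{F}_q$ with $q$ elements. *)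

theory Defs
  imports
    "HOL-Algebra.Bij"
    "HOL-Algebra.Generated_Groups"
    "HOL-Algebra.Multiplicative_Group"
    "HOL-Library.Cardinality"
    "Jordan_Normal_Form.Determinant"
begin

definition center :: "('g, 'm) monoid_scheme \<Rightarrow> 'g set" where
  "center G = {z \<in> carrier G. \<forall>x\<in>carrier G. z \<otimes>\<^bsub>G\<^esub> x = x \<otimes>\<^bsub>G\<^esub> z}"

abbreviation derived_subgroup :: "('g, 'm) monoid_scheme \<Rightarrow> 'g set" where
  "derived_subgroup G \<equiv> derived G (carrier G)"

abbreviation subgroup_index :: "('g, 'm) monoid_scheme \<Rightarrow> 'g set \<Rightarrow> nat" where
  "subgroup_index G H \<equiv> card (rcosets\<^bsub>G\<^esub> H)"

definition maximal_subgroup :: "'g set \<Rightarrow> ('g, 'm) monoid_scheme \<Rightarrow> bool" where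
  "maximal_subgroup M G \<longleftrightarrow> subgroup M G \<and> M \<noteq> carrier G \<and>
     (\<forall>H. subgroup H G \<longrightarrow> M \<subseteq> H \<longrightarrow> H = M \<or> H = carrier G)"

text \<open>Finiteness is implied: \<open>order G\<close> is \<open>0\<close> when the carrier is infinite.\<close>

definition p_group :: "nat \<Rightarrow> ('g, 'm) monoid_scheme \<Rightarrow> bool" where
  "p_group p G \<longleftrightarrow> Factorial_Ring.prime p \<and> group G \<and> (\<exists>n. Coset.order G = p ^ n)"

definition extraspecial :: "nat \<Rightarrow> ('g, 'm) monoid_scheme \<Rightarrow> bool" where
  "extraspecial p E \<longleftrightarrow> p_group p E \<and> card (derived_subgroup E) = p \<and> card (center E) = p"

definition semi_extraspecial :: "nat \<Rightarrow> ('g, 'm) monoid_scheme \<Rightarrow> bool" where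
  "semi_extraspecial p G \<longleftrightarrow> p_group p G \<and> carrier G \<noteq> {\<one>\<^bsub>G\<^esub>} \<and>
     (\<forall>N. maximal_subgroup N (G\<lparr>carrier := center G\<rparr>) \<longrightarrow> extraspecial p (G Mod N))"

definition sylow_subgroup :: "nat \<Rightarrow> 'g set \<Rightarrow> ('g, 'm) monoid_scheme \<Rightarrow> bool" where
  "sylow_subgroup p P G \<longleftrightarrow> subgroup P G \<and> card P = p ^ multiplicity p (Coset.order G)"

text \<open>The field is given by its type.\<close>

definition SL :: "'k::field itself \<Rightarrow> nat \<Rightarrow> 'k mat monoid" where
  "SL _ n = \<lparr>carrier = {A \<in> carrier_mat n n. det A = 1}, monoid.mult = (*), one = 1\<^sub>m n\<rparr>"

lemma group_SL: "group (SL TYPE('k::field) n)"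
proof (rule groupI)
  fix A assume "A \<in> carrier (SL TYPE('k) n)"
  then have A: "A \<in> carrier_mat n n" "det A = 1" by (auto simp: SL_def)
  then have "A \<in> Units (ring_mat TYPE('k) n ())"
    by (intro det_non_zero_imp_unit) auto
  then obtain B where B: "B \<in> carrier_mat n n" "B * A = 1\<^sub>m n"
    by (auto simp: Units_def ring_mat_def)
  then have "det B = 1" using A det_mult[of B n A] by simp
  with B show "\<exists>B\<in>carrier (SL TYPE('k) n). B \<otimes>\<^bsub>SL TYPE('k) n\<^esub> A = \<one>\<^bsub>SL TYPE('k) n\<^esub>"
    by (auto simp: SL_def)
qed (auto simp: SL_def det_mult)

end

theory Submission
  imports Defs "HOL-Algebra.Group_Action" "HOL-Algebra.Sylow" "HOL-Library.Product_Plus"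
begin

text \<open>
  Let \<open>q = p^a\<close> and let \<open>\<sigma>\<close> be an automorphism of \<open>G\<close> of order
  \<open>q^2 - 1\<close>. This order is prime to \<open>p\<close>, so \<open>\<sigma>\<close> acts faithfully on
  \<open>V = G / Z(G)\<close>. An invariant subgroup of order \<open>r\<close> strictly between \<open>1\<close> and
  \<open>V\<close> would give \<open>\<sigma>\<close> an order at most \<open>(r - 1) (q^2 / r - 1) < q^2 - 1\<close>; hence
  \<open>V\<close> is irreducible, and a nonzero additive eigenfunctional identifies it with the field
  \<open>K\<close> of \<open>q^2\<close> elements, \<open>\<sigma>\<close> becoming multiplication by a generator
  \<open>\<lambda>\<close> of the multiplicative group.

  In a semi-extraspecial group \<open>[x, G] = Z(G)\<close> for every noncentral \<open>x\<close>. Composing the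
  commutator map \<open>V \<times> V \<rightarrow> Z(G)\<close> with an eigenfunctional \<open>Z(G) \<rightarrow> K\<close> of
  eigenvalue \<open>\<mu>\<close> yields an alternating form \<open>B\<close> with
  \<open>B(\<lambda>x, \<lambda>y) = \<mu> B(x, y)\<close> for which all images \<open>B(x, K)\<close>, \<open>x \<noteq> 0\<close>,
  coincide. Multiplication by \<open>\<mu>\<close> maps this image to itself, so \<open>\<mu>\<close> lies in a proper
  subfield and \<open>\<mu>^t = 1\<close> for some \<open>t \<le> q - 1\<close>. Now \<open>\<lambda>^t\<close> preserves \<open>B\<close>, so
  its powers have adjoints, hence all of \<open>K\<close> does; taking adjoints is a nontrivial involution
  of \<open>K\<close>, that is, conjugation over the field of \<open>q\<close> elements. Therefore
  \<open>B(x, y)\<close> depends only on the product of \<open>y\<close> and the conjugate of \<open>x\<close>, and the kernel of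
  \<open>B(1, -)\<close> is the subfield of order \<open>q\<close>. As the eigenfunctionals separate the points of
  \<open>Z(G)\<close>, this determines the commutator map. Finally \<open>\<sigma>^((q^2 - 1) / 2)\<close> inverts
  \<open>V\<close> and centralises \<open>Z(G)\<close>, which splits \<open>G\<close> as a Heisenberg group.

  Conversely, the Heisenberg group has the automorphism
  \<open>(v, t) \<mapsto> (\<lambda> v, N(\<lambda>) t)\<close>. A \<open>p\<close>-subgroup of \<open>SL\<^sub>3(q)\<close> fixes a nonzero vector
  and then a nonzero covector vanishing on it, so it is conjugate to a group of unitriangular matrices.
\<close>

section \<open>Finite fields\<close>

text \<open>Names the generators of the multiplicative group of a finite field. For an infinite type
  \<open>CARD('a)\<close> is 0 and every nonzero element qualifies.\<close>

definition primitive_element :: "'a::field \<Rightarrow> bool" where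
  "primitive_element g \<longleftrightarrow> g \<noteq> 0 \<and> inj_on (\<lambda>i. g ^ i) {..<CARD('a) - 1}"

text \<open>Multiplication by \<open>x\<close> permutes \<open>S\<close>, so the product over
  \<open>S\<close> absorbs a factor \<open>x ^ card S\<close> and can be cancelled. This serves for
  the nonzero elements of any finite subring.\<close>

lemma power_card_closed:
  fixes S :: "'a::field set"
  assumes "finite S" "0 \<notin> S" "\<And>x y. x \<in> S \<Longrightarrow> y \<in> S \<Longrightarrow> x * y \<in> S" "x \<in> S"
  shows "x ^ card S = 1"
proof -
  have x0: "x \<noteq> 0" using assms by auto
  have inj: "inj_on ((*) x) S" using x0 by (auto simp: inj_on_def)
  have im: "(*) x ` S = S"
    by (rule card_subset_eq[OF assms(1) _ card_image[OF inj]]) (use assms in blast)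
  have "\<Prod>S = (\<Prod>y\<in>S. x * y)"
    using prod.reindex[OF inj, of "\<lambda>y. y"] by (simp add: im)
  also have "\<dots> = x ^ card S * \<Prod>S" by (simp add: prod.distrib)
  finally show ?thesis using assms(1,2) by (auto simp: prod_zero_iff)
qed

lemma card_nonzero:
  assumes "finite (UNIV :: 'a::field set)"
  shows "card (UNIV - {0 :: 'a}) = CARD('a) - 1"
  using assms by (simp add: card_Diff_singleton)

lemma finite_field_power_card:
  fixes x :: "'a::field"
  assumes "finite (UNIV :: 'a set)" "x \<noteq> 0"
  shows "x ^ (CARD('a) - 1) = 1"
  using power_card_closed[of "UNIV - {0}" x] assms by (simp add: card_nonzero)

lemma primitive_element_power:
  fixes g :: "'a::field"
  assumes "finite (UNIV :: 'a set)" "primitive_element g" "x \<noteq> 0"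
  obtains i where "i < CARD('a) - 1" "x = g ^ i"
proof -
  have "(\<lambda>i. g ^ i) ` {..<CARD('a) - 1} = UNIV - {0}"
    using assms by (intro card_subset_eq) (auto simp: primitive_element_def card_image card_nonzero)
  then show ?thesis using that assms(3) by (metis (no_types, lifting) DiffI UNIV_I imageE insertE empty_iff lessThan_iff)
qed

lemma primitive_element_eq_1_iff:
  fixes g :: "'a::field"
  assumes "finite (UNIV :: 'a set)" "primitive_element g"
  shows "g ^ i = 1 \<longleftrightarrow> (CARD('a) - 1) dvd i"
proof -
  let ?n = "CARD('a) - 1"
  have g1: "g ^ ?n = 1" using finite_field_power_card assms by (auto simp: primitive_element_def)
  have pos: "?n > 0"
    using card_mono[of UNIV "{0, 1 :: 'a}"] assms(1) by simp
  have "g ^ i = g ^ (?n * (i div ?n) + i mod ?n)" by simp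
  then have eq: "g ^ i = g ^ (i mod ?n)" by (simp only: power_add power_mult g1 power_one mult_1)
  show ?thesis
  proof
    assume "g ^ i = 1"
    then have "g ^ (i mod ?n) = g ^ 0" using eq by simp
    then have "i mod ?n = 0"
      using assms(2) pos unfolding primitive_element_def inj_on_def by (metis lessThan_iff mod_less_divisor)
    then show "?n dvd i" by auto
  next
    assume "?n dvd i" then show "g ^ i = 1" using eq by (simp add: dvd_eq_mod_eq_0)
  qed
qed

lemma primitive_elementI:
  fixes g :: "'a::field"
  assumes "g \<noteq> 0" "\<And>i. 0 < i \<Longrightarrow> i < CARD('a) - 1 \<Longrightarrow> g ^ i \<noteq> 1"
  shows "primitive_element g"
proof -
  have "i = j" if "i \<le> j" "j < CARD('a) - 1" "g ^ i = g ^ j" for i j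
  proof (rule ccontr)
    assume "i \<noteq> j"
    have "g ^ j = g ^ i * g ^ (j - i)" using that(1) by (metis le_add_diff_inverse power_add)
    then have "g ^ (j - i) = 1" using that assms(1) by simp
    then show False using assms(2)[of "j - i"] that \<open>i \<noteq> j\<close> by auto
  qed
  then have "inj_on (\<lambda>i. g ^ i) {..<CARD('a) - 1}"
    by (intro inj_onI) (metis lessThan_iff nat_le_linear)
  then show ?thesis using assms(1) by (simp add: primitive_element_def)
qed

lemma primitive_element_exists:
  assumes fin: "finite (UNIV :: 'a::field set)"
  shows "\<exists>g :: 'a. primitive_element g"
proof -
  \<comment> \<open>Cyclicity of the multiplicative group is a theorem about fields given as
    records, so the type-class field is repackaged as one.\<close>
  define R :: "'a ring" where
    "R = \<lparr>carrier = UNIV, monoid.mult = (*), one = 1, ring.zero = 0, add = (+)\<rparr>"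
  have "abelian_group R"
    by (rule abelian_groupI) (auto simp: R_def algebra_simps intro: exI[of _ "- x" for x])
  moreover have "comm_monoid R"
    by (rule comm_monoidI) (auto simp: R_def algebra_simps)
  ultimately have "cring R"
    by (rule cringI) (auto simp: R_def algebra_simps)
  then have field: "Ring.field R"
    by (rule cring.cring_fieldI2) (auto simp: R_def intro: right_inverse)
  have pow: "x [^]\<^bsub>R\<^esub> (n::nat) = x ^ n" for x n
    by (induction n) (auto simp: R_def nat_pow_def)
  have car: "carrier (mult_of R) = UNIV - {0}" and finR: "finite (carrier R)"
    using fin by (simp_all add: R_def)
  obtain g where "carrier (mult_of R) = {g [^]\<^bsub>R\<^esub> i | i :: nat. i \<in> UNIV}"
    using field.finite_field_mult_group_has_gen[OF field finR] by blast
  then have g': "UNIV - {0} = {g ^ i | i :: nat. True}" unfolding car by (simp add: pow)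
  then have "g ^ 1 \<in> UNIV - {0}" by blast
  with g' have g: "g \<noteq> 0" "UNIV - {0} = {g ^ i | i :: nat. True}" by auto
  have "primitive_element g"
  proof (rule primitive_elementI[OF g(1)])
    fix i assume i: "0 < i" "i < CARD('a) - 1"
    show "g ^ i \<noteq> 1"
    proof
      \<comment> \<open>Exponents would then matter only modulo \<open>i\<close>, leaving at most
        \<open>i\<close> powers of \<open>g\<close>, fewer than there are nonzero elements.\<close>
      assume *: "g ^ i = 1"
      have "UNIV - {0} \<subseteq> (\<lambda>j. g ^ j) ` {..<i}"
      proof
        fix x assume "x \<in> UNIV - {0::'a}"
        then obtain k where "x = g ^ k" using g by auto
        also have "g ^ k = g ^ (i * (k div i) + k mod i)" by simp
        also have "\<dots> = g ^ (k mod i)" by (simp only: power_add power_mult * power_one mult_1)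
        finally show "x \<in> (\<lambda>j. g ^ j) ` {..<i}" using i by auto
      qed
      then have "card (UNIV - {0::'a}) \<le> i"
        by (metis card_lessThan finite_lessThan surj_card_le)
      then show False using i fin by (simp add: card_nonzero)
    qed
  qed
  then show ?thesis ..
qed

text \<open>Replacing \<open>x\<close> by \<open>g * x\<close> permutes the nonzero elements and
  multiplies the sum by \<open>g ^ i\<close>, which is not 1. This orthogonality relation isolates
  one term in \<open>eigenfunctional_exists\<close>.\<close>

lemma sum_primitive_powers:
  assumes fin: "finite (UNIV :: 'a::field set)" and "\<not> (CARD('a) - 1) dvd i"
  shows "(\<Sum>x\<in>UNIV - {0 :: 'a}. x ^ i) = 0"
proof -
  obtain g :: 'a where g: "primitive_element g" using primitive_element_exists[OF fin] by blast
  have g0: "g \<noteq> 0" using g by (simp add: primitive_element_def)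
  have inj: "inj_on ((*) g) (UNIV - {0})" using g0 by (auto simp: inj_on_def)
  have im: "(*) g ` (UNIV - {0}) = UNIV - {0}"
    by (rule card_subset_eq[OF _ _ card_image[OF inj]]) (use g0 fin in auto)
  have "(\<Sum>x\<in>UNIV - {0 :: 'a}. x ^ i) = (\<Sum>x\<in>UNIV - {0 :: 'a}. (g * x) ^ i)"
    using sum.reindex[OF inj, of "\<lambda>x. x ^ i"] by (simp add: im)
  also have "\<dots> = g ^ i * (\<Sum>x\<in>UNIV - {0 :: 'a}. x ^ i)"
    by (simp add: sum_distrib_left power_mult_distrib)
  finally have "(g ^ i - 1) * (\<Sum>x\<in>UNIV - {0 :: 'a}. x ^ i) = 0" by (simp add: algebra_simps)
  moreover have "g ^ i \<noteq> 1" using primitive_element_eq_1_iff[OF fin g] assms(2) by simp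
  ultimately show ?thesis by simp
qed

section \<open>Subrings of finite fields and alternating eigenforms\<close>

text \<open>Multiplication by a nonzero \<open>x\<close> maps the finite set \<open>R\<close>
  injectively to itself and therefore hits 1. For \<open>x = 0\<close> the convention
  \<open>inverse 0 = 0\<close> applies.\<close>

lemma subring_inverse:
  fixes R :: "'a::field set"
  assumes "finite R" "1 \<in> R" "\<And>x y. x \<in> R \<Longrightarrow> y \<in> R \<Longrightarrow> x * y \<in> R" "x \<in> R"
  shows "inverse x \<in> R"
proof (cases "x = 0")
  case True then show ?thesis using assms by simp
next
  case False
  have "(*) x ` R = R"
    using assms False by (intro card_subset_eq card_image) (auto simp: inj_on_def)
  then obtain y where "y \<in> R" "1 = x * y" using assms(2) by (metis imageE)
  then show ?thesis by (metis inverse_unique)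
qed

lemma subring_uminus:
  fixes R :: "'a::field set"
  assumes "finite R" "0 \<in> R" "\<And>x y. x \<in> R \<Longrightarrow> y \<in> R \<Longrightarrow> x + y \<in> R" "x \<in> R"
  shows "- x \<in> R"
proof -
  have "(+) x ` R = R"
    using assms by (intro card_subset_eq card_image) (auto simp: inj_on_def)
  then obtain y where "y \<in> R" "0 = x + y" using assms(2) by (metis imageE)
  then show ?thesis by (metis add_eq_0_iff)
qed

text \<open>\<open>R\<close> is a subfield by finiteness. For \<open>c\<close> outside
  \<open>R\<close> the sum of \<open>R\<close> and \<open>R * c\<close> is direct, so the square of
  \<open>card R\<close> is at most \<open>q * q\<close>.\<close>

lemma proper_subring_card_le:
  fixes R :: "'a::field set"
  assumes fin: "finite (UNIV :: 'a set)" and card: "CARD('a) = q * q"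
    and R: "0 \<in> R" "1 \<in> R" "\<And>x y. x \<in> R \<Longrightarrow> y \<in> R \<Longrightarrow> x + y \<in> R"
      "\<And>x y. x \<in> R \<Longrightarrow> y \<in> R \<Longrightarrow> x * y \<in> R" and ne: "R \<noteq> UNIV"
  shows "card R \<le> q"
proof -
  have finR: "finite R" using fin by (rule rev_finite_subset) simp
  have inv: "inverse x \<in> R" if "x \<in> R" for x using subring_inverse[OF finR R(2,4) that] by blast
  have neg: "- x \<in> R" if "x \<in> R" for x using subring_uminus[OF finR R(1,3) that] by blast
  have diff: "x - y \<in> R" if "x \<in> R" "y \<in> R" for x y using R(3)[OF that(1) neg[OF that(2)]] by simp
  obtain c where c: "c \<notin> R" using ne by blast
  have "inj_on (\<lambda>(r, s). r + s * c) (R \<times> R)"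
  proof (clarsimp simp: inj_on_def)
    fix r s r' s' assume *: "r \<in> R" "s \<in> R" "r' \<in> R" "s' \<in> R" "r + s * c = r' + s' * c"
    then have e: "(s - s') * c = r' - r" by (simp add: algebra_simps)
    have "s = s'"
    proof (rule ccontr)
      assume "s \<noteq> s'"
      then have "c = inverse (s - s') * (r' - r)" using e by (simp add: field_simps)
      then show False using c R(4) inv diff * by metis
    qed
    then show "r = r' \<and> s = s'" using * by simp
  qed
  then have "card (R \<times> R) \<le> CARD('a)" using fin by (intro card_inj_on_le) auto
  then have "card R * card R \<le> q * q" by (simp add: card card_cartesian_product)
  then show ?thesis by (meson linorder_not_le mult_strict_mono' zero_le)
qed

text \<open>The eigenvalue \<open>m\<close> multiplies \<open>range (B 1)\<close> into itself, so it lies in a proper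
  subring and has order \<open>t < q\<close>. Then \<open>l ^ t\<close> preserves \<open>B\<close>, and it has too many powers for
  the subring of elements with an adjoint to be proper.\<close>

lemma form_adjoint:
  fixes B :: "'a::field \<Rightarrow> 'a \<Rightarrow> 'a"
  assumes fin: "finite (UNIV :: 'a set)" and card: "CARD('a) = q * q" and q: "2 < q"
    and add_l: "\<And>x y z. B (x + y) z = B x z + B y z"
    and add_r: "\<And>x y z. B x (y + z) = B x y + B x z"
    and alt: "\<And>x. B x x = 0"
    and l: "primitive_element l" and eigen: "\<And>x y. B (l * x) (l * y) = m * B x y"
    and nz: "B 1 y0 \<noteq> 0"
    and img: "\<And>x. x \<noteq> 0 \<Longrightarrow> range (B x) = range (B 1)"
  obtains st where "\<And>x y. st (x + y) = st x + st y" "\<And>x y. st (x * y) = st x * st y"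
    "\<And>x. st (st x) = x" "st \<noteq> id" "\<And>x y. B x y = B 1 (st x * y)"
proof -
  have l0: "l \<noteq> 0" using l by (simp add: primitive_element_def)
  have skew: "B x y = - B y x" for x y
    using alt[of "x + y"] alt[of x] alt[of y]
    by (simp add: add_l add_r eq_neg_iff_add_eq_0 add.commute)
  have zero_l: "B 0 y = 0" for y using add_l[of 0 0 y] by (metis add.right_neutral add_cancel_right_left)
  have zero_r: "B x 0 = 0" for x using add_r[of x 0 0] by (metis add.right_neutral add_cancel_right_left)
  have nondeg: "\<exists>y. B x y \<noteq> 0" if "x \<noteq> 0" for x
    using img[OF that] nz by (metis rangeI rangeE)
  \<comment> \<open>Surjectivity would make \<open>B 1\<close> injective by finiteness, but both 0
    and 1 lie in its kernel.\<close>
  have nonsurj: "range (B 1) \<noteq> UNIV"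
  proof
    assume "range (B 1) = UNIV"
    then have "inj (B 1)" using fin by (simp add: finite_UNIV_surj_inj)
    then show False using alt[of 1] zero_r[of 1] by (metis injD zero_neq_one)
  qed
  define I where "I = range (B 1)"
  have I_add: "u + v \<in> I" if "u \<in> I" "v \<in> I" for u v
    using that unfolding I_def by (auto simp flip: add_r)
  have I0: "0 \<in> I" unfolding I_def using zero_r[of 1] by (metis rangeI)
  \<comment> \<open>The multiplier ring of the image \<open>I\<close>. It contains \<open>m\<close>
    because \<open>B l\<close> and \<open>B 1\<close> have the same range, and it is proper because
    \<open>I\<close> is proper and contains the nonzero \<open>B 1 y0\<close>.\<close>
  define R where "R = {k. \<forall>u\<in>I. k * u \<in> I}"
  have m0: "m \<noteq> 0"
  proof
    assume "m = 0"
    then have "B l (l * y) = 0" for y using eigen[of 1 y] by simp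
    then have "B l y = 0" for y using l0 by (metis nonzero_mult_div_cancel_left times_divide_eq_right)
    then show False using nondeg[OF l0] by blast
  qed
  have mR: "m \<in> R"
  proof -
    have "m * B 1 y \<in> range (B 1)" for y
      using eigen[of 1 y] img[OF l0] rangeI[of "B l" "l * y"] by simp
    then show ?thesis unfolding R_def I_def by auto
  qed
  have R1: "1 \<in> R" and R0: "0 \<in> R" and Radd: "x \<in> R \<Longrightarrow> y \<in> R \<Longrightarrow> x + y \<in> R"
    and Rmult: "x \<in> R \<Longrightarrow> y \<in> R \<Longrightarrow> x * y \<in> R" for x y
    using I_add I0 unfolding R_def by (auto simp: distrib_right mult.assoc)
  have Rne: "R \<noteq> UNIV"
  proof
    assume "R = UNIV"
    have "x \<in> I" for x
    proof -
      have "x / B 1 y0 \<in> R" using \<open>R = UNIV\<close> by simp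
      then have "(x / B 1 y0) * B 1 y0 \<in> I" unfolding R_def using rangeI[of "B 1" y0] by (simp only: I_def mem_Collect_eq)
      then show ?thesis using nz by simp
    qed
    then show False using nonsurj unfolding I_def by blast
  qed
  have Rq: "card R \<le> q"
    by (rule proper_subring_card_le[OF fin card R0 R1]) (use Radd Rmult Rne in auto)
  define t where "t = card (R - {0})"
  have finR: "finite R" using fin by (rule rev_finite_subset) simp
  have mt: "m ^ t = 1"
    unfolding t_def by (rule power_card_closed) (use finR mR m0 Rmult in auto)
  have t: "0 < t" "t \<le> q - 1"
    using Rq R0 finR m0 mR card_gt_0_iff[of "R - {0}"] by (auto simp: t_def card_Diff_singleton)
  define k where "k = l ^ t"
  have k0: "k \<noteq> 0" using l0 by (simp add: k_def)
  have eigen_pow: "B (l ^ i * x) (l ^ i * y) = m ^ i * B x y" for i x y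
    by (induction i arbitrary: x y) (simp_all add: eigen mult.assoc)
  have Bk: "B (k * x) (k * y) = B x y" for x y
    using eigen_pow[of t x y] by (simp add: k_def mt)
  have Bki: "B (k ^ i * x) (k ^ i * y) = B x y" for x y i
    by (induction i arbitrary: x y) (simp_all add: Bk mult.assoc)
  have qq: "(q - 1) * (q + 1) = q * q - 1" using q by (simp add: algebra_simps) 
  \<comment> \<open>For \<open>i \<le> q\<close> the exponents \<open>t * i\<close> stay below the
    order \<open>q * q - 1\<close> of \<open>l\<close>. This gives \<open>q + 1\<close> distinct
    powers of \<open>k\<close>, one more than a proper subring can hold.\<close>
  have kinj: "inj_on (\<lambda>i. k ^ i) {..q}"
  proof (rule inj_onI)
    fix i j assume ij: "i \<in> {..q}" "j \<in> {..q}" "k ^ i = k ^ j"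
    have *: "t * i < q * q - 1" if "i \<le> q" for i
    proof -
      have "t * i \<le> (q - 1) * q" using t that by (simp add: mult_mono)
      also have "\<dots> < (q - 1) * (q + 1)" using q by simp
      finally show ?thesis by (simp only: qq)
    qed
    have "l ^ (t * i) = l ^ (t * j)" using ij by (simp add: k_def power_mult)
    then have "t * i = t * j"
      using l *[of i] *[of j] ij unfolding primitive_element_def card by (auto dest: inj_onD)
    then show "i = j" using t by simp
  qed
  define T where "T = {x. \<exists>x'. \<forall>u v. B (x * u) v = B u (x' * v)}"
  have TU: "T = UNIV"
  proof (rule ccontr)
    assume ne: "T \<noteq> UNIV"
    have 0: "0 \<in> T" unfolding T_def by (auto intro!: exI[of _ 0] simp: zero_l zero_r)
    have 1: "1 \<in> T" unfolding T_def by (auto intro!: exI[of _ 1])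
    have a: "x + y \<in> T" if "x \<in> T" "y \<in> T" for x y
      using that unfolding T_def
      by (auto simp: distrib_right add_l) (metis add_r distrib_right)
    have b: "x * y \<in> T" if "x \<in> T" "y \<in> T" for x y
      using that unfolding T_def by (auto simp: mult.assoc) (metis mult.assoc)
    have "card T \<le> q" by (rule proper_subring_card_le[OF fin card 0 1]) (use a b ne in auto)
    moreover have "k ^ i \<in> T" for i
    proof -
      \<comment> \<open>Invariance of \<open>B\<close> under \<open>k ^ i\<close> says that the
        adjoint of \<open>k ^ i\<close> is its inverse.\<close>
      have "B (k ^ i * u) v = B u (inverse k ^ i * v)" for u v
        using Bki[of i u "inverse k ^ i * v"] k0 by (simp add: power_inverse field_simps)
      then show ?thesis unfolding T_def by blast
    qed
    then have "card ((\<lambda>i. k ^ i) ` {..q}) \<le> card T"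
      using fin by (intro card_mono) (auto intro: rev_finite_subset)
    ultimately show False using card_image[OF kinj] by simp
  qed
  have "\<forall>x. \<exists>x'. \<forall>u v. B (x * u) v = B u (x' * v)" using TU unfolding T_def by blast
  then obtain st where st: "\<And>x u v. B (x * u) v = B u (st x * v)" by metis
  \<comment> \<open>Adjoints are unique because \<open>B 1\<close> is not the zero map, so each law
    for \<open>st\<close> follows by comparing the two sides inside \<open>B\<close>.\<close>
  have uniq: "x = y" if "\<And>u v. B u (x * v) = B u (y * v)" for x y
  proof (rule ccontr)
    assume "x \<noteq> y"
    have "B 1 ((x - y) * v) = 0" for v
      using that[of 1 v] add_r[of 1 "(x - y) * v" "y * v"] by (simp add: algebra_simps)
    from this[of "y0 / (x - y)"] nz \<open>x \<noteq> y\<close> show False by simp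
  qed
  show ?thesis
  proof
    show "st (x + y) = st x + st y" for x y
      by (rule uniq) (simp add: distrib_right add_r add_l st[symmetric])
    show "st (x * y) = st x * st y" for x y
      by (rule uniq) (simp add: st[symmetric] mult.assoc mult.left_commute)
    show "st (st x) = x" for x
    proof (rule uniq)
      fix u v show "B u (st (st x) * v) = B u (x * v)"
        using st[of "st x" u v] st[of x v u] skew[of "st x * u" v] skew[of u "x * v"] by simp
    qed
    show "B x y = B 1 (st x * y)" for x y using st[of x 1 y] by simp
    show "st \<noteq> id"
    proof
      \<comment> \<open>Then \<open>k\<close> equals its adjoint, the inverse of \<open>k\<close>,
        so \<open>k ^ 2 = k ^ 0\<close>, against \<open>kinj\<close> and
        \<open>2 < q\<close>.\<close>
      assume "st = id"
      then have "st k = k" by simp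
      then have "B u (k ^ 2 * v) = B u (1 * v)" for u v
        using Bk[of u v] st[of k u "k * v"] by (simp add: power2_eq_square mult.assoc)
      then have "k ^ 2 = k ^ 0" using uniq[of "k ^ 2" 1] by simp
      then show False using kinj q unfolding inj_on_def by (metis atMost_iff less_imp_le zero_le zero_neq_numeral)
    qed
  qed
qed

section \<open>The quadratic extension of a finite field\<close>

definition nonsquare :: "'a::field" where
  "nonsquare = (SOME s. \<forall>t. t * t \<noteq> s)"

definition has_nonsquare :: "'a::field itself \<Rightarrow> bool" where
  "has_nonsquare _ \<longleftrightarrow> (\<exists>s :: 'a. \<forall>t. t * t \<noteq> s)"

lemma nonsquare:
  assumes "has_nonsquare TYPE('a::field)"
  shows "t * t \<noteq> (nonsquare :: 'a)"
  using someI_ex[OF assms[unfolded has_nonsquare_def]] unfolding nonsquare_def by blast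

text \<open>When every element is a square there is no quadratic extension to adjoin a root of, and the
  type is a copy of the base field; this makes it a field for every base field.\<close>

typedef (overloaded) 'a qext = "{z :: 'a::field \<times> 'a. snd z = 0 \<or> has_nonsquare TYPE('a)}"
  by (rule exI[of _ "(0, 0)"]) simp

setup_lifting type_definition_qext

lift_definition qre :: "'a::field qext \<Rightarrow> 'a" is fst .
lift_definition qim :: "'a::field qext \<Rightarrow> 'a" is snd .
lift_definition qpair :: "'a::field \<Rightarrow> 'a \<Rightarrow> 'a qext" is
  "\<lambda>x y. (x, if has_nonsquare TYPE('a) then y else 0)" by simp

text \<open>The norm to the base field: the product of \<open>z\<close> and its conjugate.\<close>

definition qnorm :: "'a::field qext \<Rightarrow> 'a" where
  "qnorm z = qre z * qre z - nonsquare * (qim z * qim z)"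

lemma qext_eq_iff: "z = w \<longleftrightarrow> qre z = qre w \<and> qim z = qim w"
  by transfer (auto simp: prod_eq_iff)

lemma qre_qpair [simp]: "qre (qpair x y) = x"
  by transfer simp

lemma qim_qpair:
  "has_nonsquare TYPE('a::field) \<Longrightarrow> qim (qpair x y) = (y :: 'a)"
  by transfer simp

lemma qim_eq_0: "\<not> has_nonsquare TYPE('a::field) \<Longrightarrow> qim (z :: 'a qext) = 0"
  by transfer simp

instantiation qext :: (field) field
begin

definition "0 = qpair 0 0"
definition "1 = qpair 1 0"
definition "z + w = qpair (qre z + qre w) (qim z + qim w)"
definition "z - w = qpair (qre z - qre w) (qim z - qim w)"
definition "- z = qpair (- qre z) (- qim z)"
definition "z * w = qpair (qre z * qre w + nonsquare * (qim z * qim w)) (qre z * qim w + qim z * qre w)"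
definition "inverse z = qpair (qre z / qnorm z) (- qim z / qnorm z)"
definition divide_qext :: "'a qext \<Rightarrow> 'a qext \<Rightarrow> 'a qext" where "divide_qext z w = z * inverse w"

lemma qim_simps [simp]:
  "qim (0 :: 'a qext) = 0" "qim (1 :: 'a qext) = 0"
  "qim (z + w) = qim z + qim w" "qim (z - w) = qim z - qim w" "qim (- z) = - qim z"
  "qim (z * w) = qre z * qim w + qim z * qre w" "qim (inverse z) = - qim z / qnorm z"
  for z w :: "'a qext"
  by (cases "has_nonsquare TYPE('a)"; simp add: zero_qext_def one_qext_def plus_qext_def minus_qext_def
      uminus_qext_def times_qext_def inverse_qext_def qim_qpair qim_eq_0)+

lemma qre_simps [simp]:
  "qre (0 :: 'a qext) = 0" "qre (1 :: 'a qext) = 1"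
  "qre (z + w) = qre z + qre w" "qre (z - w) = qre z - qre w" "qre (- z) = - qre z"
  "qre (z * w) = qre z * qre w + nonsquare * (qim z * qim w)" "qre (inverse z) = qre z / qnorm z"
  for z w :: "'a qext"
  by (simp_all add: zero_qext_def one_qext_def plus_qext_def minus_qext_def
      uminus_qext_def times_qext_def inverse_qext_def)

text \<open>A zero of the norm with \<open>qim z \<noteq> 0\<close> would make
  \<open>nonsquare\<close> the square of \<open>qre z / qim z\<close>.\<close>

lemma qnorm_eq_0_iff: "qnorm z = 0 \<longleftrightarrow> z = 0" for z :: "'a qext"
proof
  assume n: "qnorm z = 0"
  have "qim z = 0"
  proof (rule ccontr)
    assume i: "qim z \<noteq> 0"
    then have "has_nonsquare TYPE('a)" using qim_eq_0 by blast
    moreover have "(qre z / qim z) * (qre z / qim z) = nonsquare"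
      using n i by (simp add: qnorm_def field_simps)
    ultimately show False using nonsquare by blast
  qed
  then show "z = 0" using n by (simp add: qnorm_def qext_eq_iff)
qed (simp add: qnorm_def)

instance
proof
  fix z :: "'a qext" assume "z \<noteq> 0"
  then have "qnorm z \<noteq> 0" by (simp add: qnorm_eq_0_iff)
  then have "(qre z * qre z - nonsquare * (qim z * qim z)) / qnorm z = 1" by (simp add: qnorm_def)
  then show "inverse z * z = 1"
    by (simp add: qext_eq_iff mult.commute diff_divide_distrib)
qed (simp_all add: qext_eq_iff algebra_simps divide_qext_def)

end

definition qcnj :: "'a::field qext \<Rightarrow> 'a qext" where
  "qcnj z = qpair (qre z) (- qim z)"

lemma qre_qcnj [simp]: "qre (qcnj z) = qre z"
  by (simp add: qcnj_def)

lemma qim_qcnj [simp]: "qim (qcnj z) = - qim z" for z :: "'a::field qext"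
  by (cases "has_nonsquare TYPE('a)") (simp_all add: qcnj_def qim_qpair qim_eq_0)

text \<open>Translation by 1 permutes the field, so adding 1 to every element leaves the sum of all
  elements unchanged.\<close>

lemma of_nat_card_eq_0:
  assumes fin: "finite (UNIV :: 'a::field set)"
  shows "of_nat CARD('a) = (0 :: 'a)"
proof -
  have "(\<Sum>x\<in>(UNIV :: 'a set). x) = (\<Sum>x\<in>UNIV. x + 1)"
    by (rule sum.reindex_bij_witness[of _ "\<lambda>x. x + 1" "\<lambda>x. x - 1"]) auto
  then show ?thesis by (simp add: sum.distrib)
qed

lemma two_neq_zero:
  assumes "finite (UNIV :: 'a::field set)" "odd CARD('a)"
  shows "(2 :: 'a) \<noteq> 0"
proof
  assume 2: "(2 :: 'a) = 0"
  obtain m where "CARD('a) = 2 * m + 1" using assms(2) oddE by blast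
  then have "of_nat CARD('a) = (1 :: 'a)" by (simp add: 2)
  then show False using of_nat_card_eq_0[OF assms(1)] by simp
qed

text \<open>On a finite field surjective squaring would be injective, yet 1 and -1 have the same
  square and differ in odd characteristic.\<close>

lemma has_nonsquare_odd:
  assumes "finite (UNIV :: 'a::field set)" "odd CARD('a)"
  shows "has_nonsquare TYPE('a)"
proof (rule ccontr)
  assume "\<not> has_nonsquare TYPE('a)"
  then have "surj (\<lambda>t :: 'a. t * t)" unfolding has_nonsquare_def surj_def by metis
  then have "inj (\<lambda>t :: 'a. t * t)" using assms(1) finite_UNIV_surj_inj by blast
  then have "(1 :: 'a) = - 1" by (rule injD) simp
  then have "(2 :: 'a) = 0" by (metis add.right_inverse one_add_one)
  then show False using two_neq_zero[OF assms] by blast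
qed

lemma qext_UNIV_bij:
  assumes "has_nonsquare TYPE('a::field)"
  shows "bij_betw (\<lambda>z :: 'a qext. (qre z, qim z)) UNIV UNIV"
  by (rule bij_betw_byWitness[where f' = "\<lambda>(x, y). qpair x y"])
    (use assms in \<open>auto simp: qext_eq_iff qim_qpair\<close>)

lemma card_qext:
  assumes "has_nonsquare TYPE('a::field)"
  shows "CARD('a qext) = CARD('a) * CARD('a)"
  using bij_betw_same_card[OF qext_UNIV_bij[OF assms]] by (simp flip: UNIV_Times_UNIV add: card_cartesian_product)

lemma finite_qext:
  assumes "finite (UNIV :: 'a::field set)"
  shows "finite (UNIV :: 'a qext set)"
proof -
  have "inj (\<lambda>z :: 'a qext. (qre z, qim z))" by (auto simp: inj_def qext_eq_iff)
  then show ?thesis using assms by (metis finite_Prod_UNIV finite_imageD finite_subset top_greatest)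
qed

section \<open>The involution of the quadratic extension\<close>

lemma card_power_fixed_le:
  assumes "2 \<le> n"
  shows "finite {x :: 'a::field. x ^ n = x}" "card {x :: 'a::field. x ^ n = x} \<le> n"
proof -
  define P :: "'a poly" where "P = Polynomial.monom 1 n - Polynomial.monom 1 1"
  have "coeff P n = 1" using assms by (simp add: P_def)
  then have P0: "P \<noteq> 0" by auto
  have "degree P \<le> n"
    unfolding P_def using assms by (intro degree_diff_le order_trans[OF degree_monom_le]) auto
  moreover have eq: "{x. x ^ n = x} = {x. poly P x = 0}" by (auto simp: P_def poly_monom)
  ultimately show "card {x :: 'a. x ^ n = x} \<le> n" using card_poly_roots_bound[OF P0] by simp
  show "finite {x :: 'a. x ^ n = x}" unfolding eq by (rule poly_roots_finite[OF P0])
qed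

lemma subfield_power:
  assumes "finite S" "0 \<in> S" "\<And>x y. x \<in> S \<Longrightarrow> y \<in> S \<Longrightarrow> x * y \<in> S" "x \<in> S" "card S > 0"
  shows "x ^ card S = (x :: 'a::field)"
proof (cases "x = 0")
  case False
  have "x ^ card (S - {0}) = 1"
    by (rule power_card_closed) (use assms False in auto)
  then have "x ^ (card S - 1) = 1" using assms by (simp add: card_Diff_singleton)
  then show ?thesis using assms(5) power_eq_if[of x "card S"] by simp
qed (use assms in simp)

lemma card_qim_eq_0:
  assumes "has_nonsquare TYPE('a::field)"
  shows "card {z :: 'a qext. qim z = 0} = CARD('a)"
proof -
  have "bij_betw (\<lambda>x. qpair x 0) (UNIV :: 'a set) {z :: 'a qext. qim z = 0}"
    by (rule bij_betw_byWitness[where f' = qre]) (use assms in \<open>auto simp: qext_eq_iff qim_qpair\<close>)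
  then show ?thesis by (metis bij_betw_same_card)
qed

text \<open>The fixed ring of \<open>st\<close> is shown to have exactly \<open>q\<close> elements
  and hence to be the base field. A square root \<open>j\<close> of \<open>nonsquare\<close> has a
  fixed square without being fixed, so it goes to \<open>- j\<close>.\<close>

lemma involution_eq_qcnj:
  fixes st :: "'a::field qext \<Rightarrow> 'a qext"
  assumes fin: "finite (UNIV :: 'a set)" and odd: "odd CARD('a)"
    and add: "\<And>x y. st (x + y) = st x + st y" and mult: "\<And>x y. st (x * y) = st x * st y"
    and inv: "\<And>x. st (st x) = x" and ne: "st \<noteq> id"
  shows "st = qcnj"
proof -
  let ?q = "CARD('a)"
  have ns: "has_nonsquare TYPE('a)" by (rule has_nonsquare_odd[OF fin odd])
  have finK: "finite (UNIV :: 'a qext set)" by (rule finite_qext[OF fin])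
  have fin_sub: "finite S" for S :: "'a qext set" using finK by (rule rev_finite_subset) simp
  have cardK: "CARD('a qext) = ?q * ?q" by (rule card_qext[OF ns])
  have two: "(2 :: 'a qext) \<noteq> 0"
    by (rule two_neq_zero[OF finK]) (use odd in \<open>simp add: cardK\<close>)
  have q2: "2 \<le> ?q" using card_mono[OF fin, of "{0, 1}"] by simp
  have st0: "st 0 = 0" using add[of 0 0] by (metis add_cancel_right_right add_0)
  have st1: "st 1 = 1"
  proof -
    have "st 1 * st 1 = st 1" using mult[of 1 1] by simp
    moreover have "st 1 \<noteq> 0" using inv[of 1] st0 by auto
    ultimately show ?thesis by simp
  qed
  have stm: "st (- x) = - st x" for x using add[of x "- x"] st0 by (simp add: eq_neg_iff_add_eq_0 add.commute)
  have std: "st (x - y) = st x - st y" for x y using add[of x "- y"] stm by simp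
  define Fix where "Fix = {x. st x = x}"
  have Fix_ne: "Fix \<noteq> UNIV" using ne by (auto simp: Fix_def fun_eq_iff set_eq_iff)
  have Fix: "0 \<in> Fix" "1 \<in> Fix" "\<And>x y. x \<in> Fix \<Longrightarrow> y \<in> Fix \<Longrightarrow> x + y \<in> Fix"
    "\<And>x y. x \<in> Fix \<Longrightarrow> y \<in> Fix \<Longrightarrow> x * y \<in> Fix"
    by (auto simp: Fix_def st0 st1 add mult)
  have le: "card Fix \<le> ?q" by (rule proper_subring_card_le[OF finK cardK Fix Fix_ne])
  obtain x0 where x0: "st x0 \<noteq> x0" using ne by fastforce
  \<comment> \<open>\<open>st\<close> negates \<open>u\<close>, so division by \<open>u\<close>
    carries negated elements into \<open>Fix\<close>. Thus \<open>x + st x\<close> and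
    \<open>(x - st x) / u\<close> are two elements of \<open>Fix\<close> that determine
    \<open>x\<close>, whence \<open>Fix\<close> has at least \<open>q\<close> elements.\<close>
  define u where "u = x0 - st x0"
  have u: "u \<noteq> 0" "st u = - u" using x0 by (auto simp: u_def std inv)
  have stdiv: "st (v / u) = v / u" if "st v = - v" for v
  proof -
    have "st (v / u) * st u = st v" using u(1) by (simp flip: mult)
    then show ?thesis using u that by (simp add: field_simps)
  qed
  have "inj (\<lambda>x. (x + st x, (x - st x) / u))"
  proof (rule injI)
    fix x y assume "(x + st x, (x - st x) / u) = (y + st y, (y - st y) / u)"
    then have "x + st x = y + st y" "x - st x = y - st y" using u(1) by auto
    then have "(x + st x) + (x - st x) = (y + st y) + (y - st y)" by simp
    then have "2 * x = 2 * y" by (simp add: algebra_simps)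
    then show "x = y" using two by simp
  qed
  moreover have "range (\<lambda>x. (x + st x, (x - st x) / u)) \<subseteq> Fix \<times> Fix"
    by (auto simp: Fix_def add std inv add.commute intro!: stdiv)
  ultimately have "CARD('a qext) \<le> card (Fix \<times> Fix)"
    using fin_sub[of Fix] by (intro card_inj_on_le) auto
  then have "?q * ?q \<le> card Fix * card Fix" by (simp add: cardK card_cartesian_product)
  then have "?q \<le> card Fix" by (meson linorder_not_le mult_strict_mono' zero_le)
  then have cardFix: "card Fix = ?q" using le by simp
  let ?F = "{z :: 'a qext. qim z = 0}"
  have cardF: "card ?F = ?q" by (rule card_qim_eq_0[OF ns])
  \<comment> \<open>\<open>Fix\<close> and the base field both have \<open>q\<close> elements and
    satisfy \<open>x ^ q = x\<close>, which has at most \<open>q\<close> solutions; so both are the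
    solution set.\<close>
  let ?R = "{x :: 'a qext. x ^ ?q = x}"
  have "x ^ ?q = x" if "x \<in> Fix" for x
    using subfield_power[OF fin_sub Fix(1,4) that] cardFix q2 by simp
  then have "Fix \<subseteq> ?R" by blast
  then have "Fix = ?R"
    using card_power_fixed_le[OF q2, where 'a = "'a qext"] cardFix by (intro card_seteq) auto
  moreover have "x ^ ?q = x" if "x \<in> ?F" for x
    using subfield_power[OF fin_sub, of ?F x] that cardF q2 by simp
  then have "?F \<subseteq> ?R" by blast
  then have "?F = ?R"
    using card_power_fixed_le[OF q2, where 'a = "'a qext"] cardF by (intro card_seteq) auto
  ultimately have FixF: "Fix = ?F" by simp
  define j :: "'a qext" where "j = qpair 0 1"
  have j: "qre j = 0" "qim j = 1" using ns by (simp_all add: j_def qim_qpair)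
  have "j * j \<in> Fix" by (simp add: FixF j)
  then have "st j * st j = j * j" by (simp add: Fix_def mult)
  then have "st j = j \<or> st j = - j" by (simp add: square_eq_iff)
  moreover have "j \<notin> Fix" by (simp add: FixF j)
  ultimately have stj: "st j = - j" by (auto simp: Fix_def)
  have "st z = qcnj z" for z
  proof -
    have z: "z = qpair (qre z) 0 + qpair (qim z) 0 * j"
      using ns by (simp add: qext_eq_iff qim_qpair j)
    have "qpair x 0 \<in> Fix" for x using ns by (simp add: FixF qim_qpair)
    then have st_pair: "st (qpair x 0) = qpair x 0" for x by (simp add: Fix_def)
    have "st z = qpair (qre z) 0 - qpair (qim z) 0 * j"
      by (subst z) (simp add: add mult stj st_pair)
    also have "\<dots> = qcnj z" using ns by (simp add: qext_eq_iff qim_qpair j)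
    finally show ?thesis .
  qed
  then show ?thesis by blast
qed

text \<open>The formula is \<open>form_adjoint\<close> with the involution identified as
  conjugation. It gives \<open>B 1 u = B u 1\<close> for real \<open>u\<close> (those with
  \<open>qim u = 0\<close>), and skew symmetry then makes \<open>B 1\<close> vanish on the reals. A
  nonreal \<open>y\<close> in the kernel would make \<open>B 1\<close> vanish identically.\<close>

lemma alternating_eigenform:
  fixes B :: "'a::field qext \<Rightarrow> 'a qext \<Rightarrow> 'a qext"
  assumes fin: "finite (UNIV :: 'a set)" and odd: "odd CARD('a)"
    and add_l: "\<And>x y z. B (x + y) z = B x z + B y z"
    and add_r: "\<And>x y z. B x (y + z) = B x y + B x z"
    and alt: "\<And>x. B x x = 0"
    and l: "primitive_element l" and eigen: "\<And>x y. B (l * x) (l * y) = m * B x y"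
    and nz: "B 1 y0 \<noteq> 0"
    and img: "\<And>x. x \<noteq> 0 \<Longrightarrow> range (B x) = range (B 1)"
  shows "B x y = B 1 (qcnj x * y)" and "B 1 y = 0 \<longleftrightarrow> qim y = 0"
proof -
  let ?q = "CARD('a)"
  have ns: "has_nonsquare TYPE('a)" by (rule has_nonsquare_odd[OF fin odd])
  have finK: "finite (UNIV :: 'a qext set)" by (rule finite_qext[OF fin])
  have cardK: "CARD('a qext) = ?q * ?q" by (rule card_qext[OF ns])
  have two: "(2 :: 'a) \<noteq> 0" by (rule two_neq_zero[OF fin odd])
  have "2 \<le> ?q" using card_mono[OF fin, of "{0, 1}"] by simp
  then have q2: "2 < ?q" using odd by (cases "?q = 2") auto
  obtain st where st: "\<And>x y. st (x + y) = st x + st y" "\<And>x y. st (x * y) = st x * st y"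
    "\<And>x. st (st x) = x" "st \<noteq> id" and B: "\<And>x y. B x y = B 1 (st x * y)"
    by (rule form_adjoint[OF finK cardK q2 add_l add_r alt l eigen nz])
      (rule img, assumption, rule that, assumption+)
  have st_eq: "st = qcnj" using involution_eq_qcnj[OF fin odd st] .
  show B': "B x y = B 1 (qcnj x * y)" for x y using B st_eq by simp
  have skew: "B x y = - B y x" for x y
    using alt[of "x + y"] alt[of x] alt[of y] by (simp add: add_l add_r eq_neg_iff_add_eq_0 add.commute)
  have real0: "B 1 y = 0" if y: "qim y = 0" for y
  proof -
    define u where "u = qpair (qre y / 2) 0"
    have u: "qim u = 0" "qre u + qre u = qre y" using ns two by (simp_all add: u_def qim_qpair)
    have "y = u + u" "qcnj u * 1 = u" unfolding qext_eq_iff qre_simps qim_simps using u y by simp_all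
    then have "B 1 y = B 1 u + B u 1" using B'[of u 1] add_r by metis
    then show ?thesis using skew[of u 1] by simp
  qed
  show "B 1 y = 0 \<longleftrightarrow> qim y = 0"
  proof
    assume y: "B 1 y = 0"
    show "qim y = 0"
    proof (rule ccontr)
      assume im: "qim y \<noteq> 0"
      have pow: "B (l ^ i * x) (l ^ i * y) = m ^ i * B x y" for i x y
        by (induction i arbitrary: x y) (simp_all add: eigen mult.assoc)
      \<comment> \<open>A real \<open>k\<close> is its own conjugate, so one factor \<open>k\<close>
        moves to the left argument; as \<open>k\<close> is a power of \<open>l\<close>, the
        eigenvalue rule reduces the value to a multiple of \<open>B 1 y\<close>.\<close>
      have sq: "B 1 (k * k * y) = 0" if k: "qim k = 0" for k
      proof (cases "k = 0")
        case True
        then show ?thesis using real0 by simp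
      next
        case False
        then obtain i where i: "k = l ^ i" using primitive_element_power[OF finK l] by blast
        have "qcnj k = k" using k by (simp add: qext_eq_iff)
        then have "B 1 (k * k * y) = B (k * 1) (k * y)" using B'[of k "k * y"] by (simp add: mult.assoc)
        then show ?thesis using pow[of i 1 y] y i by simp
      qed
      have sub: "B x (y - z) = B x y - B x z" for x y z
        using add_r[of x "y - z" z] by simp
      have mult_real: "B 1 (c * y) = 0" if c: "qim c = 0" for c
      proof -
        \<comment> \<open>Every real \<open>c\<close> is a difference of two squares: those of half
          of \<open>c + 1\<close> and half of \<open>c - 1\<close>.\<close>
        define k1 k2 :: "'a qext" where "k1 = qpair ((qre c + 1) / 2) 0" and "k2 = qpair ((qre c - 1) / 2) 0"
        have k: "qim k1 = 0" "qim k2 = 0" using ns by (simp_all add: k1_def k2_def qim_qpair)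
        have "k1 * k1 - k2 * k2 = (k1 + k2) * (k1 - k2)" by (simp add: algebra_simps)
        moreover have "qre k1 + qre k2 = qre c" "qre k1 - qre k2 = 1"
          using two by (simp_all add: k1_def k2_def flip: add_divide_distrib diff_divide_distrib)
        then have "k1 + k2 = c" "k1 - k2 = 1" using c k by (simp_all add: qext_eq_iff)
        ultimately have "c * y = k1 * k1 * y - k2 * k2 * y" by (simp flip: left_diff_distrib)
        then show ?thesis using sub sq k by simp
      qed
      have "B 1 w = 0" for w
      proof -
        define c where "c = qpair (qim w / qim y) 0"
        have c: "qim c = 0" "qre c = qim w / qim y" using ns by (simp_all add: c_def qim_qpair)
        have "w = (w - c * y) + c * y" by simp
        then have "B 1 w = B 1 (w - c * y) + B 1 (c * y)" using add_r by metis
        moreover have "qim (w - c * y) = 0" using c im by simp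
        ultimately show ?thesis using real0 mult_real[OF c(1)] by simp
      qed
      then show False using nz by blast
    qed
  qed (rule real0)
qed

section \<open>Groups of prime power order\<close>

text \<open>\<open>act (inv g)\<close> inverts \<open>act g\<close>, so bijectivity need not be
  assumed. The restriction is there because \<open>BijGroup E\<close> consists of extensional
  functions.\<close>

lemma group_actionI:
  fixes G (structure)
  assumes "group G"
    and closed: "\<And>g x. g \<in> carrier G \<Longrightarrow> x \<in> E \<Longrightarrow> act g x \<in> E"
    and one: "\<And>x. x \<in> E \<Longrightarrow> act \<one> x = x"
    and mult: "\<And>g h x. g \<in> carrier G \<Longrightarrow> h \<in> carrier G \<Longrightarrow> x \<in> E \<Longrightarrow>
      act (g \<otimes> h) x = act g (act h x)"
  shows "group_action G E (\<lambda>g. restrict (act g) E)"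
proof -
  interpret group G by fact
  have bij: "restrict (act g) E \<in> Bij E" if g: "g \<in> carrier G" for g
  proof -
    have "bij_betw (act g) E E"
    proof (rule bij_betw_byWitness[where f' = "act (inv g)"])
      show "\<forall>x\<in>E. act (inv g) (act g x) = x" "\<forall>x\<in>E. act g (act (inv g) x) = x"
        using mult[of "inv g" g] mult[of g "inv g"] one g by simp_all
    qed (use closed g in auto)
    then show ?thesis by (simp add: Bij_def bij_betw_restrict_eq)
  qed
  show ?thesis
  proof (intro group_action.intro group_hom.intro group_hom_axioms.intro homI group_axioms group_BijGroup)
    show "restrict (act g) E \<in> carrier (BijGroup E)" if "g \<in> carrier G" for g
      using bij[OF that] by (simp add: BijGroup_def)
    show "restrict (act (g \<otimes> h)) E = restrict (act g) E \<otimes>\<^bsub>BijGroup E\<^esub> restrict (act h) E"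
      if "g \<in> carrier G" "h \<in> carrier G" for g h
      using bij that closed by (auto simp: BijGroup_def compose_def mult intro!: restrict_ext)
  qed
qed

text \<open>The orbits with more than one point partition the nonfixed points, and their sizes
  divide \<open>p ^ n\<close>, hence are multiples of \<open>p\<close>.\<close>

lemma (in group_action) card_fixed_points_dvd:
  assumes fin: "finite E" and ord: "Coset.order G = p ^ n" and p: "Factorial_Ring.prime (p::nat)" and dvd: "p dvd card E"
  shows "p dvd card {x \<in> E. \<forall>g\<in>carrier G. \<phi> g x = x}" (is "p dvd card ?F")
proof -
  define \<O> where "\<O> = {X \<in> orbits G E \<phi>. card X \<noteq> 1}"
  have orb_sub: "X \<subseteq> E" if "X \<in> orbits G E \<phi>" for X using that orbits_coverture by blast
  have fixed_iff: "card (orbit G \<phi> x) = 1 \<longleftrightarrow> x \<in> ?F" if x: "x \<in> E" for x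
  proof
    assume "card (orbit G \<phi> x) = 1"
    then have "orbit G \<phi> x = {x}" using orbit_refl[OF x] by (metis card_1_singletonE singletonD)
    then show "x \<in> ?F" using x unfolding orbit_def by blast
  next
    assume "x \<in> ?F"
    then have "orbit G \<phi> x = {x}" using orbit_refl[OF x] unfolding orbit_def by auto
    then show "card (orbit G \<phi> x) = 1" by simp
  qed
  have U: "\<Union>\<O> = E - ?F"
  proof (intro equalityI subsetI)
    fix x assume "x \<in> \<Union>\<O>"
    then obtain X where X: "X \<in> orbits G E \<phi>" "card X \<noteq> 1" "x \<in> X" by (auto simp: \<O>_def)
    then have xE: "x \<in> E" using orb_sub by blast
    then have "orbit G \<phi> x \<in> orbits G E \<phi>" by (auto simp: orbits_def)
    then have "X = orbit G \<phi> x" using disjoint_union[of X "orbit G \<phi> x"] X orbit_refl[OF xE] by blast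
    then show "x \<in> E - ?F" using X fixed_iff[OF xE] xE by auto
  next
    fix x assume "x \<in> E - ?F"
    then have "x \<in> E" "orbit G \<phi> x \<in> \<O>" using fixed_iff[of x] by (auto simp: \<O>_def orbits_def)
    then show "x \<in> \<Union>\<O>" using orbit_refl by blast
  qed
  have "pairwise disjnt \<O>"
    using disjoint_union unfolding \<O>_def pairwise_def disjnt_def by blast
  moreover have "finite X" if "X \<in> \<O>" for X
    using orb_sub[of X] that fin finite_subset unfolding \<O>_def by blast
  ultimately have "card (\<Union>\<O>) = sum card \<O>" by (rule card_Union_disjoint)
  moreover have "p dvd card X" if X: "X \<in> \<O>" for X
  proof -
    obtain x where x: "x \<in> E" "X = orbit G \<phi> x" using X by (auto simp: \<O>_def orbits_def)
    then have "card X dvd p ^ n" using orbit_stabilizer_theorem[OF x(1)] ord by (metis dvd_triv_left)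
    then obtain k where "card X = p ^ k" using p divides_primepow_nat by blast
    then show ?thesis using X by (cases k) (auto simp: \<O>_def)
  qed
  ultimately have "p dvd card (E - ?F)" using U by (metis dvd_sum)
  moreover have "card ?F = card E - card (E - ?F)"
  proof -
    have "E - (E - ?F) = ?F" by auto
    then show ?thesis using card_Diff_subset[of "E - ?F" E] fin by simp
  qed
  ultimately show ?thesis using dvd by (simp add: dvd_diff_nat)
qed

text \<open>The number of fixed points is a multiple of \<open>p\<close>, and it is positive because
  of \<open>e\<close>; so it exceeds 1. It is applied to conjugation with \<open>e\<close> the
  identity, and to vectors and covectors with \<open>e\<close> zero.\<close>

lemma p_group_fixes_another_point:
  assumes "group G" "Coset.order G = p ^ n" "Factorial_Ring.prime (p::nat)" "finite E" "p dvd card E"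
    and closed: "\<And>g x. g \<in> carrier G \<Longrightarrow> x \<in> E \<Longrightarrow> act g x \<in> E"
    and one: "\<And>x. x \<in> E \<Longrightarrow> act \<one>\<^bsub>G\<^esub> x = x"
    and mult: "\<And>g h x. g \<in> carrier G \<Longrightarrow> h \<in> carrier G \<Longrightarrow> x \<in> E \<Longrightarrow>
      act (g \<otimes>\<^bsub>G\<^esub> h) x = act g (act h x)"
    and e: "e \<in> E" "\<And>g. g \<in> carrier G \<Longrightarrow> act g e = e"
  obtains x where "x \<in> E" "x \<noteq> e" "\<And>g. g \<in> carrier G \<Longrightarrow> act g x = x"
proof -
  interpret group_action G E "\<lambda>g. restrict (act g) E"
    by (rule group_actionI[OF assms(1)]) (fact closed one mult)+
  let ?F = "{x \<in> E. \<forall>g\<in>carrier G. restrict (act g) E x = x}"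
  have "p dvd card ?F" by (rule card_fixed_points_dvd) (use assms in auto)
  moreover have "e \<in> ?F" using e by auto
  moreover have "finite ?F" using assms by auto
  ultimately have "?F \<noteq> {e}" using assms(3) not_prime_1 by force
  then obtain x where "x \<in> ?F" "x \<noteq> e" using \<open>e \<in> ?F\<close> by blast
  then show ?thesis by (intro that[of x]) auto
qed

section \<open>Centers of groups of prime power order\<close>

context group begin

lemma mult_inv_cancel:
  assumes "x \<in> carrier G" "y \<in> carrier G"
  shows "x \<otimes> (inv x \<otimes> y) = y" "inv x \<otimes> (x \<otimes> y) = y"
  using m_assoc[of x "inv x" y] m_assoc[of "inv x" x y] assms by simp_all

lemma subgroup_center: "subgroup (center G) G"
proof (rule subgroupI)
  show "inv z \<in> center G" if "z \<in> center G" for z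
  proof -
    have z: "z \<in> carrier G" "\<And>x. x \<in> carrier G \<Longrightarrow> z \<otimes> x = x \<otimes> z" using that by (auto simp: center_def)
    have "inv z \<otimes> x = x \<otimes> inv z" if "x \<in> carrier G" for x
    proof -
      have "inv z \<otimes> x = inv z \<otimes> (x \<otimes> z) \<otimes> inv z" using z(1) that by (simp add: m_assoc)
      also have "\<dots> = inv z \<otimes> (z \<otimes> x) \<otimes> inv z" using z(2)[OF that] by simp
      also have "\<dots> = x \<otimes> inv z" using z(1) that by (simp add: mult_inv_cancel)
      finally show ?thesis .
    qed
    then show ?thesis using z by (simp add: center_def)
  qed
  show "z \<otimes> w \<in> center G" if "z \<in> center G" "w \<in> center G" for z w
  proof -
    have "z \<otimes> w \<otimes> x = x \<otimes> (z \<otimes> w)" if "x \<in> carrier G" for x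
    proof -
      have c: "z \<in> carrier G" "w \<in> carrier G" "w \<otimes> x = x \<otimes> w" "z \<otimes> x = x \<otimes> z"
        using \<open>z \<in> center G\<close> \<open>w \<in> center G\<close> that by (auto simp: center_def)
      have "z \<otimes> w \<otimes> x = z \<otimes> x \<otimes> w" using c(1-3) that by (simp add: m_assoc)
      also have "\<dots> = x \<otimes> (z \<otimes> w)" using c(1,2) that unfolding c(4) by (simp add: m_assoc)
      finally show ?thesis .
    qed
    moreover have "z \<in> carrier G" "w \<in> carrier G" using that unfolding center_def by blast+
    ultimately show ?thesis unfolding center_def by blast
  qed
qed (auto simp: center_def intro!: exI[of _ \<one>])

lemma p_subgroup_dvd_card:
  assumes "Coset.order G = p ^ n" "Factorial_Ring.prime (p::nat)" "subgroup H G" "H \<noteq> {\<one>}"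
  shows "p dvd card H"
proof -
  have "card H dvd p ^ n" using lagrange[OF assms(3)] assms(1) by (metis dvd_triv_right)
  then obtain k where k: "card H = p ^ k" using assms(2) divides_primepow_nat by blast
  have "k \<noteq> 0"
  proof
    assume "k = 0"
    then have "card H = 1" using k by simp
    then show False using assms(3,4) subgroup.one_closed by (metis card_1_singletonE singletonD)
  qed
  then show ?thesis using k by (cases k) auto
qed

text \<open>\<open>G\<close> acts on \<open>H\<close> by conjugation and fixes the identity; a
  second fixed point is central.\<close>

lemma normal_subgroup_meets_center:
  assumes "Coset.order G = p ^ n" "Factorial_Ring.prime (p::nat)" "H \<lhd> G" "H \<noteq> {\<one>}"
  obtains z where "z \<in> H" "z \<noteq> \<one>" "z \<in> center G"
proof -
  interpret normal H G by fact
  have fin: "finite (carrier G)" using assms by (metis order_gt_0_iff_finite prime_gt_0_nat zero_less_power)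
  obtain z where z: "z \<in> H" "z \<noteq> \<one>" "\<And>g. g \<in> carrier G \<Longrightarrow> g \<otimes> z \<otimes> inv g = z"
  proof (rule p_group_fixes_another_point[of G p n H "\<lambda>g x. g \<otimes> x \<otimes> inv g" \<one>])
    show "p dvd card H" by (rule p_subgroup_dvd_card) (use assms is_subgroup in auto)
    show "finite H" using fin subset finite_subset by blast
    show "g \<otimes> h \<otimes> x \<otimes> inv (g \<otimes> h) = g \<otimes> (h \<otimes> x \<otimes> inv h) \<otimes> inv g"
      if "g \<in> carrier G" "h \<in> carrier G" "x \<in> H" for g h x
      using that subset by (simp add: m_assoc inv_mult_group subsetD)
  qed (use assms subset in \<open>auto simp: group_axioms inv_op_closed2 subsetD\<close>)
  have "z \<otimes> g = g \<otimes> z" if "g \<in> carrier G" for g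
  proof -
    have "z \<in> carrier G" using z(1) subset by blast
    then have "g \<otimes> z \<otimes> inv g \<otimes> g = g \<otimes> z" using that by (simp add: m_assoc)
    then show ?thesis using z(3)[OF that] by simp
  qed
  then show ?thesis using that z subset by (auto simp: center_def)
qed

lemma maximal_subgroup_exists:
  assumes "finite (carrier G)" "subgroup H G" "H \<noteq> carrier G"
  obtains M where "maximal_subgroup M G" "H \<subseteq> M"
proof -
  define S where "S = {M. subgroup M G \<and> M \<noteq> carrier G \<and> H \<subseteq> M}"
  have "S \<subseteq> Pow (carrier G)" by (auto simp: S_def dest: subgroup.subset)
  then have "finite S" using assms(1) finite_subset by blast
  moreover have "H \<in> S" using assms by (simp add: S_def)
  ultimately obtain M where M: "M \<in> S" "\<And>M'. M' \<in> S \<Longrightarrow> M \<subseteq> M' \<Longrightarrow> M = M'"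
    using finite_has_maximal[of S] by blast
  then have "maximal_subgroup M G"
    unfolding maximal_subgroup_def S_def by blast
  then show ?thesis using that M(1) by (auto simp: S_def)
qed

end

text \<open>The derived subgroup is normal and nontrivial, so it meets the center nontrivially. Both
  have prime order \<open>p\<close>, hence both equal their intersection.\<close>

lemma extraspecial_derived_eq_center:
  assumes "extraspecial p E"
  shows "derived_subgroup E = center E"
proof -
  interpret group E using assms by (simp add: extraspecial_def p_group_def)
  let ?D = "derived_subgroup E"
  obtain n where n: "Coset.order E = p ^ n" and p: "Factorial_Ring.prime p"
    using assms by (auto simp: extraspecial_def p_group_def)
  have fin: "finite (carrier E)" using n p by (metis order_gt_0_iff_finite prime_gt_0_nat zero_less_power)
  have card: "card ?D = p" "card (center E) = p" using assms by (auto simp: extraspecial_def)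
  have D: "?D \<lhd> E" by (rule derived_self_is_normal)
  have "?D \<noteq> {\<one>\<^bsub>E\<^esub>}" using card p not_prime_1 by auto
  then obtain z where z: "z \<in> ?D" "z \<noteq> \<one>\<^bsub>E\<^esub>" "z \<in> center E"
    using normal_subgroup_meets_center[OF n p D] by blast
  have sub: "subgroup (?D \<inter> center E) E"
    using D subgroup_center by (simp add: normal_imp_subgroup subgroups_Inter_pair)
  have ne: "?D \<inter> center E \<noteq> {\<one>\<^bsub>E\<^esub>}" using z by blast
  have "p dvd card (?D \<inter> center E)" by (rule p_subgroup_dvd_card[OF n p sub ne])
  moreover have finD: "finite ?D" "finite (center E)" using card prime_gt_0_nat[OF p] by (simp_all add: card_ge_0_finite)
  moreover have "0 < card (?D \<inter> center E)" using z finD by (auto simp: card_gt_0_iff)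
  ultimately have "p \<le> card (?D \<inter> center E)" by (simp add: dvd_imp_le)
  then have "?D \<inter> center E = ?D" "?D \<inter> center E = center E"
    using card finD card_seteq[of ?D "?D \<inter> center E"] card_seteq[of "center E" "?D \<inter> center E"] by auto
  then show ?thesis by simp
qed

section \<open>Semi-extraspecial groups\<close>

definition commutator :: "('g, 'm) monoid_scheme \<Rightarrow> 'g \<Rightarrow> 'g \<Rightarrow> 'g" where
  "commutator G x y = x \<otimes>\<^bsub>G\<^esub> y \<otimes>\<^bsub>G\<^esub> inv\<^bsub>G\<^esub> x \<otimes>\<^bsub>G\<^esub> inv\<^bsub>G\<^esub> y"

lemma commutator_in_derived:
  assumes "x \<in> carrier G" "y \<in> carrier G"
  shows "commutator G x y \<in> derived_subgroup G"
  unfolding derived_def commutator_def using assms by (intro generate.incl) blast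

lemma (in group) subgroup_nat_pow_closed:
  assumes "subgroup H G" "h \<in> H"
  shows "h [^] (n::nat) \<in> H"
  using assms by (induction n) (auto intro: subgroup.m_closed subgroup.one_closed)

lemma (in group) center_subset: "center G \<subseteq> carrier G"
  unfolding center_def by blast

lemma (in group) center_commute:
  assumes "z \<in> center G" "x \<in> carrier G"
  shows "z \<otimes> x = x \<otimes> z"
  using assms unfolding center_def by blast

lemma (in group) commutator_closed [simp]:
  assumes "x \<in> carrier G" "y \<in> carrier G"
  shows "commutator G x y \<in> carrier G"
  using assms by (simp add: commutator_def)

lemma (in group) commutator_mult_swap:
  assumes "x \<in> carrier G" "y \<in> carrier G"
  shows "commutator G x y \<otimes> (y \<otimes> x) = x \<otimes> y"
  using assms by (simp add: commutator_def m_assoc mult_inv_cancel)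

lemma (in group) commutator_inverse:
  assumes "x \<in> carrier G" "y \<in> carrier G"
  shows "inv (commutator G x y) = commutator G y x"
  using assms by (simp add: commutator_def inv_mult_group m_assoc)

lemma (in group) commutator_eq_one_iff:
  assumes "x \<in> carrier G" "y \<in> carrier G"
  shows "commutator G x y = \<one> \<longleftrightarrow> x \<otimes> y = y \<otimes> x"
proof -
  have "commutator G x y = \<one> \<longleftrightarrow> commutator G x y \<otimes> (y \<otimes> x) = \<one> \<otimes> (y \<otimes> x)"
    using assms by (subst right_cancel) auto
  then show ?thesis using assms commutator_mult_swap by simp
qed

lemma (in group) hom_commutator:
  assumes "group H" "h \<in> hom G H" "x \<in> carrier G" "y \<in> carrier G"
  shows "h (commutator G x y) = commutator H (h x) (h y)"
proof -
  interpret group_hom G H h using assms by (simp add: group_hom_def group_hom_axioms_def group_axioms)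
  show ?thesis using assms(3,4) by (simp add: commutator_def)
qed

section \<open>Commutator calculus in nilpotency class at most two\<close>

locale class_two_group = group +
  assumes commutator_central: "x \<in> carrier G \<Longrightarrow> y \<in> carrier G \<Longrightarrow> commutator G x y \<in> center G"
begin

text \<open>In the commutator of \<open>x \<otimes> y\<close> with \<open>z\<close>, the commutator
  of \<open>y\<close> and \<open>z\<close> appears between \<open>x\<close> and its inverse; being
  central, it can be pulled out.\<close>

lemma commutator_mult_left:
  assumes "x \<in> carrier G" "y \<in> carrier G" "z \<in> carrier G"
  shows "commutator G (x \<otimes> y) z = commutator G x z \<otimes> commutator G y z"
proof -
  let ?c = "commutator G y z"
  have c: "?c \<in> carrier G" using assms by simp
  have "commutator G (x \<otimes> y) z = x \<otimes> ?c \<otimes> (z \<otimes> (inv x \<otimes> inv z))"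
    using assms by (simp add: commutator_def inv_mult_group m_assoc mult_inv_cancel)
  also have "\<dots> = ?c \<otimes> x \<otimes> (z \<otimes> (inv x \<otimes> inv z))"
    using center_commute[OF commutator_central[OF assms(2,3)] assms(1)] by simp
  also have "\<dots> = ?c \<otimes> commutator G x z"
    using assms c by (simp add: commutator_def[of G x z] m_assoc)
  also have "\<dots> = commutator G x z \<otimes> ?c"
    using center_commute[OF commutator_central[OF assms(2,3)]] assms by simp
  finally show ?thesis .
qed

lemma commutator_mult_right:
  assumes "x \<in> carrier G" "y \<in> carrier G" "z \<in> carrier G"
  shows "commutator G x (y \<otimes> z) = commutator G x y \<otimes> commutator G x z"
proof -
  have "commutator G x (y \<otimes> z) = inv (commutator G (y \<otimes> z) x)"
    using assms by (simp add: commutator_inverse)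
  also have "\<dots> = inv (commutator G z x) \<otimes> inv (commutator G y x)"
    using assms by (simp add: commutator_mult_left inv_mult_group)
  also have "\<dots> = commutator G x z \<otimes> commutator G x y"
    using assms by (simp add: commutator_inverse)
  also have "\<dots> = commutator G x y \<otimes> commutator G x z"
    using center_commute[OF commutator_central[OF assms(1,3)]] assms by simp
  finally show ?thesis .
qed

lemma commutator_center_left:
  assumes "z \<in> center G" "x \<in> carrier G"
  shows "commutator G z x = \<one>" "commutator G x z = \<one>"
  using assms center_subset by (auto simp: commutator_eq_one_iff center_commute subset_iff)

lemma commutator_pow_left:
  assumes "x \<in> carrier G" "y \<in> carrier G"
  shows "commutator G (x [^] (n::nat)) y = commutator G x y [^] n"
proof (induction n)
  case 0
  then show ?case using assms by (simp add: commutator_eq_one_iff)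
next
  case (Suc n)
  then show ?case using assms by (simp add: commutator_mult_left)
qed

lemma commutator_hom_center:
  assumes "x \<in> carrier G"
  shows "commutator G x \<in> hom G (G\<lparr>carrier := center G\<rparr>)"
  using assms commutator_central by (auto simp: hom_def commutator_mult_right)

end

section \<open>Structure of semi-extraspecial groups\<close>

text \<open>What the later argument uses of semi-extraspeciality, phrased without maximal subgroups
  of the center. The key property is \<open>commutator_image\<close>.\<close>

locale semi_extraspecial_group = class_two_group +
  fixes p :: nat
  assumes prime: "Factorial_Ring.prime p"
    and finite_carrier: "finite (carrier G)"
    and odd_order: "odd p \<Longrightarrow> odd (Coset.order G)"
    and center_ne_carrier: "center G \<noteq> carrier G"
    and derived_eq_center: "derived_subgroup G = center G"
    and commutator_image: "x \<in> carrier G \<Longrightarrow> x \<notin> center G \<Longrightarrow> commutator G x ` carrier G = center G"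
    and pow_center: "x \<in> carrier G \<Longrightarrow> x [^] p \<in> center G"
    and center_pow: "z \<in> center G \<Longrightarrow> z [^] p = \<one>"

text \<open>Iterating surjectivity makes every element of \<open>H\<close> a \<open>p ^ n\<close>-th
  power, and these are trivial in a group of order \<open>p ^ n\<close>.\<close>

lemma (in group) p_power_map_not_surj:
  assumes ord: "Coset.order G = p ^ n" and p: "Factorial_Ring.prime (p::nat)" and H: "subgroup H G"
    and surj: "(\<lambda>z. z [^] p) ` H = H"
  shows "H = {\<one>}"
proof -
  have "\<forall>z\<in>H. \<exists>w\<in>H. w [^] (p ^ i) = z" for i
  proof (induction i)
    case 0
    then show ?case using H by (auto simp: subgroup.mem_carrier intro!: bexI)
  next
    case (Suc i)
    show ?case
    proof
      fix z assume "z \<in> H"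
      then obtain w where w: "w \<in> H" "w [^] (p ^ i) = z" using Suc by blast
      then obtain v where v: "v \<in> H" "w = v [^] p" using surj by blast
      then have "v \<in> carrier G" using H subgroup.mem_carrier by metis
      then have "v [^] (p ^ Suc i) = z" using w v by (simp add: nat_pow_pow)
      then show "\<exists>w\<in>H. w [^] (p ^ Suc i) = z" using v by blast
    qed
  qed
  moreover have "w [^] (p ^ n) = \<one>" if "w \<in> H" for w
    using that H pow_order_eq_1[of w] ord subgroup.mem_carrier by metis
  ultimately have "z = \<one>" if "z \<in> H" for z using that by metis
  then show ?thesis using subgroup.one_closed[OF H] by blast
qed

lemma semi_extraspecial_imp_group:
  assumes ses: "semi_extraspecial p G"
  shows "semi_extraspecial_group G p"
proof -
  interpret group G using ses by (simp add: semi_extraspecial_def p_group_def)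
  let ?Z = "center G" and ?c = "commutator G"
  let ?GZ = "G\<lparr>carrier := ?Z\<rparr>"
  obtain n where ord: "Coset.order G = p ^ n" and p: "Factorial_Ring.prime p"
    using ses by (auto simp: semi_extraspecial_def p_group_def)
  have fin: "finite (carrier G)" using ord p by (metis order_gt_0_iff_finite prime_gt_0_nat zero_less_power)
  have finZ: "finite ?Z" using fin center_subset finite_subset by blast
  have Zgrp: "group ?GZ" by (rule subgroup_imp_group[OF subgroup_center])
  have ne: "carrier G \<noteq> {\<one>\<^bsub>G\<^esub>}" using ses by (simp add: semi_extraspecial_def)
  have Zne: "?Z \<noteq> {\<one>\<^bsub>G\<^esub>}"
    using normal_subgroup_meets_center[OF ord p normal_self ne] by blast
  have quot: "N \<lhd> G" "carrier (G Mod N) = rcosets\<^bsub>G\<^esub> N"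
      "group_hom G (G Mod N) (\<lambda>a. N #>\<^bsub>G\<^esub> a)" "N \<subseteq> ?Z" "subgroup N G"
      "extraspecial p (G Mod N)" "center (G Mod N) = (\<lambda>a. N #>\<^bsub>G\<^esub> a) ` ?Z"
    if max: "maximal_subgroup N ?GZ" for N
  proof -
    let ?\<pi> = "\<lambda>a. N #>\<^bsub>G\<^esub> a"
    have N: "subgroup N ?GZ" "N \<noteq> ?Z" using max by (auto simp: maximal_subgroup_def)
    show NZ: "N \<subseteq> ?Z" using subgroup.subset[OF N(1)] by simp
    show Nsub: "subgroup N G" using incl_subgroup[OF subgroup_center N(1)] .
    show nor: "N \<lhd> G"
    proof (rule normal_invI[OF Nsub])
      fix x h assume x: "x \<in> carrier G" and h: "h \<in> N"
      have hc: "h \<in> carrier G" using h Nsub subgroup.mem_carrier by metis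
      have "x \<otimes>\<^bsub>G\<^esub> h = h \<otimes>\<^bsub>G\<^esub> x" using center_commute[of h x] h NZ x by auto
      then have "x \<otimes>\<^bsub>G\<^esub> h \<otimes>\<^bsub>G\<^esub> inv\<^bsub>G\<^esub> x = h" using x hc by (simp add: m_assoc)
      then show "x \<otimes>\<^bsub>G\<^esub> h \<otimes>\<^bsub>G\<^esub> inv\<^bsub>G\<^esub> x \<in> N" using h by simp
    qed
    show car: "carrier (G Mod N) = rcosets\<^bsub>G\<^esub> N" by (simp add: FactGroup_def)
    show hom: "group_hom G (G Mod N) ?\<pi>"
      using normal.r_coset_hom_Mod[OF nor] normal.factorgroup_is_group[OF nor]
      by (simp add: group_hom_def group_hom_axioms_def group_axioms)
    interpret \<pi>: group_hom G "G Mod N" ?\<pi> by (rule hom)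
    show es: "extraspecial p (G Mod N)" using ses max by (simp add: semi_extraspecial_def)
    have cardZ: "card (center (G Mod N)) = p" using es by (simp add: extraspecial_def)
    have sub: "?\<pi> ` ?Z \<subseteq> center (G Mod N)"
    proof
      fix Y assume "Y \<in> ?\<pi> ` ?Z"
      then obtain z where z: "z \<in> ?Z" "Y = N #>\<^bsub>G\<^esub> z" by blast
      then have zc: "z \<in> carrier G" using center_subset by blast
      have "Y \<otimes>\<^bsub>G Mod N\<^esub> X = X \<otimes>\<^bsub>G Mod N\<^esub> Y" if "X \<in> carrier (G Mod N)" for X
      proof -
        obtain x where x: "x \<in> carrier G" "X = N #>\<^bsub>G\<^esub> x" using \<open>X \<in> carrier (G Mod N)\<close> by (auto simp: car RCOSETS_def)
        show ?thesis
          using \<pi>.hom_mult[OF zc x(1)] \<pi>.hom_mult[OF x(1) zc] center_commute[OF z(1) x(1)] x(2) z(2) by simp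
      qed
      moreover have "Y \<in> carrier (G Mod N)" using \<pi>.hom_closed[OF zc] z(2) by simp
      ultimately show "Y \<in> center (G Mod N)" unfolding center_def by blast
    qed
    \<comment> \<open>The image of \<open>Z(G)\<close> is a nontrivial subgroup of the center of the
      quotient, whose order is the prime \<open>p\<close>; so it is the whole center.\<close>
    have subgr: "subgroup (?\<pi> ` ?Z) (G Mod N)" by (rule \<pi>.subgroup_img_is_subgroup[OF subgroup_center])
    have nontriv: "?\<pi> ` ?Z \<noteq> {\<one>\<^bsub>G Mod N\<^esub>}"
    proof
      assume *: "?\<pi> ` ?Z = {\<one>\<^bsub>G Mod N\<^esub>}"
      have "z \<in> N" if z: "z \<in> ?Z" for z
      proof -
        have "N #>\<^bsub>G\<^esub> z = N" using * z by (auto simp: FactGroup_def)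
        then show ?thesis using z center_subset coset_join1[OF _ _ Nsub] Nsub
          by (metis rcos_self subsetD)
      qed
      then show False using N(2) NZ by blast
    qed
    obtain m where "Coset.order (G Mod N) = p ^ m" using es by (auto simp: extraspecial_def p_group_def)
    then have "p dvd card (?\<pi> ` ?Z)" using \<pi>.p_subgroup_dvd_card[OF _ p subgr nontriv] by blast
    moreover have "card (?\<pi> ` ?Z) > 0" using finZ subgroup.one_closed[OF subgroup_center] by (auto simp: card_gt_0_iff)
    ultimately have "p \<le> card (?\<pi> ` ?Z)" by (rule dvd_imp_le)
    then show "center (G Mod N) = ?\<pi> ` ?Z"
      using card_seteq[OF _ sub] cardZ prime_gt_0_nat[OF p] by (metis card_ge_0_finite)
  qed
  \<comment> \<open>As \<open>N\<close> lies in \<open>Z(G)\<close> and the quotient has center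
    \<open>Z(G) / N\<close>, centrality modulo \<open>N\<close> lifts to \<open>G\<close>.\<close>
  have coset_mem: "x \<in> ?Z" if max: "maximal_subgroup N ?GZ" and x: "x \<in> carrier G"
      and c: "N #>\<^bsub>G\<^esub> x \<in> center (G Mod N)" for N x
  proof -
    obtain z where z: "z \<in> ?Z" "N #>\<^bsub>G\<^esub> x = N #>\<^bsub>G\<^esub> z" using c quot(7)[OF max] by auto
    then have "x \<in> N #>\<^bsub>G\<^esub> z" using rcos_self[OF x quot(5)[OF max]] by simp
    then obtain h where "h \<in> N" "x = h \<otimes>\<^bsub>G\<^esub> z" by (auto simp: r_coset_def)
    then show ?thesis using quot(4)[OF max] z(1) subgroup.m_closed[OF subgroup_center] by blast
  qed
  obtain N0 where N0: "maximal_subgroup N0 ?GZ"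
    using group.maximal_subgroup_exists[OF Zgrp _ group.triv_subgroup[OF Zgrp]] finZ Zne by auto
  \<comment> \<open>In the extraspecial quotient by \<open>N0\<close> the derived subgroup is the
    center, so commutators are central there and \<open>coset_mem\<close> lifts this.\<close>
  have central: "?c x y \<in> ?Z" if "x \<in> carrier G" "y \<in> carrier G" for x y
  proof -
    interpret \<pi>: group_hom G "G Mod N0" "\<lambda>a. N0 #>\<^bsub>G\<^esub> a" by (rule quot(3)[OF N0])
    have "N0 #>\<^bsub>G\<^esub> ?c x y = commutator (G Mod N0) (N0 #>\<^bsub>G\<^esub> x) (N0 #>\<^bsub>G\<^esub> y)"
      using hom_commutator[OF \<pi>.H.group_axioms \<pi>.homh that] .
    also have "\<dots> \<in> derived_subgroup (G Mod N0)"
      using that by (intro commutator_in_derived \<pi>.hom_closed)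
    also have "\<dots> = center (G Mod N0)"
      by (rule extraspecial_derived_eq_center[OF quot(6)[OF N0]])
    finally show ?thesis using coset_mem[OF N0] that by simp
  qed
  interpret class_two_group G by unfold_locales (rule central)
  \<comment> \<open>A proper image of \<open>commutator G x\<close> would lie in a maximal subgroup
    \<open>N\<close> of \<open>Z(G)\<close>. Then \<open>x\<close> would be central modulo
    \<open>N\<close>, hence central.\<close>
  have image: "?c x ` carrier G = ?Z" if x: "x \<in> carrier G" "x \<notin> ?Z" for x
  proof (rule ccontr)
    interpret cx: group_hom G ?GZ "?c x"
      using commutator_hom_center[OF x(1)] Zgrp by (simp add: group_hom_def group_hom_axioms_def group_axioms)
    assume "?c x ` carrier G \<noteq> ?Z"
    then obtain N where N: "maximal_subgroup N ?GZ" "?c x ` carrier G \<subseteq> N"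
      using group.maximal_subgroup_exists[OF Zgrp _ cx.subgroup_img_is_subgroup[OF subgroup_self]] finZ by auto
    interpret \<pi>: group_hom G "G Mod N" "\<lambda>a. N #>\<^bsub>G\<^esub> a" by (rule quot(3)[OF N(1)])
    have comm: "(N #>\<^bsub>G\<^esub> x) \<otimes>\<^bsub>G Mod N\<^esub> (N #>\<^bsub>G\<^esub> y) = (N #>\<^bsub>G\<^esub> y) \<otimes>\<^bsub>G Mod N\<^esub> (N #>\<^bsub>G\<^esub> x)"
      if y: "y \<in> carrier G" for y
    proof -
      have "N #>\<^bsub>G\<^esub> ?c x y = N"
        using N(2) y quot(5)[OF N(1)] by (intro coset_join2) (auto simp: x)
      then have "\<one>\<^bsub>G Mod N\<^esub> = N #>\<^bsub>G\<^esub> ?c x y" by (simp add: FactGroup_def)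
      also have "\<dots> = commutator (G Mod N) (N #>\<^bsub>G\<^esub> x) (N #>\<^bsub>G\<^esub> y)"
        by (rule hom_commutator[OF \<pi>.H.group_axioms \<pi>.homh x(1) y])
      finally show ?thesis using x y by (subst (asm) eq_commute, subst (asm) \<pi>.H.commutator_eq_one_iff) auto
    qed
    have "N #>\<^bsub>G\<^esub> x \<in> center (G Mod N)"
      unfolding center_def quot(2)[OF N(1)] RCOSETS_def
      using x comm by auto
    then show False using coset_mem[OF N(1) x(1)] x(2) by blast
  qed
  \<comment> \<open>An abelian \<open>G\<close> would have abelian quotients, but the derived
    subgroup of an extraspecial group has order \<open>p\<close>, not 1.\<close>
  have Zcar: "?Z \<noteq> carrier G"
  proof
    assume Z: "?Z = carrier G"
    interpret \<pi>: group_hom G "G Mod N0" "\<lambda>a. N0 #>\<^bsub>G\<^esub> a" by (rule quot(3)[OF N0])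
    have "center (G Mod N0) = carrier (G Mod N0)"
      using quot(7)[OF N0] quot(2)[OF N0] Z by (auto simp: RCOSETS_def)
    then have "comm_group (G Mod N0)"
      using \<pi>.H.center_commute \<pi>.H.group_axioms by (metis group.group_comm_groupI)
    then have "derived_subgroup (G Mod N0) = {\<one>\<^bsub>G Mod N0\<^esub>}"
      by (rule comm_group.derived_eq_singleton) simp
    then have "p = 1" using quot(6)[OF N0] by (simp add: extraspecial_def)
    then show False using p by simp
  qed
  then obtain x0 where x0: "x0 \<in> carrier G" "x0 \<notin> ?Z" using center_subset by blast
  have derived: "derived_subgroup G = ?Z"
  proof
    show "derived_subgroup G \<subseteq> ?Z"
      unfolding derived_def
      by (rule generate_subgroup_incl[OF _ subgroup_center]) (use central in \<open>auto simp: commutator_def\<close>)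
    show "?Z \<subseteq> derived_subgroup G"
    proof
      fix z assume "z \<in> ?Z"
      then obtain y where "y \<in> carrier G" "z = ?c x0 y" using image[OF x0] by blast
      then show "z \<in> derived_subgroup G" using commutator_in_derived[OF x0(1)] by simp
    qed
  qed
  \<comment> \<open>For noncentral \<open>x [^] p\<close> both \<open>x\<close> and
    \<open>x [^] p\<close> have commutator image \<open>Z(G)\<close>. By bilinearity the
    \<open>p\<close>-th power map would then be onto \<open>Z(G)\<close>, which is impossible as
    \<open>Z(G)\<close> is nontrivial.\<close>
  have pow: "x [^]\<^bsub>G\<^esub> p \<in> ?Z" if x: "x \<in> carrier G" for x
  proof (rule ccontr)
    assume n: "x [^]\<^bsub>G\<^esub> p \<notin> ?Z"
    then have xZ: "x \<notin> ?Z" using subgroup_nat_pow_closed[OF subgroup_center] by blast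
    have "?Z = ?c (x [^]\<^bsub>G\<^esub> p) ` carrier G" using image[OF _ n] x by simp
    also have "\<dots> = (\<lambda>z. z [^]\<^bsub>G\<^esub> p) ` ?c x ` carrier G"
      using x by (simp add: image_image commutator_pow_left)
    finally have "(\<lambda>z. z [^]\<^bsub>G\<^esub> p) ` ?Z = ?Z" using image[OF x xZ] by simp
    then show False using p_power_map_not_surj[OF ord p subgroup_center] Zne by blast
  qed
  have cpow: "z [^]\<^bsub>G\<^esub> p = \<one>\<^bsub>G\<^esub>" if z: "z \<in> ?Z" for z
  proof -
    obtain y where y: "y \<in> carrier G" "z = ?c x0 y" using z image[OF x0] by blast
    then have "z [^]\<^bsub>G\<^esub> p = ?c (x0 [^]\<^bsub>G\<^esub> p) y" using x0 by (simp add: commutator_pow_left)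
    then show ?thesis using commutator_center_left(1)[OF pow[OF x0(1)] y(1)] by simp
  qed
  show ?thesis
    by unfold_locales (use p fin ord Zcar derived image pow cpow in auto)
qed

section \<open>Eigenfunctionals and irreducibility\<close>

lemma coprime_inverse_mod:
  assumes "Factorial_Ring.prime (p::nat)" "\<not> p dvd k"
  obtains k' j where "k * k' = p * j + 1"
proof -
  have "coprime k p" using assms by (metis prime_imp_coprime coprime_commute)
  moreover have "k \<noteq> 0" using assms(2) by (metis dvd_0_right)
  ultimately obtain x y where "k * x = p * y + 1" using bezout_nat[of k p] by auto
  then show ?thesis using that by blast
qed

lemma (in group) funpow_hom:
  assumes "s \<in> hom G G"
  shows "s ^^ n \<in> hom G G"
proof (induction n)
  case 0
  then show ?case by (simp add: hom_def)
next
  case (Suc n)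
  then show ?case using assms by (auto simp: hom_def Pi_iff)
qed

lemma funpow_closed: "(\<And>x. x \<in> H \<Longrightarrow> s x \<in> H) \<Longrightarrow> x \<in> H \<Longrightarrow> (s ^^ n) x \<in> H"
  by (induction n) auto

lemma nat_pow_hom_image:
  assumes "group G" "group H" "h \<in> hom G H" "x \<in> carrier G"
  shows "h (x [^]\<^bsub>G\<^esub> (n::nat)) = h x [^]\<^bsub>H\<^esub> n"
proof -
  interpret group_hom G H h using assms by (simp add: group_hom_def group_hom_axioms_def)
  show ?thesis using assms(4) by (simp add: hom_nat_pow)
qed

text \<open>A homomorphism to the additive group of a field is obtained from a subgroup that is maximal
  among those avoiding a given element.\<close>

lemma (in comm_group) additive_functional_exists:
  fixes p :: nat
  assumes fin: "finite (carrier G)" and p: "Factorial_Ring.prime p"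
    and exp: "\<And>x. x \<in> carrier G \<Longrightarrow> x [^] p = \<one>"
    and char: "of_nat p = (0 :: 'k::field)"
    and z: "z \<in> carrier G" "z \<noteq> \<one>"
  obtains g :: "'a \<Rightarrow> 'k::field"
  where "\<And>x y. x \<in> carrier G \<Longrightarrow> y \<in> carrier G \<Longrightarrow> g (x \<otimes> y) = g x + g y" "g z \<noteq> 0"
proof -
  define S where "S = {M. subgroup M G \<and> z \<notin> M}"
  have "S \<subseteq> Pow (carrier G)" by (auto simp: S_def dest: subgroup.subset)
  then have "finite S" using fin finite_subset by blast
  moreover have "{\<one>} \<in> S" using z triv_subgroup by (simp add: S_def)
  ultimately obtain M where M: "M \<in> S" and max: "\<And>M'. M' \<in> S \<Longrightarrow> M \<subseteq> M' \<Longrightarrow> M = M'"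
    using finite_has_maximal[of S] by blast
  have sub: "subgroup M G" and zM: "z \<notin> M" using M by (auto simp: S_def)
  have Mc: "m \<in> carrier G" if "m \<in> M" for m using subgroup.mem_carrier[OF sub that] .
  have exp_mod: "x [^] k = x [^] (k mod p)" if x: "x \<in> carrier G" for x and k :: nat
  proof -
    have "x [^] k = x [^] (p * (k div p) + k mod p)" by simp
    also have "\<dots> = (x [^] p) [^] (k div p) \<otimes> x [^] (k mod p)"
      using x by (simp only: nat_pow_mult[symmetric] nat_pow_pow)
    also have "\<dots> = x [^] (k mod p)" using x by (simp add: exp)
    finally show ?thesis .
  qed
  have pow_inv: "x [^] (k * k') = x" if "x \<in> carrier G" "k * k' = p * j + 1" for x and k k' j :: nat
  proof -
    have "(1 + p * j) mod p = 1 mod p" by (rule mod_mult_self2)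
    then have "(k * k') mod p = 1" using that(2) prime_gt_1_nat[OF p] by simp
    then show ?thesis using exp_mod[OF that(1), of "k * k'"] that(1) by simp
  qed
  have dvd: "p dvd k" if k: "z [^] k \<in> M" for k :: nat
  proof (rule ccontr)
    assume "\<not> p dvd k"
    then obtain k' j where kk: "k * k' = p * j + 1" using coprime_inverse_mod[OF p] by blast
    have "(z [^] k) [^] k' \<in> M" by (rule subgroup_nat_pow_closed[OF sub k])
    then show False using zM pow_inv[OF z(1) kk] z(1) by (simp add: nat_pow_pow)
  qed
  \<comment> \<open>For \<open>x\<close> outside \<open>M\<close>, maximality puts \<open>z\<close>
    into the subgroup generated by \<open>M\<close> and \<open>x\<close>. The exponent of
    \<open>x\<close> in that expression is invertible modulo \<open>p\<close>, so the equation can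
    be solved for \<open>x\<close>.\<close>
  have decomp: "\<exists>i :: nat. \<exists>m\<in>M. x = m \<otimes> z [^] i" if x: "x \<in> carrier G" for x
  proof (cases "x \<in> M")
    case True
    then show ?thesis using x by (intro exI[of _ 0] bexI[of _ x]) auto
  next
    case False
    define M' where "M' = {m \<otimes> x [^] k | m k :: nat. m \<in> M}"
    have "subgroup M' G"
    proof (rule subgroupI)
      show "M' \<subseteq> carrier G" using x Mc by (auto simp: M'_def)
      show "M' \<noteq> {}" using subgroup.one_closed[OF sub] by (auto simp: M'_def)
      fix u assume "u \<in> M'"
      then obtain m k where u: "u = m \<otimes> x [^] (k::nat)" "m \<in> M" by (auto simp: M'_def)
      have "x [^] k \<otimes> x [^] ((p - 1) * k) = x [^] (p * k)"
        using x prime_gt_0_nat[OF p] by (simp add: nat_pow_mult algebra_simps)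
      also have "\<dots> = \<one>" using exp[OF x] x by (simp flip: nat_pow_pow)
      finally have "inv (x [^] k) = x [^] ((p - 1) * k)"
        using x by (metis inv_equality m_comm nat_pow_closed)
      then have "inv u = inv m \<otimes> x [^] ((p - 1) * k)" using u x Mc by (simp add: inv_mult)
      then show "inv u \<in> M'" using subgroup.m_inv_closed[OF sub u(2)] unfolding M'_def by blast
      fix v assume "v \<in> M'"
      then obtain n l where v: "v = n \<otimes> x [^] (l::nat)" "n \<in> M" by (auto simp: M'_def)
      have "u \<otimes> v = (m \<otimes> n) \<otimes> (x [^] k \<otimes> x [^] l)" using u v x Mc by (simp add: m_ac)
      also have "\<dots> = (m \<otimes> n) \<otimes> x [^] (k + l)" using x by (simp add: nat_pow_mult)
      finally show "u \<otimes> v \<in> M'" using subgroup.m_closed[OF sub u(2) v(2)] unfolding M'_def by blast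
    qed
    moreover have "M \<subseteq> M'"
    proof
      fix m assume "m \<in> M"
      then have "m = m \<otimes> x [^] (0::nat)" using Mc by simp
      then show "m \<in> M'" using \<open>m \<in> M\<close> unfolding M'_def by blast
    qed
    moreover have "x = \<one> \<otimes> x [^] (1::nat)" using x by simp
    then have "x \<in> M'" using subgroup.one_closed[OF sub] unfolding M'_def by blast
    ultimately have "z \<in> M'" using max[of M'] False unfolding S_def by blast
    then obtain m k where zk: "z = m \<otimes> x [^] (k::nat)" "m \<in> M" by (auto simp: M'_def)
    have "\<not> p dvd k"
    proof
      assume "p dvd k"
      then have "x [^] k = \<one>" using exp_mod[OF x, of k] by (simp add: dvd_eq_mod_eq_0)
      then show False using zk zM Mc by simp
    qed
    then obtain k' j where kk: "k * k' = p * j + 1" using coprime_inverse_mod[OF p] by blast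
    have "z [^] k' = m [^] k' \<otimes> (x [^] k) [^] k'"
      using zk x Mc by (simp add: nat_pow_distrib)
    also have "(x [^] k) [^] k' = x" using pow_inv[OF x kk] x by (simp add: nat_pow_pow)
    finally have "x = inv (m [^] k') \<otimes> z [^] k'" using zk(2) x z Mc by (simp add: inv_solve_left)
    moreover have "inv (m [^] k') \<in> M"
      using subgroup.m_inv_closed[OF sub subgroup_nat_pow_closed[OF sub zk(2)]] .
    ultimately show ?thesis by blast
  qed
  \<comment> \<open>The exponent of \<open>z\<close> is determined modulo \<open>p\<close>, so its
    image in a field of characteristic \<open>p\<close> is well defined and can serve as the
    functional.\<close>
  have of_nat_eq: "of_nat i = (of_nat i' :: 'k)" if eq: "m \<otimes> z [^] i = m' \<otimes> z [^] i'" and m: "m \<in> M" "m' \<in> M"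
    for m m' and i i' :: nat
  proof -
    have *: "of_nat i = (of_nat i' :: 'k)" if eq: "m \<otimes> z [^] i = m' \<otimes> z [^] i'" and m: "m \<in> M" "m' \<in> M" and "i \<le> i'"
      for m m' and i i' :: nat
    proof -
      have "m \<otimes> z [^] i = (m' \<otimes> z [^] (i' - i)) \<otimes> z [^] i"
        using eq \<open>i \<le> i'\<close> m z Mc by (simp add: m_assoc nat_pow_mult)
      then have "m = m' \<otimes> z [^] (i' - i)" using m z Mc by (subst (asm) right_cancel) auto
      then have "z [^] (i' - i) = inv m' \<otimes> m" using m z Mc by (simp add: inv_solve_left)
      also have "\<dots> \<in> M" using m sub by (simp add: subgroup.m_closed subgroup.m_inv_closed)
      finally obtain j where "i' - i = p * j" using dvd by blast
      then have "i' = i + p * j" using \<open>i \<le> i'\<close> by simp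
      then show ?thesis by (simp add: char)
    qed
    show ?thesis
    proof (cases "i \<le> i'")
      case True
      then show ?thesis by (rule *[OF eq m])
    next
      case False
      then have "i' \<le> i" by simp
      then show ?thesis by (rule *[OF eq[symmetric] m(2,1), symmetric])
    qed
  qed
  define e :: "'a \<Rightarrow> nat" where "e x = (SOME i. \<exists>m\<in>M. x = m \<otimes> z [^] i)" for x
  have e: "\<exists>m\<in>M. x = m \<otimes> z [^] e x" if "x \<in> carrier G" for x
    using someI_ex[OF decomp[OF that]] by (simp add: e_def)
  show ?thesis
  proof
    fix x y assume xy: "x \<in> carrier G" "y \<in> carrier G"
    define i j k where "i = e x" and "j = e y" and "k = e (x \<otimes> y)"
    obtain m m' m'' where m: "m \<in> M" "m' \<in> M" "m'' \<in> M"
      and eq: "x = m \<otimes> z [^] i" "y = m' \<otimes> z [^] j" "x \<otimes> y = m'' \<otimes> z [^] k"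
      using e[of x] e[of y] e[of "x \<otimes> y"] xy unfolding i_def j_def k_def by blast
    have c: "m \<in> carrier G" "m' \<in> carrier G" using m Mc by auto
    have "m'' \<otimes> z [^] k = (m \<otimes> z [^] i) \<otimes> (m' \<otimes> z [^] j)" using eq by simp
    also have "\<dots> = (m \<otimes> m') \<otimes> (z [^] i \<otimes> z [^] j)" using c z by (simp add: m_ac)
    also have "\<dots> = (m \<otimes> m') \<otimes> z [^] (i + j)" using z by (simp add: nat_pow_mult)
    finally have "of_nat k = (of_nat (i + j) :: 'k)"
      by (rule of_nat_eq) (use m sub in \<open>auto simp: subgroup.m_closed\<close>)
    then show "of_nat (e (x \<otimes> y)) = (of_nat (e x) :: 'k) + of_nat (e y)"
      by (simp add: i_def j_def k_def)
  next
    obtain m where m: "m \<in> M" "z = m \<otimes> z [^] e z" using e[OF z(1)] by blast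
    have "m \<otimes> z [^] e z = \<one> \<otimes> z [^] (1::nat)" using m(2)[symmetric] z by simp
    then have "of_nat (e z) = (of_nat 1 :: 'k)"
      by (rule of_nat_eq) (use m sub in \<open>auto simp: subgroup.one_closed\<close>)
    then show "of_nat (e z) \<noteq> (0 :: 'k)" by simp
  qed
qed

text \<open>The weighted orbit sums of \<open>g0\<close> are eigenfunctionals, and summing them over all eigenvalues
  recovers \<open>- g0\<close>.\<close>

lemma eigenfunctional_exists:
  fixes g0 :: "'g \<Rightarrow> 'k::field"
  assumes fin: "finite (UNIV :: 'k set)"
    and s: "s \<in> hom G G" and A: "group G"
    and per: "\<And>x. x \<in> carrier G \<Longrightarrow> (s ^^ (CARD('k) - 1)) x = x"
    and add: "\<And>x y. x \<in> carrier G \<Longrightarrow> y \<in> carrier G \<Longrightarrow> g0 (x \<otimes>\<^bsub>G\<^esub> y) = g0 x + g0 y"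
    and z: "z \<in> carrier G" "g0 z \<noteq> 0"
  obtains g :: "'g \<Rightarrow> 'k::field" and m where "m \<noteq> 0"
    "\<And>x y. x \<in> carrier G \<Longrightarrow> y \<in> carrier G \<Longrightarrow> g (x \<otimes>\<^bsub>G\<^esub> y) = g x + g y"
    "\<And>x. x \<in> carrier G \<Longrightarrow> g (s x) = m * g x" "g z \<noteq> 0"
proof -
  interpret group G by fact
  let ?n = "CARD('k) - 1"
  define g where "g m x = (\<Sum>i<?n. inverse m ^ i * g0 ((s ^^ i) x))" for m x
  have npos: "?n > 0" using card_mono[OF fin, of "{0, 1}"] by simp
  have g_add: "g m (x \<otimes>\<^bsub>G\<^esub> y) = g m x + g m y" if "x \<in> carrier G" "y \<in> carrier G" for m x y
  proof -
    have "g0 ((s ^^ i) (x \<otimes>\<^bsub>G\<^esub> y)) = g0 ((s ^^ i) x) + g0 ((s ^^ i) y)" for i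
      using that funpow_hom[OF s, of i] by (simp add: hom_mult hom_in_carrier add)
    then show ?thesis by (simp add: g_def distrib_left sum.distrib)
  qed
  have g_eigen: "g m (s x) = m * g m x" if m: "m \<noteq> 0" and x: "x \<in> carrier G" for m x
  proof -
    let ?f = "\<lambda>i. inverse m ^ i * g0 ((s ^^ i) x)"
    \<comment> \<open>Both \<open>s\<close> and \<open>m\<close> have period dividing
      \<open>CARD('k) - 1\<close>, so the index of the sum may be shifted cyclically; this shift is
      the eigenvalue equation.\<close>
    have "?f ?n = ?f 0"
      using finite_field_power_card[OF fin m] per[OF x] by (simp add: power_inverse)
    moreover have "(\<Sum>i<Suc ?n. ?f i) = ?f 0 + (\<Sum>i<?n. ?f (Suc i))" by (rule sum.lessThan_Suc_shift)
    ultimately have "(\<Sum>i<?n. ?f i) = (\<Sum>i<?n. ?f (Suc i))" by simp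
    then have "m * g m x = (\<Sum>i<?n. m * ?f (Suc i))" by (simp add: g_def sum_distrib_left)
    also have "\<dots> = g m (s x)"
      unfolding g_def using m by (intro sum.cong) (simp_all add: funpow_swap1)
    finally show ?thesis by simp
  qed
  have "(\<Sum>m\<in>UNIV - {0}. g m z) = (\<Sum>i<?n. \<Sum>m\<in>UNIV - {0}. inverse m ^ i * g0 ((s ^^ i) z))"
    unfolding g_def by (rule sum.swap)
  also have "\<dots> = (\<Sum>i<?n. (\<Sum>m\<in>UNIV - {0::'k}. inverse m ^ i) * g0 ((s ^^ i) z))"
    by (simp only: sum_distrib_right)
  also have "\<dots> = (\<Sum>i<?n. if i = 0 then - g0 z else 0)"
  proof (rule sum.cong[OF refl])
    fix i assume i: "i \<in> {..<?n}"
    have inv: "(\<Sum>m\<in>UNIV - {0::'k}. inverse m ^ i) = (\<Sum>m\<in>UNIV - {0::'k}. m ^ i)"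
      by (rule sum.reindex_bij_witness[of _ inverse inverse]) auto
    show "(\<Sum>m\<in>UNIV - {0::'k}. inverse m ^ i) * g0 ((s ^^ i) z) = (if i = 0 then - g0 z else 0)"
    proof (cases "i = 0")
      case True
      \<comment> \<open>At \<open>i = 0\<close> the inner sum counts the nonzero elements, and that
        number is -1 in the field.\<close>
      have "of_nat ?n = (- 1 :: 'k)"
        using of_nat_card_eq_0[OF fin] npos by (simp add: of_nat_diff)
      then show ?thesis using True by (simp add: card_nonzero[OF fin])
    next
      case False
      then have "\<not> ?n dvd i" using i by (auto dest: dvd_imp_le)
      then show ?thesis unfolding inv using sum_primitive_powers[OF fin, of i] False by simp
    qed
  qed
  also have "\<dots> = - g0 z" using npos by simp
  finally have "(\<Sum>m\<in>UNIV - {0}. g m z) \<noteq> 0" using z by simp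
  then obtain m where "m \<in> UNIV - {0}" "g m z \<noteq> 0" by (rule sum.not_neutral_contains_not_neutral)
  then show ?thesis using that[of m "g m"] g_add g_eigen by blast
qed

section \<open>Endomorphisms of elementary abelian groups with period prime to p\<close>

text \<open>The period of \<open>s\<close> divides \<open>Q - 1\<close>, which is prime to
  \<open>p\<close> because \<open>p\<close> divides \<open>Q\<close>. \<open>Q\<close> is tied to
  the order of the group only in \<open>irreducible\<close> and
  \<open>field_coordinate\<close>.\<close>

locale periodic_endomorphism = comm_group +
  fixes s :: "'a \<Rightarrow> 'a" and p Q :: nat
  assumes fin: "finite (carrier G)" and prime: "Factorial_Ring.prime p"
    and exponent: "x \<in> carrier G \<Longrightarrow> x [^] p = \<one>"
    and s_hom: "s \<in> hom G G"
    and period: "x \<in> carrier G \<Longrightarrow> (s ^^ (Q - 1)) x = x"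
    and Q: "1 < Q" "p dvd Q"
begin

lemma pow_hom: "(s ^^ n) \<in> hom G G"
  by (rule funpow_hom[OF s_hom])

lemma pow_closed [simp]: "x \<in> carrier G \<Longrightarrow> (s ^^ n) x \<in> carrier G"
  by (rule hom_in_carrier[OF pow_hom])

lemma pow_mult: "x \<in> carrier G \<Longrightarrow> y \<in> carrier G \<Longrightarrow> (s ^^ n) (x \<otimes> y) = (s ^^ n) x \<otimes> (s ^^ n) y"
  by (rule hom_mult[OF pow_hom])

lemma pow_inv: "x \<in> carrier G \<Longrightarrow> (s ^^ n) (inv x) = inv ((s ^^ n) x)"
  using group_hom.hom_inv[of G G "s ^^ n" x] pow_hom[of n] is_group
  unfolding group_hom_def group_hom_axioms_def by blast

lemma period_mult:
  assumes "x \<in> carrier G"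
  shows "(s ^^ (k * (Q - 1) + i)) x = (s ^^ i) x"
proof -
  have "(s ^^ (k * (Q - 1))) y = y" if "y \<in> carrier G" for y
    using that by (induction k) (simp_all add: funpow_add period del: One_nat_def)
  then show ?thesis using assms by (simp add: funpow_add)
qed

text \<open>Telescoping: the displacement over \<open>k * m\<close> steps is the product of the
  displacements over \<open>k\<close> blocks of \<open>m\<close> steps.\<close>

lemma displacement_iterate:
  assumes W: "subgroup W G" and X: "X \<subseteq> carrier G" "\<And>x. x \<in> X \<Longrightarrow> s x \<in> X"
    and triv: "\<And>x. x \<in> X \<Longrightarrow> (s ^^ m) x \<otimes> inv x \<in> W" and x: "x \<in> X"
  shows "(s ^^ (k * m)) x \<otimes> inv x \<in> W"
proof (induction k)
  case 0
  then show ?case using x X by (auto simp: subgroup.one_closed[OF W])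
next
  case (Suc k)
  let ?y = "(s ^^ (k * m)) x"
  have y: "?y \<in> X" using X(2) x by (rule funpow_closed)
  have c: "x \<in> carrier G" "?y \<in> carrier G" "(s ^^ m) ?y \<in> carrier G" using x y X(1) by auto
  have "(s ^^ (Suc k * m)) x \<otimes> inv x = ((s ^^ m) ?y \<otimes> inv ?y) \<otimes> (?y \<otimes> inv x)"
    using c by (simp add: funpow_add m_assoc mult_inv_cancel)
  then show ?case using Suc triv[OF y] by (simp add: subgroup.m_closed[OF W])
qed

text \<open>An automorphism of order prime to \<open>p\<close> that is trivial on both factors of a normal
  series is trivial.\<close>

lemma displacement_compose:
  assumes W: "subgroup W G" "\<And>x. x \<in> W \<Longrightarrow> s x \<in> W"
    and W1: "subgroup W1 G" "\<And>x. x \<in> W1 \<Longrightarrow> s x \<in> W1"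
    and X: "X \<subseteq> carrier G" "\<And>x. x \<in> X \<Longrightarrow> s x \<in> X"
    and t1: "\<And>x. x \<in> W1 \<Longrightarrow> (s ^^ m1) x \<otimes> inv x \<in> W"
    and t2: "\<And>x. x \<in> X \<Longrightarrow> (s ^^ m2) x \<otimes> inv x \<in> W1"
    and x: "x \<in> X"
  shows "(s ^^ (m1 * m2)) x \<otimes> inv x \<in> W"
proof -
  let ?m = "m1 * m2"
  have Wc: "W \<subseteq> carrier G" "W1 \<subseteq> carrier G" using W(1) W1(1) by (auto dest: subgroup.subset)
  have p_triv: "(s ^^ (p * ?m)) x \<otimes> inv x \<in> W" if x: "x \<in> X" for x
  proof -
    define d where "d = (s ^^ ?m) x \<otimes> inv x"
    have xc: "x \<in> carrier G" using x X by blast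
    have d: "d \<in> W1" unfolding d_def by (rule displacement_iterate[OF W1(1) X t2 x])
    then have dc: "d \<in> carrier G" using Wc by blast
    have ux: "(s ^^ ?m) x = d \<otimes> x" using xc by (simp add: d_def m_assoc)
    have "(s ^^ (m2 * m1)) d \<otimes> inv d \<in> W"
      by (rule displacement_iterate[OF W(1) Wc(2) W1(2) t1 d])
    then obtain w where w: "w \<in> W" "w = (s ^^ ?m) d \<otimes> inv d" by (simp add: mult.commute)
    have wc: "w \<in> carrier G" using w Wc by blast
    have ud: "(s ^^ ?m) d = w \<otimes> d" using dc by (simp add: w(2) m_assoc)
    have ud_pow: "(s ^^ ?m) (d [^] k) = w [^] k \<otimes> d [^] k" for k :: nat
    proof -
      have "(s ^^ ?m) (d [^] k) = ((s ^^ ?m) d) [^] k"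
        by (rule nat_pow_hom_image[OF is_group is_group pow_hom dc])
      then show ?thesis using wc dc by (simp add: ud nat_pow_distrib)
    qed
    \<comment> \<open>Each application of \<open>s ^^ ?m\<close> adds one factor \<open>d\<close>,
      with an error in \<open>W\<close>; after \<open>p\<close> applications the factor
      \<open>d [^] p\<close> is trivial.\<close>
    have "\<exists>v\<in>W. (s ^^ (k * ?m)) x = v \<otimes> d [^] k \<otimes> x" for k
    proof (induction k)
      case 0
      then show ?case using xc by (intro bexI[of _ \<one>]) (auto simp: subgroup.one_closed[OF W(1)])
    next
      case (Suc k)
      then obtain v where v: "v \<in> W" "(s ^^ (k * ?m)) x = v \<otimes> d [^] k \<otimes> x" by blast
      have vc: "v \<in> carrier G" using v Wc by blast
      have sv: "(s ^^ ?m) v \<in> W" using W(2) v(1) by (rule funpow_closed)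
      then have svc: "(s ^^ ?m) v \<in> carrier G" using Wc by blast
      have "(s ^^ (Suc k * ?m)) x = (s ^^ ?m) (v \<otimes> d [^] k \<otimes> x)"
        using v(2) by (simp add: funpow_add)
      also have "\<dots> = (s ^^ ?m) v \<otimes> (w [^] k \<otimes> d [^] k) \<otimes> (d \<otimes> x)"
        using vc dc xc by (simp only: pow_mult ud_pow ux m_closed nat_pow_closed)
      also have "\<dots> = ((s ^^ ?m) v \<otimes> w [^] k) \<otimes> d [^] Suc k \<otimes> x"
        using svc wc dc xc by (simp add: m_assoc)
      finally show ?case
        using subgroup.m_closed[OF W(1) sv subgroup_nat_pow_closed[OF W(1) w(1)]] by blast
    qed
    then obtain v where "v \<in> W" "(s ^^ (p * ?m)) x = v \<otimes> d [^] p \<otimes> x" by blast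
    moreover from this have "v \<in> carrier G" using Wc by blast
    ultimately show ?thesis using exponent[OF dc] xc by (simp add: m_assoc)
  qed
  \<comment> \<open>So \<open>Q * ?m\<close> steps displace by an element of \<open>W\<close>, and
    modulo the period \<open>Q - 1\<close> they amount to \<open>?m\<close> steps.\<close>
  obtain r where r: "Q = p * r" using Q(2) by blast
  have "(s ^^ (r * (p * ?m))) x \<otimes> inv x \<in> W"
    by (rule displacement_iterate[OF W(1) X p_triv x])
  moreover have "r * (p * ?m) = ?m * (Q - 1) + ?m"
  proof -
    have "r * (p * ?m) = Q * ?m" using r by simp
    also have "\<dots> = ?m * (Q - 1) + ?m" using Q(1) mult_eq_if[of Q ?m] by (simp add: mult.commute)
    finally show ?thesis .
  qed
  ultimately show ?thesis using period_mult[of x ?m ?m] x X(1) by auto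
qed

text \<open>Take \<open>v\<close> in \<open>X\<close> outside \<open>W\<close> and let
  \<open>m1\<close> be its period modulo \<open>W\<close>. The elements fixed by
  \<open>s ^^ m1\<close> modulo \<open>W\<close> form an invariant subgroup \<open>W1\<close>, which
  contains \<open>W\<close> and the \<open>m1\<close> further cosets of the iterates of
  \<open>v\<close>. Induction from \<open>W1\<close> to \<open>X\<close> supplies \<open>m2\<close>,
  and \<open>m1 * m2\<close> works.\<close>

lemma displacement_bound:
  assumes "subgroup W G" "\<And>x. x \<in> W \<Longrightarrow> s x \<in> W"
    and X: "subgroup X G" "\<And>x. x \<in> X \<Longrightarrow> s x \<in> X" and "W \<subseteq> X" "W \<noteq> X"
  shows "\<exists>m>0. (m + 1) * card W \<le> card X \<and> (\<forall>x\<in>X. (s ^^ m) x \<otimes> inv x \<in> W)"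
  using assms(1,2,5,6)
proof (induction "card X - card W" arbitrary: W rule: less_induct)
  case less
  have W: "subgroup W G" "\<And>x. x \<in> W \<Longrightarrow> s x \<in> W" and WX: "W \<subseteq> X" "W \<noteq> X" using less.prems by auto
  have Xc: "X \<subseteq> carrier G" using X(1) by (rule subgroup.subset)
  have finX: "finite X" using Xc fin finite_subset by blast
  obtain v where v: "v \<in> X" "v \<notin> W" using WX by blast
  have vc: "v \<in> carrier G" using v Xc by blast
  have svX: "(s ^^ i) v \<in> X" for i using X(2) v(1) by (rule funpow_closed)
  have svc: "(s ^^ i) v \<in> carrier G" for i using svX Xc by blast
  have Wpow: "(s ^^ i) w \<in> W" if "w \<in> W" for i w using W(2) that by (rule funpow_closed)
  define m1 where "m1 = (LEAST m. 0 < m \<and> (s ^^ m) v \<otimes> inv v \<in> W)"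
  have ex: "0 < Q - 1 \<and> (s ^^ (Q - 1)) v \<otimes> inv v \<in> W"
    using Q vc by (simp add: period subgroup.one_closed[OF W(1)] del: One_nat_def)
  have m1: "0 < m1" "(s ^^ m1) v \<otimes> inv v \<in> W"
    using LeastI[of "\<lambda>m. 0 < m \<and> (s ^^ m) v \<otimes> inv v \<in> W" "Q - 1"] ex unfolding m1_def by blast+
  have m1_le: "m1 \<le> Q - 1" unfolding m1_def by (rule Least_le) (rule ex)
  have m1_min: "\<not> (s ^^ i) v \<otimes> inv v \<in> W" if "0 < i" "i < m1" for i
    using not_less_Least[of i "\<lambda>m. 0 < m \<and> (s ^^ m) v \<otimes> inv v \<in> W"] that by (auto simp: m1_def)
  define W1 where "W1 = {x \<in> X. (s ^^ m1) x \<otimes> inv x \<in> W}"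
  have W1: "subgroup W1 G"
  proof (rule subgroupI)
    show "W1 \<subseteq> carrier G" using Xc by (auto simp: W1_def)
    show "W1 \<noteq> {}" using v m1 by (auto simp: W1_def)
    fix x assume x: "x \<in> W1"
    then have xX: "x \<in> X" and xc: "x \<in> carrier G" and xW: "(s ^^ m1) x \<otimes> inv x \<in> W" using Xc by (auto simp: W1_def)
    have "(s ^^ m1) (inv x) \<otimes> inv (inv x) = inv ((s ^^ m1) x \<otimes> inv x)"
      using xc by (simp add: pow_inv inv_mult)
    then show "inv x \<in> W1"
      using subgroup.m_inv_closed[OF W(1) xW] subgroup.m_inv_closed[OF X(1) xX] by (simp add: W1_def)
    fix y assume y: "y \<in> W1"
    then have yX: "y \<in> X" and yc: "y \<in> carrier G" and yW: "(s ^^ m1) y \<otimes> inv y \<in> W" using Xc by (auto simp: W1_def)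
    have "(s ^^ m1) (x \<otimes> y) \<otimes> inv (x \<otimes> y) = ((s ^^ m1) x \<otimes> inv x) \<otimes> ((s ^^ m1) y \<otimes> inv y)"
      using xc yc by (simp add: pow_mult inv_mult m_ac)
    then show "x \<otimes> y \<in> W1"
      using subgroup.m_closed[OF W(1) xW yW] subgroup.m_closed[OF X(1) xX yX] by (simp add: W1_def)
  qed
  have W1s: "s x \<in> W1" if "x \<in> W1" for x
  proof -
    have x: "x \<in> X" "x \<in> carrier G" "(s ^^ m1) x \<otimes> inv x \<in> W" using that Xc by (auto simp: W1_def)
    have "(s ^^ m1) (s x) \<otimes> inv (s x) = (s ^^ 1) ((s ^^ m1) x \<otimes> inv x)"
      using x(2) pow_closed[OF x(2), of 1] by (simp only: pow_mult pow_inv pow_closed inv_closed) (simp add: funpow_swap1)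
    then show ?thesis using X(2)[OF x(1)] W(2)[OF x(3)] by (simp add: W1_def)
  qed
  have vW1: "(s ^^ i) v \<in> W1" for i
  proof -
    have "v \<in> W1" using v m1 by (simp add: W1_def)
    then show ?thesis using W1s by (rule funpow_closed[rotated])
  qed
  have WW1: "W \<subseteq> W1"
  proof
    fix w assume w: "w \<in> W"
    then have "(s ^^ m1) w \<otimes> inv w \<in> W"
      using Wpow subgroup.m_closed[OF W(1)] subgroup.m_inv_closed[OF W(1)] by blast
    then show "w \<in> W1" using w WX by (auto simp: W1_def)
  qed
  have W1X: "W1 \<subseteq> X" by (auto simp: W1_def)
  have finW1: "finite W1" "finite W" using finX W1X WX(1) finite_subset by blast+
  \<comment> \<open>Undoing \<open>i\<close> steps is done by going forward \<open>Q - 1 - i\<close>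
    steps, so that no inverse of \<open>s\<close> is needed.\<close>
  have rewind: "(s ^^ (Q - 1 - i + j)) v = (s ^^ (j - i)) v" if "i \<le> j" "i \<le> Q - 1" for i j
  proof -
    have "Q - 1 - i + j = 1 * (Q - 1) + (j - i)" using that by linarith
    then show ?thesis using period_mult[OF vc, of 1 "j - i"] by (simp only:)
  qed
  have svW: "(s ^^ i) v \<notin> W" if "i < m1" for i
  proof
    assume "(s ^^ i) v \<in> W"
    then have "(s ^^ (Q - 1 - i)) ((s ^^ i) v) \<in> W" by (rule Wpow)
    then have "(s ^^ (Q - 1 - i + i)) v \<in> W" by (simp only: funpow_add o_apply)
    then show False using that m1_le v(2) period[OF vc] by (simp del: One_nat_def)
  qed
  have svv: "i = j" if ij: "i \<le> j" "j < m1" and W': "(s ^^ j) v \<otimes> inv ((s ^^ i) v) \<in> W" for i j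
  proof (rule ccontr)
    assume "i \<noteq> j"
    have "(s ^^ (Q - 1 - i)) ((s ^^ j) v \<otimes> inv ((s ^^ i) v)) \<in> W" using W' by (rule Wpow)
    also have "(s ^^ (Q - 1 - i)) ((s ^^ j) v \<otimes> inv ((s ^^ i) v)) =
        (s ^^ (Q - 1 - i + j)) v \<otimes> inv ((s ^^ (Q - 1 - i + i)) v)"
      using svc by (simp only: pow_mult pow_inv inv_closed funpow_add o_apply)
    also have "\<dots> = (s ^^ (j - i)) v \<otimes> inv v" using rewind[of i j] rewind[of i i] ij m1_le by (simp del: One_nat_def)
    finally show False using m1_min[of "j - i"] \<open>i \<noteq> j\<close> ij by simp
  qed
  \<comment> \<open>An index \<open>i < m1\<close> stands for the coset of the \<open>i\<close>-th
    iterate of \<open>v\<close>; the extra index \<open>m1\<close> stands for \<open>W\<close>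
    itself. Injectivity of \<open>h\<close> counts these \<open>m1 + 1\<close> cosets.\<close>
  define h where "h = (\<lambda>(w, i). if i = m1 then w else w \<otimes> (s ^^ i) v)"
  have Wc: "w \<in> carrier G" if "w \<in> W" for w using that W(1) subgroup.mem_carrier by metis
  have quot_mem: "b \<otimes> inv a \<in> W" if "w \<otimes> a = w' \<otimes> b" "w \<in> W" "w' \<in> W" "a \<in> carrier G" "b \<in> carrier G" for w w' a b
  proof -
    have wc: "w \<in> carrier G" "w' \<in> carrier G" using that Wc by auto
    have "inv w' \<otimes> (w \<otimes> a) \<otimes> inv a = inv w' \<otimes> (w' \<otimes> b) \<otimes> inv a" using that(1) by simp
    then have "b \<otimes> inv a = inv w' \<otimes> w" using wc that(4,5) by (simp add: m_assoc mult_inv_cancel)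
    then show ?thesis using that(2,3) W(1) by (simp add: subgroup.m_closed subgroup.m_inv_closed)
  qed
  have inj: "w = w' \<and> i = j" if A: "w \<in> W" "w' \<in> W" "i \<le> m1" "j \<le> m1" and eq: "h (w, i) = h (w', j)"
    for w i w' j
  proof -
    have no: "i = m1" if "j = m1" "h (w, i) = h (w', j)" "w \<in> W" "w' \<in> W" "i \<le> m1" for i j w w'
    proof (rule ccontr)
      assume "i \<noteq> m1"
      then have "w' \<otimes> \<one> = w \<otimes> (s ^^ i) v" using that Wc by (simp add: h_def)
      then have "(s ^^ i) v \<otimes> inv \<one> \<in> W" by (rule quot_mem) (use that svc in auto)
      then show False using svW[of i] svc \<open>i \<noteq> m1\<close> that(5) by simp
    qed
    consider "i = m1" "j = m1" | "i < m1" "j < m1"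
      using no[OF _ eq A(1,2)] no[OF _ eq[symmetric] A(2,1)] A(3,4) by fastforce
    then show ?thesis
    proof cases
      case 1
      then show ?thesis using eq by (simp add: h_def)
    next
      case 2
      then have eq': "w \<otimes> (s ^^ i) v = w' \<otimes> (s ^^ j) v" using eq by (simp add: h_def)
      have "i = j"
        using svv[of i j] svv[of j i] quot_mem[OF eq' A(1,2)] quot_mem[OF eq'[symmetric] A(2,1)] 2 svc
        by (metis nat_le_linear)
      then show ?thesis using eq' A Wc svc by simp
    qed
  qed
  have "inj_on h (W \<times> {..m1})"
    by (rule inj_onI) (use inj in auto)
  moreover have "h ` (W \<times> {..m1}) \<subseteq> W1"
    using WW1 vW1 subgroup.m_closed[OF W1] by (auto simp: h_def)
  ultimately have "card (W \<times> {..m1}) \<le> card W1" using finW1(1) by (intro card_inj_on_le)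
  then have bound: "(m1 + 1) * card W \<le> card W1" by (simp add: card_cartesian_product mult.commute)
  have W1_triv: "(s ^^ m1) x \<otimes> inv x \<in> W" if "x \<in> W1" for x using that by (simp add: W1_def)
  show ?case
  proof (cases "W1 = X")
    case True
    then show ?thesis using m1(1) bound W1_triv by blast
  next
    case False
    have "card W1 < card X" using False W1X finX by (intro psubset_card_mono) auto
    moreover have "v \<in> W1" using vW1[of 0] by simp
    then have "card W < card W1" using WW1 v(2) finW1(1) by (intro psubset_card_mono) auto
    ultimately have "card X - card W1 < card X - card W" by simp
    from less.hyps[OF this W1 W1s W1X False]
    obtain m2 where m2: "0 < m2" "(m2 + 1) * card W1 \<le> card X" "\<forall>x\<in>X. (s ^^ m2) x \<otimes> inv x \<in> W1" by blast
    have "(m1 * m2 + 1) * card W \<le> (m2 + 1) * ((m1 + 1) * card W)"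
      by (simp add: algebra_simps)
    also have "\<dots> \<le> (m2 + 1) * card W1" using bound by (rule mult_le_mono2)
    also have "\<dots> \<le> card X" by (rule m2(2))
    finally have "(m1 * m2 + 1) * card W \<le> card X" .
    moreover have "(s ^^ (m1 * m2)) x \<otimes> inv x \<in> W" if "x \<in> X" for x
      by (rule displacement_compose[OF W W1 W1s Xc X(2) W1_triv _ that]) (use m2(3) in auto)
    ultimately show ?thesis using m1(1) m2(1) by (intro exI[of _ "m1 * m2"]) auto
  qed
qed

text \<open>Applying \<open>displacement_bound\<close> below \<open>H\<close> and above
  \<open>H\<close> gives \<open>m1\<close> and \<open>m2\<close> with
  \<open>(m1 + 1) * (m2 + 1) \<le> Q\<close>. Then \<open>s ^^ (m1 * m2)\<close> is the identity by
  \<open>displacement_compose\<close>, although \<open>m1 * m2\<close> is positive and less than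
  \<open>Q - 1\<close>.\<close>

lemma irreducible:
  assumes card: "card (carrier G) = Q"
    and faithful: "\<And>m. 0 < m \<Longrightarrow> m < Q - 1 \<Longrightarrow> \<exists>x\<in>carrier G. (s ^^ m) x \<noteq> x"
    and H: "subgroup H G" "\<And>x. x \<in> H \<Longrightarrow> s x \<in> H" "H \<noteq> {\<one>}"
  shows "H = carrier G"
proof (rule ccontr)
  assume ne: "H \<noteq> carrier G"
  have Hc: "H \<subseteq> carrier G" using H(1) by (rule subgroup.subset)
  have triv: "subgroup {\<one>} G" "\<And>x. x \<in> {\<one>} \<Longrightarrow> s x \<in> {\<one>}"
    using triv_subgroup group_hom.hom_one[of G G s] s_hom
    by (auto simp: group_hom_def group_hom_axioms_def is_group)
  have whole: "subgroup (carrier G) G" "\<And>x. x \<in> carrier G \<Longrightarrow> s x \<in> carrier G"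
    using subgroup_self s_hom by (auto simp: hom_in_carrier)
  obtain m1 where m1: "0 < m1" "(m1 + 1) * card {\<one>} \<le> card H" "\<forall>x\<in>H. (s ^^ m1) x \<otimes> inv x \<in> {\<one>}"
    using displacement_bound[OF triv H(1,2)] subgroup.one_closed[OF H(1)] H(3) by blast
  obtain m2 where m2: "0 < m2" "(m2 + 1) * card H \<le> Q" "\<forall>x\<in>carrier G. (s ^^ m2) x \<otimes> inv x \<in> H"
    using displacement_bound[OF H(1,2) whole Hc ne] card by blast
  have "(m1 + 1) * (m2 + 1) \<le> card H * (m2 + 1)" using m1(2) by (intro mult_le_mono1) simp
  also have "\<dots> \<le> Q" using m2(2) by (simp add: mult.commute)
  finally have "m1 * m2 + 1 < Q" using m1(1) m2(1) by (simp add: algebra_simps)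
  then have "m1 * m2 < Q - 1" by linarith
  moreover have "0 < m1 * m2" using m1(1) m2(1) by simp
  ultimately obtain x where x: "x \<in> carrier G" "(s ^^ (m1 * m2)) x \<noteq> x" using faithful by blast
  have "(s ^^ (m1 * m2)) x \<otimes> inv x \<in> {\<one>}"
    by (rule displacement_compose[OF triv H(1,2) order_refl whole(2) _ _ x(1)]) (use m1(3) m2(3) in auto)
  then have "(s ^^ (m1 * m2)) x \<otimes> inv x = \<one>" by blast
  then show False using inv_equality[of "(s ^^ (m1 * m2)) x" "inv x"] x by simp
qed

text \<open>The kernel of a nonzero eigenfunctional is invariant and proper, hence trivial by
  irreducibility; equal cardinalities then give bijectivity. The eigenvalue is primitive because
  \<open>l ^ i = 1\<close> would make \<open>s ^^ i\<close> the identity.\<close>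

lemma field_coordinate:
  assumes cardK: "CARD('k::field) = Q" and card: "card (carrier G) = Q"
    and char: "of_nat p = (0 :: 'k)"
    and faithful: "\<And>m. 0 < m \<Longrightarrow> m < Q - 1 \<Longrightarrow> \<exists>x\<in>carrier G. (s ^^ m) x \<noteq> x"
  obtains g :: "'a \<Rightarrow> 'k::field" and l where "bij_betw g (carrier G) UNIV"
    "\<And>x y. x \<in> carrier G \<Longrightarrow> y \<in> carrier G \<Longrightarrow> g (x \<otimes> y) = g x + g y"
    "\<And>x. x \<in> carrier G \<Longrightarrow> g (s x) = l * g x" "primitive_element l"
proof -
  have finK: "finite (UNIV :: 'k set)" using cardK Q by (metis card.infinite not_one_less_zero)
  have "carrier G \<noteq> {\<one>}" using card Q by auto
  then obtain z where z: "z \<in> carrier G" "z \<noteq> \<one>" by blast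
  obtain g0 :: "'a \<Rightarrow> 'k" where g0: "\<And>x y. x \<in> carrier G \<Longrightarrow> y \<in> carrier G \<Longrightarrow> g0 (x \<otimes> y) = g0 x + g0 y" "g0 z \<noteq> 0"
    using additive_functional_exists[OF fin prime exponent char z] by blast
  have per: "(s ^^ (CARD('k) - 1)) x = x" if "x \<in> carrier G" for x using period[OF that] cardK by (simp del: One_nat_def)
  obtain g :: "'a \<Rightarrow> 'k" and l where l: "l \<noteq> 0"
    and g: "\<And>x y. x \<in> carrier G \<Longrightarrow> y \<in> carrier G \<Longrightarrow> g (x \<otimes> y) = g x + g y"
      "\<And>x. x \<in> carrier G \<Longrightarrow> g (s x) = l * g x" "g z \<noteq> 0"
    by (rule eigenfunctional_exists[OF finK s_hom is_group per g0(1) z(1) g0(2)]) (assumption+, rule that)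
  have "g \<one> + g \<one> = g \<one>" using g(1)[OF one_closed one_closed] l_one[OF one_closed] by metis
  then have g1: "g \<one> = 0" by (simp only: add_cancel_left_right)
  have ginv: "g (inv x) = - g x" if "x \<in> carrier G" for x
    using g(1)[of x "inv x"] that g1 by (simp add: eq_neg_iff_add_eq_0 add.commute)
  define H where "H = {x \<in> carrier G. g x = 0}"
  have "subgroup H G"
  proof (rule subgroupI)
    show "H \<noteq> {}" using g1 one_closed unfolding H_def by blast
  qed (auto simp: H_def ginv g(1))
  moreover have "s x \<in> H" if "x \<in> H" for x
    using that g(2) s_hom by (auto simp: H_def hom_in_carrier)
  moreover have "H \<noteq> carrier G" using z g(3) by (auto simp: H_def)
  ultimately have H: "H = {\<one>}" using irreducible[OF card faithful] by blast
  have inj: "inj_on g (carrier G)"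
  proof (rule inj_onI)
    fix x y assume xy: "x \<in> carrier G" "y \<in> carrier G" "g x = g y"
    then have "x \<otimes> inv y \<in> H" using g(1)[of x "inv y"] ginv[of y] by (simp add: H_def)
    then have "x \<otimes> inv y = \<one>" using H by blast
    then show "x = y" using inv_equality[of x "inv y"] xy by simp
  qed
  then have "g ` carrier G = UNIV"
    using finK card cardK by (intro card_subset_eq) (auto simp: card_image)
  then have bij: "bij_betw g (carrier G) UNIV" using inj by (simp add: bij_betw_def)
  have g_pow: "g ((s ^^ i) x) = l ^ i * g x" if "x \<in> carrier G" for i x
    using that by (induction i) (simp_all add: g(2) mult.assoc)
  have "primitive_element l"
  proof (rule primitive_elementI[OF l])
    fix i assume i: "0 < i" "i < CARD('k) - 1"
    then obtain x where x: "x \<in> carrier G" "(s ^^ i) x \<noteq> x" using faithful cardK by auto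
    show "l ^ i \<noteq> 1"
    proof
      assume "l ^ i = 1"
      then have "g ((s ^^ i) x) = g x" using g_pow[OF x(1)] by simp
      then show False using inj x by (auto dest: inj_onD)
    qed
  qed
  then show ?thesis using that bij g by blast
qed

end

section \<open>Automorphisms of maximal order\<close>

text \<open>The Heisenberg group with its cocycle in alternating form:
  \<open>qim (qcnj v * w)\<close> is the determinant of the coordinates of \<open>v\<close> and
  \<open>w\<close>.\<close>

definition heisenberg :: "('k::field qext \<times> 'k) monoid" where
  "heisenberg = \<lparr>carrier = UNIV,
     monoid.mult = (\<lambda>(v, t) (w, u). (v + w, t + u + qim (qcnj v * w))), one = (0, 0)\<rparr>"

lemma (in group) center_normal: "center G \<lhd> G"
proof (rule normal_invI[OF subgroup_center])
  fix x h assume x: "x \<in> carrier G" and h: "h \<in> center G"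
  have hc: "h \<in> carrier G" using h center_subset by blast
  have "x \<otimes> h \<otimes> inv x = h \<otimes> x \<otimes> inv x" using center_commute[OF h x] by simp
  then have "x \<otimes> h \<otimes> inv x = h" using x hc by (simp add: m_assoc)
  then show "x \<otimes> h \<otimes> inv x \<in> center G" using h by simp
qed

lemma (in normal) rcoset_eq_iff:
  assumes "x \<in> carrier G" "y \<in> carrier G"
  shows "H #> x = H #> y \<longleftrightarrow> x \<otimes> inv y \<in> H"
proof
  assume "H #> x = H #> y"
  then have "x \<in> H #> y" using rcos_self[OF assms(1) is_subgroup] by simp
  then show "x \<otimes> inv y \<in> H" using rcos_module_imp[of y x] assms(2) by blast
next
  assume "x \<otimes> inv y \<in> H"
  then have "x \<in> H #> y" using rcos_module_rev[of y x] assms by blast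
  then show "H #> x = H #> y" using repr_independence[OF _ assms(2) is_subgroup] by simp
qed

lemma (in class_two_group) commutator_mod_center:
  assumes "u \<in> carrier G" "u' \<in> carrier G" "v \<in> carrier G" "v' \<in> carrier G"
    and "u \<otimes> inv u' \<in> center G" "v \<otimes> inv v' \<in> center G"
  shows "commutator G u v = commutator G u' v'"
proof -
  have u: "u = (u \<otimes> inv u') \<otimes> u'" and v: "v = (v \<otimes> inv v') \<otimes> v'"
    using assms by (simp_all add: m_assoc)
  have "commutator G u v = commutator G u' v"
    by (subst u) (use assms in \<open>simp add: commutator_mult_left commutator_center_left\<close>)
  also have "\<dots> = commutator G u' v'"
    by (subst v) (use assms in \<open>simp add: commutator_mult_right commutator_center_left\<close>)
  finally show ?thesis .
qed

section \<open>The action on the central quotient\<close>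

text \<open>\<open>s\<close> has order exactly \<open>Q - 1\<close> with \<open>Q\<close> the index
  of the center. The name refers to Singer cycles: on \<open>G / Z(G)\<close> it will turn out to be
  multiplication by a primitive element.\<close>

locale singer_automorphism = semi_extraspecial_group +
  fixes s :: "'a \<Rightarrow> 'a" and Q :: nat
  assumes s_hom: "s \<in> hom G G"
    and period: "x \<in> carrier G \<Longrightarrow> (s ^^ (Q - 1)) x = x"
    and faithful: "0 < m \<Longrightarrow> m < Q - 1 \<Longrightarrow> \<exists>x\<in>carrier G. (s ^^ m) x \<noteq> x"
    and index: "card (rcosets (center G)) = Q"
    and Q: "1 < Q" "p dvd Q"
begin

lemma pow_s_hom: "(s ^^ n) \<in> hom G G"
  by (rule funpow_hom[OF s_hom])

lemma pow_s_closed [simp]: "x \<in> carrier G \<Longrightarrow> (s ^^ n) x \<in> carrier G"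
  by (rule hom_in_carrier[OF pow_s_hom])

lemma s_closed [simp]: "x \<in> carrier G \<Longrightarrow> s x \<in> carrier G"
  by (rule hom_in_carrier[OF s_hom])

text \<open>Every central element is a single commutator, so the effect of \<open>s\<close> on the
  center can be computed from its effect modulo the center.\<close>

lemma center_eq_commutator:
  obtains x0 where "x0 \<in> carrier G" "x0 \<notin> center G"
    "\<And>z. z \<in> center G \<Longrightarrow> \<exists>y\<in>carrier G. z = commutator G x0 y"
proof -
  obtain x0 where x0: "x0 \<in> carrier G" "x0 \<notin> center G" using center_ne_carrier center_subset by blast
  have "\<exists>y\<in>carrier G. z = commutator G x0 y" if "z \<in> center G" for z
    using that commutator_image[OF x0] by (metis imageE)
  then show ?thesis using that x0 by blast
qed

lemma pow_s_center:
  assumes "z \<in> center G"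
  shows "(s ^^ n) z \<in> center G"
proof -
  obtain x0 y where "x0 \<in> carrier G" "y \<in> carrier G" "z = commutator G x0 y"
    using center_eq_commutator assms by metis
  then show ?thesis
    using hom_commutator[OF is_group pow_s_hom] commutator_central by simp
qed

lemma pow_s_mult_period:
  assumes x: "x \<in> carrier G" and id: "\<And>x. x \<in> carrier G \<Longrightarrow> (s ^^ n) x = x"
  shows "(s ^^ (k * n)) x = x"
  using x by (induction k) (simp_all add: funpow_add id)

text \<open>If \<open>s ^^ m\<close> were trivial modulo the center, it would fix all commutators
  and so the center. It would then move each \<open>x\<close> by a fixed central factor of exponent
  \<open>p\<close>, so \<open>s ^^ (Q * m)\<close> would be the identity; but this is
  \<open>s ^^ m\<close>, as \<open>Q * m\<close> and \<open>m\<close> agree modulo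
  \<open>Q - 1\<close>.\<close>

lemma faithful_mod_center:
  assumes m: "0 < m" "m < Q - 1"
  obtains x where "x \<in> carrier G" "(s ^^ m) x \<otimes> inv x \<notin> center G"
proof -
  have "\<exists>x\<in>carrier G. (s ^^ m) x \<otimes> inv x \<notin> center G"
  proof (rule ccontr)
    assume "\<not> ?thesis"
    then have \<delta>: "(s ^^ m) x \<otimes> inv x \<in> center G" if "x \<in> carrier G" for x using that by blast
    have fix_center: "(s ^^ m) z = z" if z: "z \<in> center G" for z
    proof -
      obtain x0 y where xy: "x0 \<in> carrier G" "y \<in> carrier G" "z = commutator G x0 y"
        using center_eq_commutator z by metis
      have "(s ^^ m) z = commutator G ((s ^^ m) x0) ((s ^^ m) y)"
        using hom_commutator[OF is_group pow_s_hom] xy by simp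
      also have "\<dots> = z" using xy \<delta> by (simp add: commutator_mod_center[of _ x0 _ y])
      finally show ?thesis .
    qed
    have "(s ^^ (p * m)) x = x" if x: "x \<in> carrier G" for x
    proof -
      define d where "d = (s ^^ m) x \<otimes> inv x"
      have d: "d \<in> center G" using \<delta>[OF x] by (simp add: d_def)
      then have dc: "d \<in> carrier G" using center_subset by blast
      have sx: "(s ^^ m) x = d \<otimes> x" using x by (simp add: d_def m_assoc)
      have "(s ^^ (k * m)) x = d [^] k \<otimes> x" for k
      proof (induction k)
        case 0
        then show ?case using x by simp
      next
        case (Suc k)
        have "(s ^^ (Suc k * m)) x = (s ^^ m) (d [^] k \<otimes> x)" using Suc by (simp add: funpow_add)
        also have "\<dots> = (s ^^ m) (d [^] k) \<otimes> (s ^^ m) x"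
          by (rule hom_mult[OF pow_s_hom]) (use dc x in auto)
        also have "\<dots> = d [^] Suc k \<otimes> x"
          using subgroup_nat_pow_closed[OF subgroup_center d] dc x by (simp add: fix_center sx m_assoc)
        finally show ?case .
      qed
      then show ?thesis using center_pow[OF d] x by simp
    qed
    then have "(s ^^ (Q * m)) x = x" if "x \<in> carrier G" for x
      using Q(2) pow_s_mult_period[OF that, of "p * m" "Q div p"] by (simp add: mult.assoc[symmetric])
    moreover have "Q * m = m + m * (Q - 1)" using Q(1) mult_eq_if[of Q m] by (simp add: mult.commute)
    moreover have "(s ^^ (m + m * (Q - 1))) x = (s ^^ m) x" if "x \<in> carrier G" for x
      using pow_s_mult_period[OF that period, of m] by (simp add: funpow_add del: One_nat_def)
    ultimately show False using faithful[OF m] by metis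
  qed
  then show ?thesis using that by blast
qed

text \<open>\<open>field_coordinate\<close> for the endomorphism \<open>s'\<close> that
  \<open>s\<close> induces on the elementary abelian quotient \<open>G / Z(G)\<close>, pulled back
  to \<open>G\<close>.\<close>

lemma coordinate_exists:
  assumes cardK: "CARD('k::field) = Q" and char: "of_nat p = (0 :: 'k)"
  obtains \<psi> :: "'a \<Rightarrow> 'k::field" and l
  where "\<And>x y. x \<in> carrier G \<Longrightarrow> y \<in> carrier G \<Longrightarrow> \<psi> (x \<otimes> y) = \<psi> x + \<psi> y"
    "\<psi> ` carrier G = UNIV" "\<And>x. x \<in> carrier G \<Longrightarrow> \<psi> x = 0 \<longleftrightarrow> x \<in> center G"
    "\<And>x. x \<in> carrier G \<Longrightarrow> \<psi> (s x) = l * \<psi> x" "primitive_element l"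
proof -
  let ?Z = "center G" and ?V = "G Mod center G"
  interpret Z: normal ?Z G by (rule center_normal)
  have proj: "(\<lambda>x. ?Z #> x) \<in> hom G ?V" by (rule Z.r_coset_hom_Mod)
  have carV: "carrier ?V = (\<lambda>x. ?Z #> x) ` carrier G" by (auto simp: FactGroup_def RCOSETS_def)
  have one: "\<one>\<^bsub>?V\<^esub> = ?Z #> \<one>" using center_subset by (simp add: FactGroup_def coset_mult_one)
  have comm: "comm_group ?V" using derived_quot_is_comm_group by (simp add: derived_eq_center)
  have comp: "(\<lambda>x. ?Z #> s x) \<in> hom G ?V"
    using s_hom proj by (auto simp: hom_def Pi_iff)
  have cong: "?Z #> s x = ?Z #> s y"
    if xy: "x \<in> carrier G" "y \<in> carrier G" and eq: "?Z #> x = ?Z #> y" for x y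
  proof -
    have "x \<otimes> inv y \<in> ?Z" using eq Z.rcoset_eq_iff[OF xy] by simp
    then have "s (x \<otimes> inv y) \<in> ?Z" using pow_s_center[of _ 1] by simp
    moreover have "s (x \<otimes> inv y) = s x \<otimes> inv (s y)"
      using xy hom_mult[OF s_hom] group_hom.hom_inv[of G G s y] s_hom
      by (simp add: group_hom_def group_hom_axioms_def is_group)
    ultimately show ?thesis using Z.rcoset_eq_iff[of "s x" "s y"] xy by simp
  qed
  obtain s' where s': "s' \<in> hom ?V ?V" "\<And>x. x \<in> carrier G \<Longrightarrow> s' (?Z #> x) = ?Z #> s x"
    using FactGroup_universal[OF comp center_normal cong] by blast
  have s'_pow: "(s' ^^ n) (?Z #> x) = ?Z #> (s ^^ n) x" if "x \<in> carrier G" for x n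
    using that by (induction n) (simp_all add: s'(2))
  have cardV: "card (carrier ?V) = Q" using index by (simp add: FactGroup_def)
  interpret V: comm_group ?V by (rule comm)
  interpret V: periodic_endomorphism ?V s' p Q
  proof unfold_locales
    show "finite (carrier ?V)" using finite_carrier by (simp add: carV)
    show "X [^]\<^bsub>?V\<^esub> p = \<one>\<^bsub>?V\<^esub>" if "X \<in> carrier ?V" for X
    proof -
      obtain x where x: "x \<in> carrier G" "X = ?Z #> x" using \<open>X \<in> carrier ?V\<close> unfolding carV by blast
      have "X [^]\<^bsub>?V\<^esub> p = ?Z #> (x [^] p)"
        using nat_pow_hom_image[OF is_group V.is_group proj x(1)] x(2) by simp
      also have "\<dots> = \<one>\<^bsub>?V\<^esub>" 
        using coset_join2[OF _ subgroup_center pow_center[OF x(1)]] x(1) by (simp add: FactGroup_def)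
      finally show ?thesis .
    qed
    show "(s' ^^ (Q - 1)) X = X" if "X \<in> carrier ?V" for X
      using that s'_pow[of _ "Q - 1"] period carV by auto
  qed (use prime s'(1) Q in auto)
  have V_faithful: "\<exists>X\<in>carrier ?V. (s' ^^ m) X \<noteq> X" if m: "0 < m" "m < Q - 1" for m
  proof -
    obtain x where x: "x \<in> carrier G" "(s ^^ m) x \<otimes> inv x \<notin> ?Z" using faithful_mod_center[OF m] by blast
    then have "?Z #> (s ^^ m) x \<noteq> ?Z #> x" using Z.rcoset_eq_iff[of "(s ^^ m) x" x] by simp
    then show ?thesis using x(1) s'_pow[OF x(1), of m] carV by auto
  qed
  obtain g :: "'a set \<Rightarrow> 'k" and l where bij: "bij_betw g (carrier ?V) UNIV"
    and g: "\<And>x y. x \<in> carrier ?V \<Longrightarrow> y \<in> carrier ?V \<Longrightarrow> g (x \<otimes>\<^bsub>?V\<^esub> y) = g x + g y"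
      "\<And>x. x \<in> carrier ?V \<Longrightarrow> g (s' x) = l * g x" and l: "primitive_element l"
    by (rule V.field_coordinate[OF cardK cardV char V_faithful]) (assumption+, rule that)
  show ?thesis
  proof
    show "primitive_element l" by fact
    show "g (?Z #> (x \<otimes> y)) = g (?Z #> x) + g (?Z #> y)" if "x \<in> carrier G" "y \<in> carrier G" for x y
      using that hom_mult[OF proj that] g(1)[of "?Z #> x" "?Z #> y"] carV by simp
    show "(\<lambda>x. g (?Z #> x)) ` carrier G = UNIV"
      using bij carV by (metis bij_betw_imp_surj_on image_image)
    show "g (?Z #> s x) = l * g (?Z #> x)" if "x \<in> carrier G" for x
      using g(2)[of "?Z #> x"] that s'(2) carV by simp
    show "g (?Z #> x) = 0 \<longleftrightarrow> x \<in> ?Z" if x: "x \<in> carrier G" for x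
    proof -
      have "g (?Z #> \<one>) + g (?Z #> \<one>) = g (?Z #> \<one>)"
        using g(1)[of "\<one>\<^bsub>?V\<^esub>" "\<one>\<^bsub>?V\<^esub>"] V.l_one[OF V.one_closed] V.one_closed unfolding one by metis
      then have g1: "g (?Z #> \<one>) = 0" by (simp only: add_cancel_left_right)
      have "g (?Z #> x) = g (?Z #> \<one>) \<longleftrightarrow> ?Z #> x = ?Z #> \<one>"
        using bij x carV by (intro inj_on_eq_iff[of g "carrier ?V"]) (auto simp: bij_betw_def)
      also have "\<dots> \<longleftrightarrow> x \<in> ?Z" using Z.rcoset_eq_iff[OF x one_closed] x by simp
      finally show ?thesis by (simp add: g1)
    qed
  qed
qed

end

section \<open>The commutator form and the splitting of the group\<close>

context singer_automorphism
begin

lemma isomorphic_heisenberg: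
  assumes fin: "finite (UNIV :: 'k::field set)" and oddk: "odd CARD('k)"
    and Qk: "Q = CARD('k) * CARD('k)" and char: "of_nat p = (0 :: 'k)" and odd: "odd p"
  shows "G \<cong> (heisenberg :: ('k qext \<times> 'k) monoid)"
proof -
  let ?Z = "center G" and ?c = "commutator G"
  have ns: "has_nonsquare TYPE('k)" by (rule has_nonsquare_odd[OF fin oddk])
  have finK: "finite (UNIV :: 'k qext set)" by (rule finite_qext[OF fin])
  have cardK: "CARD('k qext) = Q" using card_qext[OF ns] Qk by simp
  have re_of_nat: "qre (of_nat n :: 'k qext) = of_nat n" and im_of_nat: "qim (of_nat n :: 'k qext) = 0" for n
    by (induction n) simp_all
  have charK: "of_nat p = (0 :: 'k qext)" using char by (simp add: qext_eq_iff re_of_nat im_of_nat)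
  have oddQ: "odd Q" using Qk oddk by simp
  obtain \<psi> :: "'a \<Rightarrow> 'k qext" and l
    where \<psi>_mult: "\<And>x y. x \<in> carrier G \<Longrightarrow> y \<in> carrier G \<Longrightarrow> \<psi> (x \<otimes> y) = \<psi> x + \<psi> y"
      and \<psi>_surj: "\<psi> ` carrier G = UNIV"
      and \<psi>_center: "\<And>x. x \<in> carrier G \<Longrightarrow> \<psi> x = 0 \<longleftrightarrow> x \<in> ?Z"
      and \<psi>_s: "\<And>x. x \<in> carrier G \<Longrightarrow> \<psi> (s x) = l * \<psi> x" and l: "primitive_element l"
    by (rule coordinate_exists[OF cardK charK]) (rule that, assumption+)
  have Zc: "z \<in> carrier G" if "z \<in> ?Z" for z using that center_subset by blast
  have Zm: "y \<otimes> z \<in> ?Z" if "y \<in> ?Z" "z \<in> ?Z" for y z using subgroup.m_closed[OF subgroup_center that] .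
  have Zi: "inv z \<in> ?Z" if "z \<in> ?Z" for z using subgroup.m_inv_closed[OF subgroup_center that] .
  have \<psi>_inv: "\<psi> (inv x) = - \<psi> x" if "x \<in> carrier G" for x
  proof -
    have "\<psi> x + \<psi> (inv x) = 0" using \<psi>_mult[of x "inv x"] \<psi>_center[of \<one>] that subgroup.one_closed[OF subgroup_center] by simp
    then show ?thesis by (simp add: eq_neg_iff_add_eq_0 add.commute)
  qed
  have \<psi>_eq: "x \<otimes> inv y \<in> ?Z" if "x \<in> carrier G" "y \<in> carrier G" "\<psi> x = \<psi> y" for x y
    using \<psi>_center[of "x \<otimes> inv y"] that by (simp add: \<psi>_mult \<psi>_inv)
  define r where "r x = (SOME g. g \<in> carrier G \<and> \<psi> g = x)" for x
  have r: "r x \<in> carrier G" "\<psi> (r x) = x" for x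
  proof -
    have "\<exists>g. g \<in> carrier G \<and> \<psi> g = x" using \<psi>_surj by (metis UNIV_I imageE)
    then show "r x \<in> carrier G" "\<psi> (r x) = x" using someI_ex[of "\<lambda>g. g \<in> carrier G \<and> \<psi> g = x"] by (auto simp: r_def)
  qed
  \<comment> \<open>The commutator map in field coordinates; the choice of representatives is
    harmless because commutators depend only on cosets of the center.\<close>
  define \<beta> where "\<beta> x y = ?c (r x) (r y)" for x y
  have \<beta>: "?c u v = \<beta> (\<psi> u) (\<psi> v)" if "u \<in> carrier G" "v \<in> carrier G" for u v
    unfolding \<beta>_def by (rule commutator_mod_center) (use that r \<psi>_eq in auto)
  have \<beta>Z: "\<beta> x y \<in> ?Z" for x y unfolding \<beta>_def using commutator_central r by blast
  have \<beta>c: "\<beta> x y \<in> carrier G" for x y using \<beta>Z Zc by blast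
  have \<beta>_left: "\<beta> (x + y) z = \<beta> x z \<otimes> \<beta> y z" for x y z
    using \<beta>[of "r x \<otimes> r y" "r z"] r by (simp add: \<psi>_mult commutator_mult_left \<beta>_def)
  have \<beta>_right: "\<beta> x (y + z) = \<beta> x y \<otimes> \<beta> x z" for x y z
    using \<beta>[of "r x" "r y \<otimes> r z"] r by (simp add: \<psi>_mult commutator_mult_right \<beta>_def)
  have \<beta>_alt: "\<beta> x x = \<one>" for x unfolding \<beta>_def using r by (simp add: commutator_eq_one_iff)
  have \<beta>_swap: "inv (\<beta> x y) = \<beta> y x" for x y unfolding \<beta>_def using r by (simp add: commutator_inverse)
  have \<beta>_s: "s (\<beta> x y) = \<beta> (l * x) (l * y)" for x y
  proof -
    have "s (\<beta> x y) = ?c (s (r x)) (s (r y))"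
      unfolding \<beta>_def by (rule hom_commutator[OF is_group s_hom r(1) r(1)])
    then show ?thesis using \<beta>[of "s (r x)" "s (r y)"] r by (simp add: \<psi>_s)
  qed
  have \<beta>_range: "range (\<beta> x) = ?Z" if "x \<noteq> 0" for x
  proof -
    have "r x \<notin> ?Z" using \<psi>_center[of "r x"] r that by simp
    then have img: "?c (r x) ` carrier G = ?Z" using commutator_image r by blast
    show ?thesis
    proof
      show "range (\<beta> x) \<subseteq> ?Z" using \<beta>Z by blast
      show "?Z \<subseteq> range (\<beta> x)"
      proof
        fix z assume "z \<in> ?Z"
        then obtain y where "y \<in> carrier G" "z = ?c (r x) y" using img by (metis imageE)
        then have "z = \<beta> x (\<psi> y)" using \<beta>[of "r x" y] r by simp
        then show "z \<in> range (\<beta> x)" by blast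
      qed
    qed
  qed
  let ?ZG = "G\<lparr>carrier := ?Z\<rparr>"
  have ZGgrp: "group ?ZG" by (rule subgroup_imp_group[OF subgroup_center])
  interpret ZG: comm_group ?ZG
    by (rule group.group_comm_groupI[OF ZGgrp]) (use center_commute Zc in auto)
  have sZG: "s \<in> hom ?ZG ?ZG"
    using pow_s_center[of _ 1] hom_mult[OF s_hom] Zc by (auto simp: hom_def)
  have ZG_pow: "z [^]\<^bsub>?ZG\<^esub> (n::nat) = z [^] n" for z n
    by (simp flip: nat_pow_consistent)
  txt \<open>An eigenfunctional of the center composed with \<open>\<beta>\<close> is a form as in \<open>alternating_eigenform\<close>.\<close>
  have separate: "\<exists>g :: 'a \<Rightarrow> 'k qext. g z \<noteq> 0 \<and> (\<forall>x\<in>?Z. \<forall>y\<in>?Z. g (x \<otimes> y) = g x + g y) \<and>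
      (\<forall>x y. g (\<beta> x y) = g (\<beta> 1 (qcnj x * y))) \<and> (\<forall>y. g (\<beta> 1 y) = 0 \<longleftrightarrow> qim y = 0)"
    if z: "z \<in> ?Z" "z \<noteq> \<one>" for z
  proof -
    have "finite (carrier ?ZG)" using finite_carrier center_subset finite_subset by auto
    moreover have "z' [^]\<^bsub>?ZG\<^esub> p = \<one>\<^bsub>?ZG\<^esub>" if "z' \<in> carrier ?ZG" for z' using that center_pow ZG_pow by simp
    ultimately obtain g0 :: "'a \<Rightarrow> 'k qext" where g0: "\<And>x y. x \<in> carrier ?ZG \<Longrightarrow> y \<in> carrier ?ZG \<Longrightarrow> g0 (x \<otimes>\<^bsub>?ZG\<^esub> y) = g0 x + g0 y" "g0 z \<noteq> 0"
      using ZG.additive_functional_exists[OF _ prime _ charK, of z] z by auto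
    have per: "(s ^^ (CARD('k qext) - 1)) x = x" if "x \<in> carrier ?ZG" for x
      using that period Zc cardK by (simp del: One_nat_def)
    have zc: "z \<in> carrier ?ZG" using z by simp
    obtain g :: "'a \<Rightarrow> 'k qext" and m where "m \<noteq> 0"
      and g: "\<And>x y. x \<in> carrier ?ZG \<Longrightarrow> y \<in> carrier ?ZG \<Longrightarrow> g (x \<otimes>\<^bsub>?ZG\<^esub> y) = g x + g y"
        "\<And>x. x \<in> carrier ?ZG \<Longrightarrow> g (s x) = m * g x" "g z \<noteq> 0"
      by (rule eigenfunctional_exists[OF finK sZG ZGgrp per g0(1) zc g0(2)]) (assumption+, rule that)
    have g_add: "g (x \<otimes> y) = g x + g y" if "x \<in> ?Z" "y \<in> ?Z" for x y using g(1)[of x y] that by simp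
    have g1: "g \<one> = 0"
    proof -
      have "g \<one> + g \<one> = g \<one>" using g_add[of \<one> \<one>] subgroup.one_closed[OF subgroup_center] by simp
      then show ?thesis by (simp only: add_cancel_left_right)
    qed
    define B where "B x y = g (\<beta> x y)" for x y
    obtain y0 where y0: "z = \<beta> 1 y0" using \<beta>_range[of 1] z by (metis imageE zero_neq_one)
    have B: "B (x + y) z = B x z + B y z" "B x (y + z) = B x y + B x z" "B x x = 0"
      "B (l * x) (l * y) = m * B x y" for x y z
      using \<beta>Z by (simp_all add: B_def \<beta>_left \<beta>_right \<beta>_alt g_add g1 g(2) flip: \<beta>_s)
    have B_nz: "B 1 y0 \<noteq> 0" using g(3) y0 by (simp add: B_def)
    have B_img: "range (B x) = range (B 1)" if "x \<noteq> 0" for x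
    proof -
      have "range (B x) = g ` range (\<beta> x)" for x by (auto simp: B_def)
      then show ?thesis using \<beta>_range[OF that] \<beta>_range[of 1] by simp
    qed
    note form = alternating_eigenform[OF fin oddk B(1-3) l B(4) B_nz B_img]
    show ?thesis
      by (rule exI[of _ g]) (use form g_add g(3) in \<open>auto simp: B_def\<close>)
  qed
  \<comment> \<open>If the two central elements differed, \<open>separate\<close> would give a
    functional nonzero on their quotient and yet equal on both.\<close>
  have \<beta>_eq: "\<beta> x y = \<beta> 1 (qcnj x * y)" for x y
  proof (rule ccontr)
    let ?a = "\<beta> x y" and ?b = "\<beta> 1 (qcnj x * y)"
    assume "?a \<noteq> ?b"
    then have ne: "?a \<otimes> inv ?b \<noteq> \<one>" using \<beta>c inv_equality[of ?a "inv ?b"] by auto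
    have mem: "?a \<otimes> inv ?b \<in> ?Z" using \<beta>Z Zm Zi by blast
    obtain g :: "'a \<Rightarrow> 'k qext" where g: "g (?a \<otimes> inv ?b) \<noteq> 0" "\<And>x y. x \<in> ?Z \<Longrightarrow> y \<in> ?Z \<Longrightarrow> g (x \<otimes> y) = g x + g y"
      "g ?a = g ?b"
      using separate[OF mem ne] by blast
    have "(?a \<otimes> inv ?b) \<otimes> ?b = ?a" using \<beta>c by (simp add: m_assoc)
    then have "g ?a = g (?a \<otimes> inv ?b) + g ?b" using g(2)[OF mem \<beta>Z] by metis
    then show False using g(1,3) by simp
  qed
  \<comment> \<open>Forward, any functional from \<open>separate\<close> will do, which requires
    only some nontrivial central element; backward, \<open>separate\<close> is applied to
    \<open>\<beta> 1 y\<close> itself.\<close>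
  have \<beta>_one: "\<beta> 1 y = \<one> \<longleftrightarrow> qim y = 0" for y
  proof
    assume y: "\<beta> 1 y = \<one>"
    obtain z where z: "z \<in> ?Z" "z \<noteq> \<one>"
    proof -
      have "?Z \<noteq> {\<one>}"
      proof
        assume "?Z = {\<one>}"
        then have "?c x y = \<one>" if "x \<in> carrier G" "y \<in> carrier G" for x y using commutator_central[OF that] by simp
        then have "carrier G \<subseteq> ?Z" unfolding center_def using commutator_eq_one_iff by blast
        then show False using center_ne_carrier center_subset by blast
      qed
      then show ?thesis using that subgroup.one_closed[OF subgroup_center] by blast
    qed
    obtain g :: "'a \<Rightarrow> 'k qext" where g: "\<And>x y. x \<in> ?Z \<Longrightarrow> y \<in> ?Z \<Longrightarrow> g (x \<otimes> y) = g x + g y"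
      "g (\<beta> 1 y) = 0 \<longleftrightarrow> qim y = 0"
      using separate[OF z] by blast
    have "g \<one> + g \<one> = g \<one>" using g(1)[of \<one> \<one>] subgroup.one_closed[OF subgroup_center] by simp
    then have "g \<one> = 0" by (simp only: add_cancel_left_right)
    then show "qim y = 0" using g(2) y by simp
  next
    assume y: "qim y = 0"
    show "\<beta> 1 y = \<one>"
    proof (rule ccontr)
      assume "\<beta> 1 y \<noteq> \<one>"
      then show False using separate[OF \<beta>Z, of 1 y] y by blast
    qed
  qed
  \<comment> \<open>The kernel of \<open>\<beta> 1\<close> consists of the elements with
    \<open>qim y = 0\<close>, so purely imaginary arguments parametrise \<open>Z(G)\<close> by the
    base field.\<close>
  define \<zeta> where "\<zeta> d = \<beta> 1 (qpair 0 d)" for d :: 'k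
  have \<zeta>_im: "\<beta> 1 y = \<zeta> (qim y)" for y
  proof -
    have "y = qpair (qre y) 0 + qpair 0 (qim y)" using ns by (simp add: qext_eq_iff qim_qpair)
    then have "\<beta> 1 y = \<beta> 1 (qpair (qre y) 0) \<otimes> \<beta> 1 (qpair 0 (qim y))" using \<beta>_right by metis
    moreover have "\<beta> 1 (qpair (qre y) 0) = \<one>" using \<beta>_one ns by (simp add: qim_qpair)
    ultimately show ?thesis using \<beta>c by (simp add: \<zeta>_def)
  qed
  have \<zeta>Z: "\<zeta> d \<in> ?Z" for d using \<beta>Z by (simp add: \<zeta>_def)
  have \<zeta>c: "\<zeta> d \<in> carrier G" for d using \<zeta>Z Zc by blast
  have \<zeta>_add: "\<zeta> (d + e) = \<zeta> d \<otimes> \<zeta> e" for d e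
  proof -
    have "qpair 0 (d + e) = qpair 0 d + qpair 0 e" using ns by (simp add: qext_eq_iff qim_qpair)
    then show ?thesis by (simp add: \<zeta>_def \<beta>_right)
  qed
  have \<zeta>_inj: "d = e" if "\<zeta> d = \<zeta> e" for d e
  proof -
    have "\<zeta> (d - e) \<otimes> \<zeta> e = \<one> \<otimes> \<zeta> e" using that \<zeta>_add[of "d - e" e] \<zeta>c by simp
    then have "\<zeta> (d - e) = \<one>" using \<zeta>c by (subst (asm) right_cancel) auto
    then show ?thesis using \<beta>_one ns by (simp add: \<zeta>_def qim_qpair)
  qed
  have \<zeta>_surj: "range \<zeta> = ?Z"
  proof
    show "range \<zeta> \<subseteq> ?Z" using \<zeta>Z by blast
    have "range (\<beta> 1) \<subseteq> range \<zeta>" using \<zeta>_im by auto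
    then show "?Z \<subseteq> range \<zeta>" using \<beta>_range[of 1] by simp
  qed
  have comm_\<zeta>: "?c u v = \<zeta> (qim (qcnj (\<psi> u) * \<psi> v))" if "u \<in> carrier G" "v \<in> carrier G" for u v
    using \<beta>[OF that] \<beta>_eq \<zeta>_im by simp
  txt \<open>An involution inverting \<open>G / Z(G)\<close> and fixing the center splits \<open>G\<close> canonically.\<close>
  define h where "h = (Q - 1) div 2"
  define \<iota> where "\<iota> = s ^^ h"
  have \<iota>_hom: "\<iota> \<in> hom G G" unfolding \<iota>_def by (rule pow_s_hom)
  have \<iota>c: "\<iota> x \<in> carrier G" if "x \<in> carrier G" for x using that by (simp add: \<iota>_def)
  have "l ^ h * l ^ h = l ^ (Q - 1)"
    using oddQ by (simp add: h_def flip: power_add mult_2)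
  also have "\<dots> = 1" using primitive_element_eq_1_iff[OF finK l] cardK by simp
  finally have "l ^ h = 1 \<or> l ^ h = - 1" by (simp add: square_eq_1_iff)
  moreover have "l ^ h \<noteq> 1"
  proof -
    have "0 < h" "h < Q - 1" using oddQ Q(1) by (auto simp: h_def elim!: oddE)
    then have "\<not> (Q - 1) dvd h" by (auto dest: dvd_imp_le)
    then show ?thesis using primitive_element_eq_1_iff[OF finK l] cardK by simp
  qed
  ultimately have lh: "l ^ h = - 1" by blast
  have \<psi>_pow: "\<psi> ((s ^^ n) x) = l ^ n * \<psi> x" if "x \<in> carrier G" for x n
    using that by (induction n) (simp_all add: \<psi>_s mult.assoc)
  have \<psi>_\<iota>: "\<psi> (\<iota> x) = - \<psi> x" if "x \<in> carrier G" for x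
    using \<psi>_pow[OF that, of h] lh by (simp add: \<iota>_def)
  \<comment> \<open>A central element is a commutator, and the two sign changes in its arguments
    cancel.\<close>
  have \<iota>_center: "\<iota> z = z" if "z \<in> ?Z" for z
  proof -
    obtain x0 where "x0 \<in> carrier G" "x0 \<notin> ?Z" "\<And>z. z \<in> ?Z \<Longrightarrow> \<exists>y\<in>carrier G. z = ?c x0 y"
      by (rule center_eq_commutator) (rule that, assumption+)
    then obtain y where xy: "x0 \<in> carrier G" "y \<in> carrier G" "z = ?c x0 y" using \<open>z \<in> ?Z\<close> by blast
    have "\<iota> z = ?c (\<iota> x0) (\<iota> y)" using hom_commutator[OF is_group \<iota>_hom] xy by simp
    also have "\<dots> = ?c x0 y" using xy \<iota>c by (simp add: comm_\<zeta> \<psi>_\<iota>)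
    finally show ?thesis using xy by simp
  qed
  \<comment> \<open>This product is central because the coordinates of its factors cancel, and it
    equals the square of \<open>x\<close> for central \<open>x\<close>. Its defect from being
    multiplicative is the commutator of \<open>y\<close> with \<open>\<iota> x\<close>, which is
    that of \<open>x\<close> with \<open>y\<close>: exactly the Heisenberg cocycle.\<close>
  define \<xi> where "\<xi> x = x \<otimes> \<iota> x" for x
  have \<xi>Z: "\<xi> x \<in> ?Z" if "x \<in> carrier G" for x
    using \<psi>_center[of "\<xi> x"] that \<iota>c by (simp add: \<xi>_def \<psi>_mult \<psi>_\<iota>)
  have \<xi>_mult: "\<xi> (x \<otimes> y) = \<xi> x \<otimes> \<xi> y \<otimes> \<zeta> (qim (qcnj (\<psi> x) * \<psi> y))"
    if xy: "x \<in> carrier G" "y \<in> carrier G" for x y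
  proof -
    have c: "\<iota> x \<in> carrier G" "\<iota> y \<in> carrier G" using xy \<iota>c by auto
    let ?k = "?c y (\<iota> x)"
    have kZ: "?k \<in> ?Z" using commutator_central xy c by blast
    have k: "?k = \<zeta> (qim (qcnj (\<psi> x) * \<psi> y))"
      using xy c by (simp add: comm_\<zeta> \<psi>_\<iota> mult.commute)
    have "\<xi> (x \<otimes> y) = x \<otimes> (y \<otimes> \<iota> x) \<otimes> \<iota> y"
      using xy c hom_mult[OF \<iota>_hom] by (simp add: \<xi>_def m_assoc)
    also have "\<dots> = x \<otimes> (?k \<otimes> (\<iota> x \<otimes> y)) \<otimes> \<iota> y"
      using commutator_mult_swap xy c by simp
    also have "\<dots> = x \<otimes> ((\<iota> x \<otimes> y) \<otimes> ?k) \<otimes> \<iota> y"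
      using center_commute[OF kZ, of "\<iota> x \<otimes> y"] xy c by simp
    also have "\<dots> = x \<otimes> (\<iota> x \<otimes> y) \<otimes> (?k \<otimes> \<iota> y)" using xy c by (simp add: m_assoc)
    also have "\<dots> = x \<otimes> (\<iota> x \<otimes> y) \<otimes> (\<iota> y \<otimes> ?k)" using center_commute[OF kZ, of "\<iota> y"] c by simp
    also have "\<dots> = \<xi> x \<otimes> \<xi> y \<otimes> ?k" using xy c by (simp add: \<xi>_def m_assoc)
    finally show ?thesis by (simp add: k)
  qed
  define w where "w x = inv_into UNIV \<zeta> (\<xi> x)" for x
  have w: "\<zeta> (w x) = \<xi> x" if "x \<in> carrier G" for x
    unfolding w_def using \<xi>Z[OF that] \<zeta>_surj by (simp add: f_inv_into_f)
  have w_mult: "w (x \<otimes> y) = w x + w y + qim (qcnj (\<psi> x) * \<psi> y)"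
    if xy: "x \<in> carrier G" "y \<in> carrier G" for x y
    by (rule \<zeta>_inj) (use xy in \<open>simp add: w \<xi>_mult \<zeta>_add\<close>)
  let ?\<Phi> = "\<lambda>x. (\<psi> x, w x)"
  have hom: "?\<Phi> \<in> hom G heisenberg"
    by (rule homI) (simp_all add: heisenberg_def \<psi>_mult w_mult)
  have sq: "z = \<one>" if z: "z \<in> carrier G" "z \<otimes> z = \<one>" for z
  proof -
    obtain k where k: "Coset.order G = 2 * k + 1" using odd_order[OF odd] oddE by blast
    have "z [^] (2 * k + 1) = (z [^] (2::nat)) [^] k \<otimes> z"
      using z(1) by (simp add: nat_pow_pow)
    moreover have "z [^] (2::nat) = \<one>" using z by (simp add: numeral_2_eq_2)
    ultimately show ?thesis using pow_order_eq_1[OF z(1)] k z(1) by simp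
  qed
  \<comment> \<open>Elements with equal image differ by a central \<open>z\<close> with
    \<open>z \<otimes> z = \<one>\<close>, and a group of odd order has no involution.\<close>
  have inj: "inj_on ?\<Phi> (carrier G)"
  proof (rule inj_onI)
    fix x y assume xy: "x \<in> carrier G" "y \<in> carrier G" and eq: "(\<psi> x, w x) = (\<psi> y, w y)"
    define z where "z = x \<otimes> inv y"
    have z: "z \<in> ?Z" using \<psi>_eq xy eq by (simp add: z_def)
    have zc: "z \<in> carrier G" using z Zc by blast
    have x: "x = z \<otimes> y" using xy by (simp add: z_def m_assoc)
    have "\<psi> z = 0" using \<psi>_center[OF zc] z by simp
    then have "w x = w z + w y" using w_mult[OF zc xy(2)] x by simp
    then have "w z + w y = 0 + w y" using eq by simp
    then have "w z = 0" by (simp only: add_right_cancel)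
    moreover have "\<zeta> 0 = \<one>" using \<beta>_one ns by (simp add: \<zeta>_def qim_qpair)
    ultimately have "\<xi> z = \<one>" using w[OF zc] by simp
    then have "z \<otimes> z = \<one>" using \<iota>_center[OF z] by (simp add: \<xi>_def)
    then have "z = \<one>" using sq zc by blast
    then show "x = y" using x xy by simp
  qed
  have cardZ: "card ?Z = CARD('k)"
    using card_image[of \<zeta> UNIV] \<zeta>_inj \<zeta>_surj by (metis inj_onI)
  have "card (carrier G) = CARD('k qext \<times> 'k)"
    using lagrange[OF subgroup_center] index cardZ cardK
    by (simp add: Coset.order_def card_cartesian_product flip: UNIV_Times_UNIV)
  then have "?\<Phi> ` carrier G = UNIV"
    using finK fin inj by (intro card_subset_eq) (auto simp: card_image finite_Prod_UNIV)
  then have "?\<Phi> \<in> iso G heisenberg"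
    using hom inj by (simp add: iso_def bij_betw_def heisenberg_def)
  then show ?thesis by (auto simp: is_iso_def)
qed

end

section \<open>Sylow subgroups of \<open>SL\<^sub>3(q)\<close>\<close>

definition mat3 :: "'a \<Rightarrow> 'a \<Rightarrow> 'a \<Rightarrow> 'a \<Rightarrow> 'a \<Rightarrow> 'a \<Rightarrow> 'a \<Rightarrow> 'a \<Rightarrow> 'a \<Rightarrow> 'a mat" where
  "mat3 a b c d e f g h i = mat_of_rows_list 3 [[a, b, c], [d, e, f], [g, h, i]]"

lemma mat3_carrier [simp]: "mat3 a b c d e f g h i \<in> carrier_mat 3 3"
  by (simp add: mat3_def mat_of_rows_list_def carrier_matI)

lemma less_3_cases: "(i::nat) < 3 \<longleftrightarrow> i = 0 \<or> i = 1 \<or> i = 2"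
  by auto

lemma mat3_index [simp]:
  "mat3 a b c d e f g h i $$ (0, 0) = a" "mat3 a b c d e f g h i $$ (0, 1) = b" "mat3 a b c d e f g h i $$ (0, 2) = c"
  "mat3 a b c d e f g h i $$ (1, 0) = d" "mat3 a b c d e f g h i $$ (1, 1) = e" "mat3 a b c d e f g h i $$ (1, 2) = f"
  "mat3 a b c d e f g h i $$ (2, 0) = g" "mat3 a b c d e f g h i $$ (2, 1) = h" "mat3 a b c d e f g h i $$ (2, 2) = i"
  by (simp_all add: mat3_def mat_of_rows_list_def)

lemmas mat3_index_Suc [simp] = mat3_index[unfolded One_nat_def]

lemma mat3_eqI:
  assumes "A \<in> carrier_mat 3 3" "B \<in> carrier_mat 3 3" "\<And>i j. i \<in> {0, 1, 2} \<Longrightarrow> j \<in> {0, 1, 2} \<Longrightarrow> A $$ (i, j) = B $$ (i, j)"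
  shows "A = B"
  using assms by (intro eq_matI) (auto simp: less_3_cases)

lemma mat3_cases:
  assumes "A \<in> carrier_mat 3 3"
  obtains a b c d e f g h i where "A = mat3 a b c d e f g h i"
proof -
  have "A = mat3 (A $$ (0, 0)) (A $$ (0, 1)) (A $$ (0, 2)) (A $$ (1, 0)) (A $$ (1, 1)) (A $$ (1, 2))
      (A $$ (2, 0)) (A $$ (2, 1)) (A $$ (2, 2))"
    by (rule mat3_eqI[OF assms mat3_carrier]) (simp, elim disjE; simp)
  then show ?thesis using that by blast
qed

lemma mat3_eq_iff:
  "mat3 a b c d e f g h i = mat3 a' b' c' d' e' f' g' h' i' \<longleftrightarrow>
    a = a' \<and> b = b' \<and> c = c' \<and> d = d' \<and> e = e' \<and> f = f' \<and> g = g' \<and> h = h' \<and> i = i'"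
  (is "?A = ?B \<longleftrightarrow> _")
proof
  assume eq: "?A = ?B"
  have "?A $$ (r, s) = ?B $$ (r, s)" for r s by (simp only: eq)
  from this[of 0 0] this[of 0 1] this[of 0 2] this[of 1 0] this[of 1 1] this[of 1 2] this[of 2 0] this[of 2 1] this[of 2 2]
  show "a = a' \<and> b = b' \<and> c = c' \<and> d = d' \<and> e = e' \<and> f = f' \<and> g = g' \<and> h = h' \<and> i = i'"
    by (simp only: mat3_index)
qed simp

lemma mat3_mult:
  "mat3 a b c d e f g h i * mat3 a' b' c' d' e' f' g' h' i' =
    mat3 (a * a' + b * d' + c * g') (a * b' + b * e' + c * h') (a * c' + b * f' + c * i')
      (d * a' + e * d' + f * g') (d * b' + e * e' + f * h') (d * c' + e * f' + f * i')
      (g * a' + h * d' + i * g') (g * b' + h * e' + i * h') (g * c' + h * f' + i * (i'::'a::comm_ring_1))"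
proof (rule mat3_eqI[OF mult_carrier_mat[OF mat3_carrier mat3_carrier] mat3_carrier])
  have prod: "(A * B) $$ (r, s) = A $$ (r, 0) * B $$ (0, s) + A $$ (r, 1) * B $$ (1, s) + A $$ (r, 2) * B $$ (2, s)"
    if "A \<in> carrier_mat 3 3" "B \<in> carrier_mat 3 3" "r < 3" "s < 3" for A B :: "'a mat" and r s
    using that by (simp add: scalar_prod_def numeral_3_eq_3 numeral_2_eq_2)
  fix r s :: nat
  assume rs: "r \<in> {0, 1, 2}" "s \<in> {0, 1, 2}"
  then have "r < 3" "s < 3" by auto
  from prod[OF mat3_carrier mat3_carrier this] rs
  show "(mat3 a b c d e f g h i * mat3 a' b' c' d' e' f' g' h' i') $$ (r, s) =
    mat3 (a * a' + b * d' + c * g') (a * b' + b * e' + c * h') (a * c' + b * f' + c * i')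
      (d * a' + e * d' + f * g') (d * b' + e * e' + f * h') (d * c' + e * f' + f * i')
      (g * a' + h * d' + i * g') (g * b' + h * e' + i * h') (g * c' + h * f' + i * i') $$ (r, s)"
    by (auto simp del: One_nat_def)
qed

lemma mat3_one: "1\<^sub>m 3 = mat3 1 0 0 0 1 0 0 0 (1::'a::comm_ring_1)"
  by (rule mat3_eqI) auto

lemma det_mat3_upper: "det (mat3 a b c 0 e f 0 0 i) = a * e * (i::'a::comm_ring_1)"
proof -
  have dim: "dim_row (mat3 a b c 0 e f 0 0 i) = 3" by (rule carrier_matD(1)[OF mat3_carrier])
  have "upper_triangular (mat3 a b c 0 e f 0 0 i)"
    unfolding upper_triangular_def dim by (auto simp: less_3_cases less_2_cases_iff)
  then have "det (mat3 a b c 0 e f 0 0 i) = prod_list (diag_mat (mat3 a b c 0 e f 0 0 i))"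
    by (rule det_upper_triangular[OF _ mat3_carrier])
  also have "diag_mat (mat3 a b c 0 e f 0 0 i) = [a, e, i]"
  proof -
    have "[0..<3] = [0, 1, 2 :: nat]" by (simp add: numeral_3_eq_3 numeral_2_eq_2)
    then show ?thesis by (simp add: diag_mat_def dim)
  qed
  finally show ?thesis by (simp add: mult.assoc)
qed

section \<open>Fixed vectors and covectors of p-subgroups\<close>

text \<open>Vectors are triples, so that their number can be read off the product type.\<close>

definition mat3_vec :: "'a::comm_ring_1 mat \<Rightarrow> 'a \<times> 'a \<times> 'a \<Rightarrow> 'a \<times> 'a \<times> 'a" where
  "mat3_vec A = (\<lambda>(x, y, z). (A $$ (0,0) * x + A $$ (0,1) * y + A $$ (0,2) * z,
     A $$ (1,0) * x + A $$ (1,1) * y + A $$ (1,2) * z, A $$ (2,0) * x + A $$ (2,1) * y + A $$ (2,2) * z))"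

definition vec_mat3 :: "'a \<times> 'a \<times> 'a \<Rightarrow> 'a::comm_ring_1 mat \<Rightarrow> 'a \<times> 'a \<times> 'a" where
  "vec_mat3 = (\<lambda>(x, y, z) A. (x * A $$ (0,0) + y * A $$ (1,0) + z * A $$ (2,0),
     x * A $$ (0,1) + y * A $$ (1,1) + z * A $$ (2,1), x * A $$ (0,2) + y * A $$ (1,2) + z * A $$ (2,2)))"

fun dot3 :: "'a::comm_ring_1 \<times> 'a \<times> 'a \<Rightarrow> 'a \<times> 'a \<times> 'a \<Rightarrow> 'a" where
  "dot3 (x, y, z) (x', y', z') = x * x' + y * y' + z * z'"

lemma dot3_add: "dot3 (u + w) v = dot3 u v + dot3 w v"
  by (cases u, cases w, cases v) (simp add: algebra_simps)

lemma mat3_vec_mult: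
  assumes "A \<in> carrier_mat 3 3" "B \<in> carrier_mat 3 3"
  shows "mat3_vec (A * B) v = mat3_vec A (mat3_vec B v)"
  using assms by (elim mat3_cases, cases v) (simp add: mat3_mult mat3_vec_def algebra_simps del: One_nat_def)

lemma vec_mat3_mult:
  assumes "A \<in> carrier_mat 3 3" "B \<in> carrier_mat 3 3"
  shows "vec_mat3 v (A * B) = vec_mat3 (vec_mat3 v A) B"
  using assms by (elim mat3_cases, cases v) (simp add: mat3_mult vec_mat3_def algebra_simps del: One_nat_def)

lemma dot3_mat3:
  "dot3 (vec_mat3 w A) v = dot3 w (mat3_vec A v)"
  by (cases v, cases w) (simp add: mat3_vec_def vec_mat3_def algebra_simps del: One_nat_def)

lemma mat3_vec_one: "mat3_vec (1\<^sub>m 3) v = v" "vec_mat3 v (1\<^sub>m 3) = v"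
  by (cases v; simp add: mat3_one mat3_vec_def vec_mat3_def del: One_nat_def)+

definition unitriangular :: "'k::field mat set" where
  "unitriangular = {mat3 1 x z 0 1 y 0 0 1 | x y z. True}"

lemma SL_simps [simp]:
  "monoid.mult (SL TYPE('k::field) n) = (*)" "one (SL TYPE('k) n) = 1\<^sub>m n"
  "A \<in> carrier (SL TYPE('k) n) \<longleftrightarrow> A \<in> carrier_mat n n \<and> det A = 1"
  by (simp_all add: SL_def)

lemma unitriangular_subgroup: "subgroup unitriangular (SL TYPE('k::field) 3)"
proof -
  interpret group "SL TYPE('k) 3" by (rule group_SL)
  show ?thesis
  proof (rule subgroupI)
    show "unitriangular \<subseteq> carrier (SL TYPE('k) 3)" by (auto simp: unitriangular_def det_mat3_upper)
    show "(unitriangular :: 'k mat set) \<noteq> {}" by (auto simp: unitriangular_def)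
    fix A :: "'k mat" assume "A \<in> unitriangular"
    then obtain x y z where A: "A = mat3 1 x z 0 1 y 0 0 1" by (auto simp: unitriangular_def)
    let ?B = "mat3 1 (- x) (x * y - z) 0 1 (- y) 0 0 1"
    have "inv\<^bsub>SL TYPE('k) 3\<^esub> A = ?B"
      by (rule inv_equality) (simp_all add: A det_mat3_upper mat3_mult mat3_one algebra_simps)
    then show "inv\<^bsub>SL TYPE('k) 3\<^esub> A \<in> unitriangular" by (auto simp: unitriangular_def)
    fix B :: "'k mat" assume "B \<in> unitriangular"
    then obtain x' y' z' where B: "B = mat3 1 x' z' 0 1 y' 0 0 1" by (auto simp: unitriangular_def)
    have "A * B = mat3 1 (x' + x) (z' + x * y' + z) 0 1 (y' + y) 0 0 1" by (simp add: A B mat3_mult)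
    then show "A \<otimes>\<^bsub>SL TYPE('k) 3\<^esub> B \<in> unitriangular" by (auto simp: unitriangular_def)
  qed
qed

lemma unitriangular_bij: "bij_betw (\<lambda>(x, y, z). mat3 1 x z 0 1 y 0 0 1) UNIV (unitriangular :: 'k::field mat set)"
  by (auto simp: bij_betw_def inj_on_def mat3_eq_iff unitriangular_def image_def)

lemma card_unitriangular: "card (unitriangular :: 'k::field mat set) = CARD('k) ^ 3"
proof -
  have "CARD('k \<times> 'k \<times> 'k) = card (unitriangular :: 'k mat set)"
    by (rule bij_betw_same_card[OF unitriangular_bij])
  then show ?thesis by (simp add: card_cartesian_product power3_eq_cube flip: UNIV_Times_UNIV)
qed

text \<open>\<open>p_group_fixes_another_point\<close> is used twice: on all vectors, and then on
  the covectors that vanish on the fixed vector \<open>v\<close>.\<close>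

lemma fixed_flag:
  fixes P :: "'k::field mat set"
  assumes fin: "finite (UNIV :: 'k set)" and p: "Factorial_Ring.prime p" and q: "CARD('k) = p ^ a" "a > 0"
    and P: "subgroup P (SL TYPE('k) 3)" "card P = p ^ n"
  obtains v w :: "'k \<times> 'k \<times> 'k" where "v \<noteq> 0" "w \<noteq> 0" "dot3 w v = 0"
    "\<And>A. A \<in> P \<Longrightarrow> mat3_vec A v = v" "\<And>A. A \<in> P \<Longrightarrow> vec_mat3 w A = w"
proof -
  interpret S: group "SL TYPE('k) 3" by (rule group_SL)
  let ?P = "SL TYPE('k) 3\<lparr>carrier := P\<rparr>"
  have grpP: "group ?P" by (rule S.subgroup_imp_group[OF P(1)])
  have ordP: "Coset.order ?P = p ^ n" using P(2) by (simp add: Coset.order_def)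
  have Pc: "A \<in> carrier_mat 3 3" if "A \<in> P" for A using subgroup.mem_carrier[OF P(1) that] by simp
  have P_one: "1\<^sub>m 3 \<in> P" using subgroup.one_closed[OF P(1)] by simp
  have finv: "finite (UNIV :: ('k \<times> 'k \<times> 'k) set)" using fin by (simp add: finite_Prod_UNIV)
  have zero: "(0 :: 'k \<times> 'k \<times> 'k) = (0, 0, 0)" by (simp add: zero_prod_def)
  have cardv: "CARD('k \<times> 'k \<times> 'k) = p ^ (a * 3)"
    using q by (simp add: card_cartesian_product power_mult power3_eq_cube flip: UNIV_Times_UNIV)
  obtain v :: "'k \<times> 'k \<times> 'k" where v: "v \<noteq> 0" "\<And>A. A \<in> P \<Longrightarrow> mat3_vec A v = v"
  proof (rule p_group_fixes_another_point[OF grpP ordP p finv, where act = mat3_vec and e = 0])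
    show "p dvd CARD('k \<times> 'k \<times> 'k)" using cardv q(2) by simp
  qed (auto simp: mat3_vec_one mat3_vec_mult Pc, simp_all add: mat3_vec_def zero)
  define E where "E = {w. dot3 w v = 0}"
  have E0: "0 \<in> E" by (cases v) (simp add: E_def zero)
  have p_dvd: "p dvd card E"
  proof -
    \<comment> \<open>The covectors vanishing on \<open>v\<close> form a nontrivial subgroup of an
      additive group of \<open>p\<close>-power order, so their number is a multiple of
      \<open>p\<close>.\<close>
    let ?V = "\<lparr>carrier = UNIV, monoid.mult = (+), one = 0\<rparr> :: ('k \<times> 'k \<times> 'k) monoid"
    have "\<exists>y. y + x = 0" for x :: "'k \<times> 'k \<times> 'k" by (rule exI[of _ "- x"]) simp
    then interpret V: group ?V by (intro groupI) (auto simp: add.assoc)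
    obtain x y z where vxyz: "v = (x, y, z)" by (cases v)
    \<comment> \<open>Up to sign, the cross products of \<open>v\<close> with the standard basis;
      they do not all vanish since \<open>v \<noteq> 0\<close>.\<close>
    have "(y, - x, 0) \<in> E" "(z, 0, - x) \<in> E" "(0, z, - y) \<in> E" by (simp_all add: E_def vxyz algebra_simps)
    then have "E \<noteq> {0}" using v(1) unfolding vxyz zero by force
    have "subgroup E ?V"
    proof (rule V.subgroupI)
      fix u assume u: "u \<in> E"
      have "inv\<^bsub>?V\<^esub> u = - u" by (rule V.inv_equality) auto
      then show "inv\<^bsub>?V\<^esub> u \<in> E" using u by (cases u) (auto simp: E_def vxyz algebra_simps add_eq_0_iff)
      fix w assume "w \<in> E"
      then show "u \<otimes>\<^bsub>?V\<^esub> w \<in> E" using u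
        by (simp add: E_def dot3_add)
    qed (use E0 in auto)
    then show ?thesis
      using V.p_subgroup_dvd_card[of p "a * 3" E] cardv p \<open>E \<noteq> {0}\<close> by (simp add: Coset.order_def)
  qed
  let ?inv = "\<lambda>A. inv\<^bsub>SL TYPE('k) 3\<^esub> A"
  have invP: "?inv A \<in> P" if "A \<in> P" for A using subgroup.m_inv_closed[OF P(1) that] .
  have inv_mult: "A * ?inv A = 1\<^sub>m 3" "?inv A * A = 1\<^sub>m 3" if "A \<in> P" for A
    using S.r_inv[of A] S.l_inv[of A] subgroup.mem_carrier[OF P(1) that] by auto
  \<comment> \<open>Matrices act on covectors from the right, so inverses are inserted to obtain a
    left action.\<close>
  obtain w where w: "w \<in> E" "w \<noteq> 0" "\<And>A. A \<in> P \<Longrightarrow> vec_mat3 w (?inv A) = w"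
  proof (rule p_group_fixes_another_point[OF grpP ordP p _ p_dvd, where act = "\<lambda>A w. vec_mat3 w (?inv A)" and e = 0])
    show "finite E" using finv by (rule rev_finite_subset) simp
    show "vec_mat3 w (?inv A) \<in> E" if "A \<in> carrier ?P" "w \<in> E" for A w
      using that v(2)[OF invP] by (simp add: E_def dot3_mat3)
    show "vec_mat3 w (?inv \<one>\<^bsub>?P\<^esub>) = w" for w using S.inv_one by (simp add: mat3_vec_one)
    show "vec_mat3 w (?inv (A \<otimes>\<^bsub>?P\<^esub> B)) = vec_mat3 (vec_mat3 w (?inv B)) (?inv A)"
      if "A \<in> carrier ?P" "B \<in> carrier ?P" for A B w
    proof -
      have "?inv (A \<otimes>\<^bsub>SL TYPE('k) 3\<^esub> B) = ?inv B \<otimes>\<^bsub>SL TYPE('k) 3\<^esub> ?inv A"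
        using that by (intro S.inv_mult_group) (auto intro: subgroup.mem_carrier[OF P(1)] simp del: SL_simps)
      then show ?thesis using that by (simp add: vec_mat3_mult Pc invP)
    qed
    show "0 \<in> E" by (rule E0)
    show "vec_mat3 0 (?inv A) = 0" for A by (simp add: vec_mat3_def zero)
  qed auto
  have "vec_mat3 w A = w" if A: "A \<in> P" for A
  proof -
    have "vec_mat3 w A = vec_mat3 (vec_mat3 w (?inv A)) A" using w(3)[OF A] by simp
    also have "\<dots> = vec_mat3 w (?inv A * A)" using A invP by (simp add: vec_mat3_mult Pc)
    finally show ?thesis using inv_mult(2)[OF A] by (simp add: mat3_vec_one)
  qed
  then show ?thesis using that[of v w] v w by (simp add: E_def)
qed

lemma dot3_dual:
  assumes "(v :: 'k::field \<times> 'k \<times> 'k) \<noteq> 0"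
  obtains x where "dot3 v x = 1"
proof -
  obtain v1 v2 v3 where v: "v = (v1, v2, v3)" by (cases v)
  then consider "v1 \<noteq> 0" | "v2 \<noteq> 0" | "v3 \<noteq> 0" using assms by (auto simp: zero_prod_def)
  then show ?thesis
  proof cases
    case 1 then show ?thesis using that[of "(1 / v1, 0, 0)"] v by simp
  next
    case 2 then show ?thesis using that[of "(0, 1 / v2, 0)"] v by simp
  next
    case 3 then show ?thesis using that[of "(0, 0, 1 / v3)"] v by simp
  qed
qed

text \<open>With \<open>v \<bullet> x = 1\<close> and \<open>w \<bullet> y = 1\<close>, the matrix with columns
  \<open>v\<close>, \<open>w \<times> x\<close>, \<open>y\<close> has determinant
  \<open>(v \<bullet> x) (w \<bullet> y) - (v \<bullet> w) (x \<bullet> y) = 1\<close>; its inverse consists of cross products.\<close>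

lemma flag_basis:
  fixes v w :: "'k::field \<times> 'k \<times> 'k"
  assumes "v \<noteq> 0" "w \<noteq> 0" "dot3 w v = 0"
  obtains g h where "g \<in> carrier_mat 3 3" "h \<in> carrier_mat 3 3" "h * g = 1\<^sub>m 3" "g * h = 1\<^sub>m 3"
    "mat3_vec g (1, 0, 0) = v" "vec_mat3 w g = (0, 0, 1)"
proof -
  obtain x where x: "dot3 v x = 1" using dot3_dual assms(1) by blast
  obtain y where y: "dot3 w y = 1" using dot3_dual assms(2) by blast
  obtain v1 v2 v3 w1 w2 w3 x1 x2 x3 y1 y2 y3 where
    c: "v = (v1, v2, v3)" "w = (w1, w2, w3)" "x = (x1, x2, x3)" "y = (y1, y2, y3)"
    by (cases v, cases w, cases x, cases y)
  have wv: "w1 * v1 + w2 * v2 + w3 * v3 = 0" and vx: "v1 * x1 + v2 * x2 + v3 * x3 = 1"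
    and wy: "w1 * y1 + w2 * y2 + w3 * y3 = 1" using assms(3) x y by (simp_all add: c)
  define u1 u2 u3 where "u1 = w2 * x3 - w3 * x2" and "u2 = w3 * x1 - w1 * x3" and "u3 = w1 * x2 - w2 * x1"
  let ?g = "mat3 v1 u1 y1 v2 u2 y2 v3 u3 y3"
  let ?h = "mat3 (u2 * y3 - u3 * y2) (u3 * y1 - u1 * y3) (u1 * y2 - u2 * y1)
    (y2 * v3 - y3 * v2) (y3 * v1 - y1 * v3) (y1 * v2 - y2 * v1) w1 w2 w3"
  have "v1 * (u2 * y3 - u3 * y2) + v2 * (u3 * y1 - u1 * y3) + v3 * (u1 * y2 - u2 * y1) =
    (v1 * x1 + v2 * x2 + v3 * x3) * (w1 * y1 + w2 * y2 + w3 * y3) -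
    (w1 * v1 + w2 * v2 + w3 * v3) * (x1 * y1 + x2 * y2 + x3 * y3)"
    by (simp add: u1_def u2_def u3_def algebra_simps)
  also have "\<dots> = 1" by (simp add: wv vx wy)
  finally have det: "v1 * (u2 * y3 - u3 * y2) + v2 * (u3 * y1 - u1 * y3) + v3 * (u1 * y2 - u2 * y1) = 1" .
  have det': "(y2 * v3 - y3 * v2) * u1 + (y3 * v1 - y1 * v3) * u2 + (y1 * v2 - y2 * v1) * u3 = 1"
    by (subst det[symmetric]) (simp add: algebra_simps)
  have wu: "w1 * u1 + w2 * u2 + w3 * u3 = 0" by (simp add: u1_def u2_def u3_def algebra_simps)
  have hg: "?h * ?g = 1\<^sub>m 3"
    unfolding mat3_mult mat3_one mat3_eq_iff
    by (intro conjI; (simp only: wv wy wu det'; fail)?) (use det in \<open>simp_all add: algebra_simps\<close>)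
  show ?thesis
  proof (rule that[of ?g ?h])
    show "?g * ?h = 1\<^sub>m 3" by (rule mat_mult_left_right_inverse[OF mat3_carrier mat3_carrier hg])
    show "mat3_vec ?g (1, 0, 0) = v" by (simp add: mat3_vec_def c del: One_nat_def)
    show "vec_mat3 w ?g = (0, 0, 1)" using wv wy wu by (simp add: vec_mat3_def c del: One_nat_def)
  qed (use hg in auto)
qed

text \<open>In a basis adapted to the flag the first column and the last row are those of the
  identity matrix; determinant 1 then forces the middle diagonal entry to be 1.\<close>

lemma p_subgroup_conjugate_unitriangular:
  fixes P :: "'k::field mat set"
  assumes fin: "finite (UNIV :: 'k set)" and p: "Factorial_Ring.prime p" and q: "CARD('k) = p ^ a" "a > 0"
    and P: "subgroup P (SL TYPE('k) 3)" "card P = p ^ n"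
  obtains g h where "g \<in> carrier_mat 3 3" "h \<in> carrier_mat 3 3" "h * g = 1\<^sub>m 3" "g * h = 1\<^sub>m 3"
    "\<And>A. A \<in> P \<Longrightarrow> h * A * g \<in> unitriangular"
proof -
  obtain v w :: "'k \<times> 'k \<times> 'k" where vw: "v \<noteq> 0" "w \<noteq> 0" "dot3 w v = 0"
    "\<And>A. A \<in> P \<Longrightarrow> mat3_vec A v = v" "\<And>A. A \<in> P \<Longrightarrow> vec_mat3 w A = w"
    using fixed_flag[OF fin p q P] by blast
  obtain g h where gh: "g \<in> carrier_mat 3 3" "h \<in> carrier_mat 3 3" "h * g = 1\<^sub>m 3" "g * h = 1\<^sub>m 3"
    "mat3_vec g (1, 0, 0) = v" "vec_mat3 w g = (0, 0, 1)"
    using flag_basis[OF vw(1-3)] by blast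
  have hv: "mat3_vec h v = (1, 0, 0)"
    using mat3_vec_mult[OF gh(2,1), of "(1, 0, 0)"] gh(3,5) by (simp add: mat3_vec_one)
  have wh: "vec_mat3 (0, 0, 1) h = w"
    using vec_mat3_mult[OF gh(1,2), of w] gh(4,6) by (simp add: mat3_vec_one)
  have "h * A * g \<in> unitriangular" if A: "A \<in> P" for A
  proof -
    have Ac: "A \<in> carrier_mat 3 3" "det A = 1" using subgroup.mem_carrier[OF P(1) A] by auto
    let ?C = "h * A * g"
    have C: "?C \<in> carrier_mat 3 3" and hA: "h * A \<in> carrier_mat 3 3" using gh Ac by auto
    have col: "mat3_vec ?C (1, 0, 0) = (1, 0, 0)"
      using gh vw(4)[OF A] hv by (simp add: mat3_vec_mult[OF hA gh(1)] mat3_vec_mult[OF gh(2) Ac(1)])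
    have row: "vec_mat3 (0, 0, 1) ?C = (0, 0, 1)"
      using gh vw(5)[OF A] wh by (simp add: vec_mat3_mult[OF hA gh(1)] vec_mat3_mult[OF gh(2) Ac(1)])
    have "det h * det g = det (1\<^sub>m 3 :: 'k mat)" using det_mult[OF gh(2,1)] gh(3) by simp
    then have "det ?C = 1"
      using det_mult[OF hA gh(1)] det_mult[OF gh(2) Ac(1)] Ac(2) by simp
    moreover obtain a b c d e f r s t where Cm: "?C = mat3 a b c d e f r s t" using mat3_cases[OF C] by blast
    moreover have "a = 1" "d = 0" "r = 0" using col unfolding Cm by (simp_all add: mat3_vec_def del: One_nat_def)
    moreover have "s = 0" "t = 1" using row unfolding Cm by (simp_all add: vec_mat3_def del: One_nat_def)
    ultimately have "?C = mat3 1 b c 0 1 f 0 0 1" by (simp add: det_mat3_upper)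
    then show ?thesis by (auto simp: unitriangular_def)
  qed
  then show ?thesis using that gh by blast
qed

text \<open>The multiplicity of \<open>p\<close> in the order of the group is found without
  computing that order. Some Sylow subgroup exists and embeds into \<open>unitriangular\<close> by
  conjugation, so its order is at most that of \<open>unitriangular\<close>, whose
  \<open>p\<close>-power order in turn divides the group order. Each such embedding is therefore
  bijective.\<close>

lemma
  assumes fin: "finite (UNIV :: 'k::field set)" and p: "Factorial_Ring.prime p" and q: "CARD('k) = p ^ a" "a > 0"
  shows sylow_unitriangular: "sylow_subgroup p unitriangular (SL TYPE('k) 3)"
    and sylow_iso_unitriangular: "sylow_subgroup p P (SL TYPE('k) 3) \<Longrightarrow>
      SL TYPE('k) 3\<lparr>carrier := P\<rparr> \<cong> SL TYPE('k) 3\<lparr>carrier := unitriangular\<rparr>"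
proof -
  let ?S = "SL TYPE('k) 3"
  let ?n = "multiplicity p (Coset.order ?S)"
  interpret S: group ?S by (rule group_SL)
  have finU: "finite (unitriangular :: 'k mat set)"
    using card_unitriangular[where 'k = 'k] q prime_gt_0_nat[OF p] by (intro card_ge_0_finite) simp
  have finS: "finite (carrier ?S)"
  proof -
    have "carrier ?S \<subseteq> range (\<lambda>(a, b, c, d, e, f, g, h, i). mat3 a b c d e f g h i)"
    proof
      fix A assume "A \<in> carrier ?S"
      then have "A \<in> carrier_mat 3 3" by simp
      then obtain a b c d e f g h i where "A = mat3 a b c d e f g h i" by (rule mat3_cases)
      then show "A \<in> range (\<lambda>(a, b, c, d, e, f, g, h, i). mat3 a b c d e f g h i)"
        by (intro image_eqI[of _ _ "(a, b, c, d, e, f, g, h, i)"]) auto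
    qed
    then show ?thesis by (rule finite_subset) (simp add: fin finite_Prod_UNIV)
  qed
  then have ord0: "Coset.order ?S \<noteq> 0" using S.order_gt_0_iff_finite by simp
  have cardU: "card (unitriangular :: 'k mat set) = p ^ (a * 3)"
    by (simp add: card_unitriangular q power_mult)
  have "p ^ (a * 3) dvd Coset.order ?S"
    using S.lagrange[OF unitriangular_subgroup] cardU by (metis dvd_triv_right)
  then have le: "a * 3 \<le> ?n"
    using ord0 p by (intro multiplicity_geI) auto
  have inj: "\<exists>\<phi>. \<phi> \<in> hom (?S\<lparr>carrier := P\<rparr>) (?S\<lparr>carrier := unitriangular\<rparr>) \<and> inj_on \<phi> P"
    if P: "subgroup P ?S" "card P = p ^ ?n" for P
  proof -
    obtain g h where gh: "g \<in> carrier_mat 3 3" "h \<in> carrier_mat 3 3" "h * g = 1\<^sub>m 3" "g * h = 1\<^sub>m 3"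
      "\<And>A. A \<in> P \<Longrightarrow> h * A * g \<in> unitriangular"
      using p_subgroup_conjugate_unitriangular[OF fin p q P] by blast
    have Pc: "A \<in> carrier_mat 3 3" if "A \<in> P" for A using subgroup.mem_carrier[OF P(1) that] by simp
    have undo: "g * (h * A * g) * h = A" if A: "A \<in> carrier_mat 3 3" for A
    proof -
      have "g * (h * A * g) * h = (g * h) * A * (g * h)"
        using gh(1,2) A by (simp add: assoc_mult_mat[of _ 3 3 _ 3 _ 3] mult_carrier_mat[of _ 3 3 _ 3])
      then show ?thesis using gh(4) A by simp
    qed
    have mult: "h * (A * B) * g = (h * A * g) * (h * B * g)" if AB: "A \<in> carrier_mat 3 3" "B \<in> carrier_mat 3 3" for A B
    proof -
      have "(h * A * g) * (h * B * g) = h * A * (g * h) * B * g"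
        using gh(1,2) AB by (simp add: assoc_mult_mat[of _ 3 3 _ 3 _ 3] mult_carrier_mat[of _ 3 3 _ 3])
      also have "\<dots> = h * (A * B) * g"
        using gh AB by (simp add: assoc_mult_mat[of _ 3 3 _ 3 _ 3] mult_carrier_mat[of _ 3 3 _ 3])
      finally show ?thesis by simp
    qed
    show ?thesis
    proof (intro exI conjI)
      show "(\<lambda>A. h * A * g) \<in> hom (?S\<lparr>carrier := P\<rparr>) (?S\<lparr>carrier := unitriangular\<rparr>)"
        using gh(5) mult Pc by (intro homI) auto
      show "inj_on (\<lambda>A. h * A * g) P"
        by (rule inj_onI) (metis undo Pc)
    qed
  qed
  have card_eq: "p ^ ?n = p ^ (a * 3)" if P: "subgroup P ?S" "card P = p ^ ?n" for P
  proof -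
    obtain \<phi> where "\<phi> \<in> hom (?S\<lparr>carrier := P\<rparr>) (?S\<lparr>carrier := unitriangular\<rparr>)" "inj_on \<phi> P"
      using inj[OF P] by blast
    then have "card P \<le> card (unitriangular :: 'k mat set)"
      using finU by (intro card_inj_on_le[of \<phi>]) (auto simp: hom_def)
    moreover have "p ^ (a * 3) \<le> p ^ ?n" using le prime_gt_0_nat[OF p] by (simp add: power_increasing)
    ultimately show ?thesis using P(2) cardU by simp
  qed
  obtain m where "Coset.order ?S = p ^ ?n * m" using multiplicity_dvd by blast
  then obtain P where P: "subgroup P ?S" "card P = p ^ ?n"
    using sylow_thm[OF p S.group_axioms _ finS] by blast
  have pn: "p ^ ?n = p ^ (a * 3)" by (rule card_eq[OF P])
  show "sylow_subgroup p unitriangular ?S"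
    unfolding sylow_subgroup_def using unitriangular_subgroup cardU pn by simp
  show "?S\<lparr>carrier := P\<rparr> \<cong> ?S\<lparr>carrier := unitriangular\<rparr>" if "sylow_subgroup p P ?S" for P
  proof -
    have P: "subgroup P ?S" "card P = p ^ ?n" using that by (auto simp: sylow_subgroup_def)
    obtain \<phi> where \<phi>: "\<phi> \<in> hom (?S\<lparr>carrier := P\<rparr>) (?S\<lparr>carrier := unitriangular\<rparr>)" "inj_on \<phi> P"
      using inj[OF P] by blast
    have "\<phi> ` P = unitriangular"
      using \<phi> finU cardU pn P(2) by (intro card_subset_eq) (auto simp: card_image hom_def)
    then have "\<phi> \<in> iso (?S\<lparr>carrier := P\<rparr>) (?S\<lparr>carrier := unitriangular\<rparr>)"
      using \<phi> by (simp add: iso_def bij_betw_def)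
    then show ?thesis by (auto simp: is_iso_def)
  qed
qed

text \<open>Adding the quadratic term \<open>qre v * qim v\<close> to \<open>t\<close> turns the
  alternating cocycle into \<open>2 * qre v * qim w\<close>; halving gives the corner entry of a
  matrix product.\<close>

lemma heisenberg_iso_unitriangular:
  assumes fin: "finite (UNIV :: 'k::field set)" and odd: "odd CARD('k)"
  shows "(heisenberg :: ('k qext \<times> 'k) monoid) \<cong> SL TYPE('k) 3\<lparr>carrier := unitriangular\<rparr>"
proof -
  have ns: "has_nonsquare TYPE('k)" by (rule has_nonsquare_odd[OF fin odd])
  have two: "(2 :: 'k) \<noteq> 0" by (rule two_neq_zero[OF fin odd])
  have "(2 :: 'k) * 2 \<noteq> 0" by (rule no_zero_divisors[OF two two])
  then have four: "(4 :: 'k) \<noteq> 0" by simp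
  define \<phi> :: "'k qext \<times> 'k \<Rightarrow> 'k mat" where
    "\<phi> = (\<lambda>(v, t). mat3 1 (qre v) ((t + qre v * qim v) / 2) 0 1 (qim v) 0 0 1)"
  have "\<phi> \<in> hom heisenberg (SL TYPE('k) 3\<lparr>carrier := unitriangular\<rparr>)"
  proof (rule homI)
    show "\<phi> z \<in> carrier (SL TYPE('k) 3\<lparr>carrier := unitriangular\<rparr>)" for z
      by (cases z) (auto simp: \<phi>_def unitriangular_def)
    show "\<phi> (z \<otimes>\<^bsub>heisenberg\<^esub> z') = \<phi> z \<otimes>\<^bsub>SL TYPE('k) 3\<lparr>carrier := unitriangular\<rparr>\<^esub> \<phi> z'" for z z'
      using two four by (cases z, cases z') (simp add: \<phi>_def heisenberg_def mat3_mult mat3_eq_iff field_simps)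
  qed
  moreover have "bij_betw \<phi> UNIV unitriangular"
  proof (rule bij_betw_imageI)
    show "inj \<phi>" using two by (auto simp: inj_def \<phi>_def mat3_eq_iff qext_eq_iff)
    show "range \<phi> = unitriangular"
    proof
      show "range \<phi> \<subseteq> unitriangular" by (auto simp: \<phi>_def unitriangular_def)
      show "unitriangular \<subseteq> range \<phi>"
      proof
        fix A :: "'k mat" assume "A \<in> unitriangular"
        then obtain x y z where "A = mat3 1 x z 0 1 y 0 0 1" by (auto simp: unitriangular_def)
        then have "A = \<phi> (qpair x y, 2 * z - x * y)" using two ns by (simp add: \<phi>_def qim_qpair)
        then show "A \<in> range \<phi>" by blast
      qed
    qed
  qed
  ultimately have "\<phi> \<in> iso heisenberg (SL TYPE('k) 3\<lparr>carrier := unitriangular\<rparr>)"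
    by (simp add: iso_def heisenberg_def)
  then show ?thesis by (auto simp: is_iso_def)
qed

section \<open>Automorphisms of the Heisenberg group\<close>

lemma group_heisenberg: "group (heisenberg :: ('k::field qext \<times> 'k) monoid)"
proof (rule groupI)
  fix z :: "'k qext \<times> 'k"
  obtain v t where z: "z = (v, t)" by (cases z)
  have "(- v, - t) \<otimes>\<^bsub>heisenberg\<^esub> z = \<one>\<^bsub>heisenberg\<^esub>"
    by (simp add: z heisenberg_def algebra_simps)
  then show "\<exists>y\<in>carrier heisenberg. y \<otimes>\<^bsub>heisenberg\<^esub> z = \<one>\<^bsub>heisenberg\<^esub>"
    by (intro bexI[of _ "(- v, - t)"]) (simp_all add: heisenberg_def)
qed (auto simp: heisenberg_def algebra_simps)

lemma nat_pow_AutoGroup: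
  assumes "group G" "\<phi> \<in> auto G"
  shows "\<phi> [^]\<^bsub>AutoGroup G\<^esub> (n::nat) = restrict (\<phi> ^^ n) (carrier G)"
proof -
  interpret A: group "AutoGroup G" by (rule group.AutoGroup[OF assms(1)])
  have car: "carrier (AutoGroup G) = auto G" by (simp add: AutoGroup_def)
  have mult: "g \<otimes>\<^bsub>AutoGroup G\<^esub> f = compose (carrier G) g f" if "g \<in> Bij (carrier G)" "f \<in> Bij (carrier G)" for g f
    using that by (simp add: AutoGroup_def BijGroup_def)
  have \<phi>: "\<phi> x \<in> carrier G" if "x \<in> carrier G" for x
    using assms(2) that by (auto simp: auto_def hom_def)
  show ?thesis
  proof (induction n)
    case 0
    then show ?case by (simp add: AutoGroup_def BijGroup_def)
  next
    case (Suc n)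
    have "\<phi> [^]\<^bsub>AutoGroup G\<^esub> n \<in> auto G" using A.nat_pow_closed[of \<phi> n] assms(2) car by simp
    then have "\<phi> [^]\<^bsub>AutoGroup G\<^esub> Suc n = compose (carrier G) (\<phi> [^]\<^bsub>AutoGroup G\<^esub> n) \<phi>"
      using assms(2) mult by (simp add: auto_def)
    also have "\<dots> = compose (carrier G) (restrict (\<phi> ^^ n) (carrier G)) \<phi>" by (simp only: Suc)
    also have "\<dots> = restrict (\<phi> ^^ Suc n) (carrier G)"
      using \<phi> by (auto simp: compose_def funpow_swap1 fun_eq_iff)
    finally show ?case .
  qed
qed

text \<open>Translates the order of an automorphism into pointwise periods; both directions of the
  equivalence rest on it.\<close>

lemma ord_AutoGroup_dvd_iff:
  assumes "group G" "\<phi> \<in> auto G"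
  shows "group.ord (AutoGroup G) \<phi> dvd n \<longleftrightarrow> (\<forall>x\<in>carrier G. (\<phi> ^^ n) x = x)"
proof -
  interpret A: group "AutoGroup G" by (rule group.AutoGroup[OF assms(1)])
  have "A.ord \<phi> dvd n \<longleftrightarrow> \<phi> [^]\<^bsub>AutoGroup G\<^esub> n = \<one>\<^bsub>AutoGroup G\<^esub>"
    using A.pow_eq_id[of \<phi> n] assms(2) by (simp add: AutoGroup_def)
  also have "\<dots> \<longleftrightarrow> (\<forall>x\<in>carrier G. (\<phi> ^^ n) x = x)"
    unfolding nat_pow_AutoGroup[OF assms]
    by (auto simp: AutoGroup_def BijGroup_def fun_eq_iff restrict_def split: if_splits)
  finally show ?thesis .
qed

text \<open>Multiplying both arguments of the cocycle by \<open>l\<close> multiplies it by the norm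
  of \<open>l\<close>, which dictates the factor on the center.\<close>

definition heisenberg_twist :: "'k::field qext \<Rightarrow> 'k qext \<times> 'k \<Rightarrow> 'k qext \<times> 'k" where
  "heisenberg_twist l = (\<lambda>(v, t). (l * v, qnorm l * t))"

lemma heisenberg_twist_hom: "heisenberg_twist l \<in> hom heisenberg heisenberg"
  by (rule homI) (auto simp: heisenberg_twist_def heisenberg_def qnorm_def algebra_simps)

lemma qnorm_mult: "qnorm (z * w) = qnorm z * qnorm w"
  by (simp add: qnorm_def algebra_simps)

lemma heisenberg_twist_pow: "(heisenberg_twist l ^^ n) = heisenberg_twist (l ^ n)"
proof (induction n)
  case 0
  have "qnorm (1 :: 'a qext) = 1" by (simp add: qnorm_def)
  then show ?case by (auto simp: heisenberg_twist_def)
next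
  case (Suc n)
  then show ?case by (auto simp: heisenberg_twist_def qnorm_mult mult.assoc)
qed

lemma heisenberg_twist_eq_id_iff: "heisenberg_twist l = id \<longleftrightarrow> l = 1"
proof
  assume "heisenberg_twist l = id"
  from fun_cong[OF this, of "(1, 0)"] show "l = 1" by (simp add: heisenberg_twist_def)
qed (auto simp: heisenberg_twist_def qnorm_def)

text \<open>The twist by a primitive element is transported along the isomorphism. Its
  \<open>n\<close>-th power is the twist by \<open>l ^ n\<close>, trivial exactly when
  \<open>CARD('k qext) - 1\<close> divides \<open>n\<close>.\<close>

lemma automorphism_of_heisenberg_iso:
  fixes G (structure)
  assumes G: "group G" and iso: "G \<cong> (heisenberg :: ('k::field qext \<times> 'k) monoid)"
    and fin: "finite (UNIV :: 'k set)"
  shows "\<exists>\<phi>\<in>auto G. group.ord (AutoGroup G) \<phi> = CARD('k qext) - 1"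
proof -
  interpret group G by fact
  interpret A: group "AutoGroup G" by (rule AutoGroup)
  have finK: "finite (UNIV :: 'k qext set)" by (rule finite_qext[OF fin])
  obtain l :: "'k qext" where l: "primitive_element l" using primitive_element_exists[OF finK] by blast
  let ?S = "carrier G"
  obtain \<theta> where "\<theta> \<in> iso G (heisenberg :: ('k qext \<times> 'k) monoid)" using iso by (auto simp: is_iso_def)
  then have \<theta>: "\<theta> \<in> hom G heisenberg" "bij_betw \<theta> ?S UNIV" by (auto simp: iso_def heisenberg_def)
  define \<eta> where "\<eta> = inv_into ?S \<theta>"
  have \<theta>\<eta>: "\<theta> (\<eta> y) = y" and \<eta>c: "\<eta> y \<in> ?S" for y
    using \<theta>(2) unfolding \<eta>_def by (simp_all add: bij_betw_def f_inv_into_f inv_into_into)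
  have \<eta>\<theta>: "\<eta> (\<theta> x) = x" if "x \<in> ?S" for x
    using \<theta>(2) that unfolding \<eta>_def by (simp add: bij_betw_def)
  have \<theta>_mult: "\<theta> (x \<otimes> y) = \<theta> x \<otimes>\<^bsub>heisenberg\<^esub> \<theta> y" if "x \<in> ?S" "y \<in> ?S" for x y
    using hom_mult[OF \<theta>(1) that] .
  let ?\<alpha> = "heisenberg_twist l"
  have \<alpha>_mult: "?\<alpha> (y \<otimes>\<^bsub>heisenberg\<^esub> y') = ?\<alpha> y \<otimes>\<^bsub>heisenberg\<^esub> ?\<alpha> y'" for y y'
    by (rule hom_mult[OF heisenberg_twist_hom]) (simp_all add: heisenberg_def)
  \<comment> \<open>Members of \<open>auto G\<close> are extensional, hence the restriction.\<close>
  define \<phi> where "\<phi> = restrict (\<lambda>x. \<eta> (?\<alpha> (\<theta> x))) ?S"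
  have \<phi>_pow: "(\<phi> ^^ n) x = \<eta> ((?\<alpha> ^^ n) (\<theta> x))" if "x \<in> ?S" for n x
    by (induction n) (use that in \<open>simp_all add: \<phi>_def \<eta>\<theta> \<theta>\<eta> \<eta>c\<close>)
  have period: "(\<forall>x\<in>?S. (\<phi> ^^ n) x = x) \<longleftrightarrow> (CARD('k qext) - 1) dvd n" for n
  proof -
    have "(\<forall>x\<in>?S. (\<phi> ^^ n) x = x) \<longleftrightarrow> (\<forall>y. (?\<alpha> ^^ n) y = y)"
    proof (intro iffI allI ballI)
      fix y assume "\<forall>x\<in>?S. (\<phi> ^^ n) x = x"
      then have "\<theta> ((\<phi> ^^ n) (\<eta> y)) = \<theta> (\<eta> y)" using \<eta>c by simp
      then show "(?\<alpha> ^^ n) y = y" by (simp add: \<phi>_pow \<eta>c \<theta>\<eta>)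
    next
      fix x assume "\<forall>y. (?\<alpha> ^^ n) y = y" and x: "x \<in> ?S"
      then have "(?\<alpha> ^^ n) (\<theta> x) = \<theta> x" by blast
      then show "(\<phi> ^^ n) x = x" using x by (simp add: \<phi>_pow \<eta>\<theta>)
    qed
    also have "\<dots> \<longleftrightarrow> l ^ n = 1"
      using heisenberg_twist_eq_id_iff[of "l ^ n"] by (simp add: heisenberg_twist_pow fun_eq_iff)
    also have "\<dots> \<longleftrightarrow> (CARD('k qext) - 1) dvd n" by (rule primitive_element_eq_1_iff[OF finK l])
    finally show ?thesis .
  qed
  have "CARD('k qext) - 1 > 0" using card_mono[OF finK, of "{0, 1}"] by simp
  have \<phi>_auto: "\<phi> \<in> auto G"
  proof -
    have "\<phi> \<in> hom G G"
    proof (rule homI)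
      show "\<phi> x \<in> ?S" if "x \<in> ?S" for x using that \<eta>c by (simp add: \<phi>_def)
      fix x y assume xy: "x \<in> ?S" "y \<in> ?S"
      have "\<theta> (\<phi> (x \<otimes> y)) = \<theta> (\<phi> x \<otimes> \<phi> y)"
        using xy by (simp add: \<phi>_def \<theta>\<eta> \<eta>c \<theta>_mult \<alpha>_mult)
      moreover have "\<phi> (x \<otimes> y) \<in> ?S" "\<phi> x \<otimes> \<phi> y \<in> ?S" using xy \<eta>c by (simp_all add: \<phi>_def)
      ultimately show "\<phi> (x \<otimes> y) = \<phi> x \<otimes> \<phi> y" by (metis \<eta>\<theta>)
    qed
    moreover have "bij_betw \<phi> ?S ?S"
    \<comment> \<open>Since the period is \<open>CARD('k qext) - 1\<close>, the power with one less
      in the exponent is the inverse.\<close>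
    proof (rule bij_betw_byWitness[where f' = "\<phi> ^^ (CARD('k qext) - 2)"])
      have *: "\<forall>x\<in>?S. (\<phi> ^^ (CARD('k qext) - 1)) x = x" by (rule period[THEN iffD2, OF dvd_refl])
      have **: "CARD('k qext) - 1 = Suc (CARD('k qext) - 2)" using \<open>CARD('k qext) - 1 > 0\<close> by simp
      show "\<forall>x\<in>?S. (\<phi> ^^ (CARD('k qext) - 2)) (\<phi> x) = x" using * unfolding ** by (simp add: funpow_swap1)
      show "\<forall>x\<in>?S. \<phi> ((\<phi> ^^ (CARD('k qext) - 2)) x) = x" using * unfolding ** by simp
      show "\<phi> ` ?S \<subseteq> ?S" by (rule image_subsetI) (simp add: \<phi>_def \<eta>c)
      show "(\<phi> ^^ (CARD('k qext) - 2)) ` ?S \<subseteq> ?S" by (rule image_subsetI) (simp add: \<phi>_pow \<eta>c)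
    qed
    moreover have "\<phi> \<in> extensional ?S" by (simp add: \<phi>_def)
    ultimately show ?thesis by (simp add: auto_def Bij_def)
  qed
  have "A.ord \<phi> dvd n \<longleftrightarrow> (CARD('k qext) - 1) dvd n" for n
    using ord_AutoGroup_dvd_iff[OF G \<phi>_auto] period by simp
  then have "A.ord \<phi> = CARD('k qext) - 1" by (meson dvd_antisym dvd_refl)
  then show ?thesis using \<phi>_auto by blast
qed

section \<open>The equivalence\<close>

theorem corollary2:
  fixes G :: "('g, 'm) monoid_scheme" and p a :: nat
  assumes "Factorial_Ring.prime p" and "odd p"
    and "semi_extraspecial p G"
    and "a > 0"
    and "subgroup_index G (derived_subgroup G) = p ^ (2 * a)"
    and "CARD('k::field) = p ^ a"
  shows "(\<exists>\<phi>\<in>auto G. group.ord (AutoGroup G) \<phi> = subgroup_index G (derived_subgroup G) - 1)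
    \<longleftrightarrow> (\<exists>P. sylow_subgroup p P (SL TYPE('k) 3) \<and> G \<cong> (SL TYPE('k) 3)\<lparr>carrier := P\<rparr>)"
proof -
  interpret semi_extraspecial_group G p by (rule semi_extraspecial_imp_group) fact
  let ?U = "SL TYPE('k) 3\<lparr>carrier := unitriangular\<rparr>"
  have fin: "finite (UNIV :: 'k set)"
    using assms(1,6) by (intro card_ge_0_finite) (simp add: prime_gt_0_nat)
  have oddk: "odd CARD('k)" using assms(2,6) by simp
  have "(of_nat p :: 'k) ^ a = 0" using of_nat_card_eq_0[OF fin] assms(6) by simp
  then have char: "of_nat p = (0 :: 'k)" by simp
  have card_sq: "p ^ (2 * a) = CARD('k) * CARD('k)" by (simp add: assms(6) mult_2 power_add)
  have cardK: "CARD('k qext) = p ^ (2 * a)" using card_qext[OF has_nonsquare_odd[OF fin oddk]] card_sq by simp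
  have heis_U: "(heisenberg :: ('k qext \<times> 'k) monoid) \<cong> ?U" by (rule heisenberg_iso_unitriangular[OF fin oddk])
  have U_heis: "?U \<cong> (heisenberg :: ('k qext \<times> 'k) monoid)" by (rule group.iso_sym[OF group_heisenberg heis_U])
  show ?thesis
  proof
    assume "\<exists>\<phi>\<in>auto G. group.ord (AutoGroup G) \<phi> = subgroup_index G (derived_subgroup G) - 1"
    then obtain \<phi> where \<phi>: "\<phi> \<in> auto G" and ord: "group.ord (AutoGroup G) \<phi> = p ^ (2 * a) - 1"
      using assms(5) by auto
    \<comment> \<open>Divisibility of \<open>n\<close> by the order gives both locale assumptions on
      \<open>\<phi>\<close>: \<open>n\<close> equal to the order yields the period, and a smaller
      positive \<open>n\<close> is not divisible, which yields faithfulness.\<close>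
    note period = ord_AutoGroup_dvd_iff[OF is_group \<phi>, unfolded ord]
    interpret singer_automorphism G p \<phi> "p ^ (2 * a)"
    proof unfold_locales
      show "\<phi> \<in> hom G G" using \<phi> by (simp add: auto_def)
      show "(\<phi> ^^ (p ^ (2 * a) - 1)) x = x" if "x \<in> carrier G" for x
        using period[THEN iffD1, OF dvd_refl] that by blast
      show "\<exists>x\<in>carrier G. (\<phi> ^^ m) x \<noteq> x" if "0 < m" "m < p ^ (2 * a) - 1" for m
        using period[of m] that by (auto dest: dvd_imp_le)
      show "subgroup_index G (center G) = p ^ (2 * a)" using assms(5) by (simp add: derived_eq_center)
      show "1 < p ^ (2 * a)" 
        using one_less_power[OF prime_gt_1_nat[OF assms(1)], of "2 * a"] assms(4) by simp
      show "p dvd p ^ (2 * a)" using assms(4) by (simp add: dvd_power)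
    qed
    have "G \<cong> (heisenberg :: ('k qext \<times> 'k) monoid)"
      by (rule isomorphic_heisenberg[OF fin oddk card_sq char assms(2)])
    then have "G \<cong> ?U" using heis_U by (rule iso_trans)
    then show "\<exists>P. sylow_subgroup p P (SL TYPE('k) 3) \<and> G \<cong> (SL TYPE('k) 3)\<lparr>carrier := P\<rparr>"
      using sylow_unitriangular[OF fin assms(1,6,4)] by blast
  next
    assume "\<exists>P. sylow_subgroup p P (SL TYPE('k) 3) \<and> G \<cong> (SL TYPE('k) 3)\<lparr>carrier := P\<rparr>"
    then obtain P where P: "sylow_subgroup p P (SL TYPE('k) 3)" and G: "G \<cong> (SL TYPE('k) 3)\<lparr>carrier := P\<rparr>" by blast
    have "G \<cong> ?U" using G sylow_iso_unitriangular[OF fin assms(1,6,4) P] by (rule iso_trans)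
    then have "G \<cong> (heisenberg :: ('k qext \<times> 'k) monoid)" using U_heis by (rule iso_trans)
    then show "\<exists>\<phi>\<in>auto G. group.ord (AutoGroup G) \<phi> = subgroup_index G (derived_subgroup G) - 1"
      using automorphism_of_heisenberg_iso[OF is_group _ fin] cardK assms(5) by simp
  qed
qed

end
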